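(* Let $k$ be a commutative ring with unit. For any $\Delta^{\mathrm{epi}}$-module $F$ (covariant functor $F\colon\Delta^{\mathrm{epi}}\to k\text{-mod}$), $$H_p^{\mathrm{bar}}(F)\cong \mathrm{Tor}_p^{\Delta^{\mathrm{epi}}}(b^{\mathrm{epi}},F)\qquad\text{for all }p\geq 0.$$
   Context: $\Delta^{\mathrm{epi}}$ is the category with objects $[n]=\{0<1<\dots<n\}$, $n\ge0$, and order-preserving surjections as morphisms. For $0\le i\le n-1$, $d_i\colon[n]\to[n-1]$ is given by $d_i(j)=j$ for $j\le i$ and $d_i(j)=j-1$ for $j>i$. The bar homology $H^{\mathrm{bar}}_*(F)$ of a $\Delta^{\mathrm{epi}}$-module $F$ is the homology of the chain complex $C^{\mathrm{bar}}_*(F)$ with $C^{\mathrm{bar}}_n(F)=F[n]$, $n\ge 0$, and differential $b'=\sum_{i=0}^{n-1}(-1)^iF(d_i)\colon F[n]\to F[n-1]$. For $m\ge0$ let $\Delta^{\mathrm{epi}}_m$ be the contravariant functor $[l]\mapsto k[\Delta^{\mathrm{epi}}([l],[m])]$ (free $k$-module on the set of morphisms). The contravariant functor $b^{\mathrm{epi}}$ is the cokernel of $(d_0)_*\colon\Delta^{\mathrm{epi}}_1\to\Delta^{\mathrm{epi}}_0$; thus $b^{\mathrm{epi}}[0]\cong k$ and $b^{\mathrm{epi}}[n]=0$ for $n>0$. $\mathrm{Tor}^{\Delta^{\mathrm{epi}}}_*(M,F)$ denotes the left derived functors of the tensor product $M\otimes_{\Delta^{\mathrm{epi}}}F$ (coend)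 of a contravariant functor $M$ and a covariant functor $F$ from $\Delta^{\mathrm{epi}}$ to $k$-modules. *)

theory Defs
  imports "HOL-Algebra.Module" "HOL-Algebra.AbelCoset" "HOL-Library.FuncSet"
begin

section \<open>Modules over a commutative ring\<close>

definition module_homs ::
    "('k, 'z) ring_scheme \<Rightarrow> ('k, 'a) module \<Rightarrow> ('k, 'b) module \<Rightarrow> ('a \<Rightarrow> 'b) set" where
  "module_homs k M N = {h \<in> carrier M \<rightarrow> carrier N.
     (\<forall>x\<in>carrier M. \<forall>y\<in>carrier M. h (x \<oplus>\<^bsub>M\<^esub> y) = h x \<oplus>\<^bsub>N\<^esub> h y) \<and>
     (\<forall>a\<in>carrier k. \<forall>x\<in>carrier M. h (a \<odot>\<^bsub>M\<^esub> x) = a \<odot>\<^bsub>N\<^esub> h x)}"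

definition module_iso ::
    "('k, 'z) ring_scheme \<Rightarrow> ('k, 'a) module \<Rightarrow> ('k, 'b) module \<Rightarrow> bool" where
  "module_iso k M N \<longleftrightarrow> (\<exists>h \<in> module_homs k M N. bij_betw h (carrier M) (carrier N))"

definition module_span ::
    "('k, 'z) ring_scheme \<Rightarrow> ('k, 'a) module \<Rightarrow> 'a set \<Rightarrow> 'a set" where
  "module_span k M S = \<Inter>{N. submodule N k M \<and> S \<subseteq> N}"

text \<open>A map \<open>h : M \<rightarrow> M'\<close> sending the submodule of \<open>M\<close> into the submodule \<open>N'\<close> of \<open>M'\<close> induces
  a map of quotients. The image of a coset is written as the union of the cosets of the images
  of its elements; these all coincide.\<close>

definition quotient_map ::
    "('k, 'b) module \<Rightarrow> 'b set \<Rightarrow> ('a \<Rightarrow> 'b) \<Rightarrow> 'a set \<Rightarrow> 'b set" where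
  "quotient_map M' N' h X = (\<Union>x\<in>X. N' +>\<^bsub>M'\<^esub> h x)"

text \<open>The record type of modules extends that of rings, so its fields \<open>mult\<close> and \<open>one\<close> carry
  no information about a module and are left unspecified.\<close>

definition quotient_module :: "('k, 'a) module \<Rightarrow> 'a set \<Rightarrow> ('k, 'a set) module" where
  "quotient_module M N =
     \<lparr>carrier = a_rcosets\<^bsub>M\<^esub> N, mult = undefined, one = undefined, zero = N, add = set_add M,
      smult = (\<lambda>a. quotient_map M N (\<lambda>x. a \<odot>\<^bsub>M\<^esub> x))\<rparr>"

definition free_module :: "('k, 'z) ring_scheme \<Rightarrow> 'x set \<Rightarrow> ('k, 'x \<Rightarrow> 'k) module" where
  "free_module k X =
     \<lparr>carrier = {c. (\<forall>x. c x \<in> carrier k) \<and> (\<forall>x. x \<notin> X \<longrightarrow> c x = \<zero>\<^bsub>k\<^esub>) \<and>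
                    finite {x. c x \<noteq> \<zero>\<^bsub>k\<^esub>}},
      mult = undefined, one = undefined,
      zero = (\<lambda>x. \<zero>\<^bsub>k\<^esub>), add = (\<lambda>c d x. c x \<oplus>\<^bsub>k\<^esub> d x), smult = (\<lambda>a c x. a \<otimes>\<^bsub>k\<^esub> c x)\<rparr>"

definition free_gen :: "('k, 'z) ring_scheme \<Rightarrow> 'x \<Rightarrow> 'x \<Rightarrow> 'k" where
  "free_gen k x = (\<lambda>y. if y = x then \<one>\<^bsub>k\<^esub> else \<zero>\<^bsub>k\<^esub>)"

text \<open>The linear extension of a map \<open>\<phi>\<close> defined on the basis \<open>X\<close>.\<close>

definition free_map ::
    "('k, 'z) ring_scheme \<Rightarrow> 'x set \<Rightarrow> ('x \<Rightarrow> 'y) \<Rightarrow> ('x \<Rightarrow> 'k) \<Rightarrow> 'y \<Rightarrow> 'k" where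
  "free_map k X \<phi> c = (\<lambda>y. \<Oplus>\<^bsub>k\<^esub>x \<in> {x \<in> X. c x \<noteq> \<zero>\<^bsub>k\<^esub> \<and> \<phi> x = y}. c x)"


section \<open>Homology of a non-negatively graded chain complex\<close>

text \<open>The differential \<open>d n\<close> goes from degree \<open>n + 1\<close> to degree \<open>n\<close>.\<close>

definition cycles ::
    "(nat \<Rightarrow> ('k, 'a) module) \<Rightarrow> (nat \<Rightarrow> 'a \<Rightarrow> 'a) \<Rightarrow> nat \<Rightarrow> 'a set" where
  "cycles C d n = (case n of 0 \<Rightarrow> carrier (C 0)
     | Suc m \<Rightarrow> {x \<in> carrier (C (Suc m)). d m x = \<zero>\<^bsub>C m\<^esub>})"

definition boundaries ::
    "(nat \<Rightarrow> ('k, 'a) module) \<Rightarrow> (nat \<Rightarrow> 'a \<Rightarrow> 'a) \<Rightarrow> nat \<Rightarrow> 'a set" where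
  "boundaries C d n = d n ` carrier (C (Suc n))"

definition homology ::
    "(nat \<Rightarrow> ('k, 'a) module) \<Rightarrow> (nat \<Rightarrow> 'a \<Rightarrow> 'a) \<Rightarrow> nat \<Rightarrow> ('k, 'a set) module" where
  "homology C d n = quotient_module ((C n)\<lparr>carrier := cycles C d n\<rparr>) (boundaries C d n)"


section \<open>The category of finite ordinals and order-preserving surjections\<close>

text \<open>The object \<open>[n] = {0 < \<dots> < n}\<close> is represented by the number \<open>n\<close>, and a morphism
  \<open>[l] \<rightarrow> [m]\<close> by a function that is \<open>undefined\<close> outside \<open>{0..l}\<close>, so that morphisms are equal
  as soon as they agree on \<open>[l]\<close>.\<close>

definition epi_mor :: "nat \<Rightarrow> nat \<Rightarrow> (nat \<Rightarrow> nat) set" where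
  "epi_mor l m = {f \<in> extensional {0..l}. mono_on {0..l} f \<and> f ` {0..l} = {0..m}}"

abbreviation epi_id :: "nat \<Rightarrow> nat \<Rightarrow> nat" where
  "epi_id n \<equiv> (\<lambda>j\<in>{0..n}. j)"

text \<open>\<open>face n i\<close> is \<open>d\<^sub>i : [n] \<rightarrow> [n - 1]\<close>.\<close>

definition face :: "nat \<Rightarrow> nat \<Rightarrow> nat \<Rightarrow> nat" where
  "face n i = (\<lambda>j\<in>{0..n}. if j \<le> i then j else j - 1)"


section \<open>Functors to modules\<close>

text \<open>The same data serve for covariant and contravariant functors: for \<open>f : [l] \<rightarrow> [m]\<close> the map
  \<open>arr F l m f\<close> goes from \<open>ob F l\<close> to \<open>ob F m\<close> if \<open>F\<close> is covariant, and from \<open>ob F m\<close> to \<open>ob F l\<close>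
  if \<open>F\<close> is contravariant. A single type \<open>'a\<close> for the elements of all the modules \<open>F[n]\<close> is no
  restriction, as there are only countably many objects.\<close>

record ('k, 'a) epi_functor =
  ob :: "nat \<Rightarrow> ('k, 'a) module"
  arr :: "nat \<Rightarrow> nat \<Rightarrow> (nat \<Rightarrow> nat) \<Rightarrow> 'a \<Rightarrow> 'a"

definition covariant :: "('k, 'z) ring_scheme \<Rightarrow> ('k, 'a) epi_functor \<Rightarrow> bool" where
  "covariant k F \<longleftrightarrow>
     (\<forall>n. module k (ob F n)) \<and>
     (\<forall>l m. \<forall>f \<in> epi_mor l m. arr F l m f \<in> module_homs k (ob F l) (ob F m)) \<and>
     (\<forall>n. \<forall>x \<in> carrier (ob F n). arr F n n (epi_id n) x = x) \<and>
     (\<forall>l m n. \<forall>f \<in> epi_mor l m. \<forall>g \<in> epi_mor m n. \<forall>x \<in> carrier (ob F l).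
        arr F l n (compose {0..l} g f) x = arr F m n g (arr F l m f x))"

definition contravariant :: "('k, 'z) ring_scheme \<Rightarrow> ('k, 'a) epi_functor \<Rightarrow> bool" where
  "contravariant k M \<longleftrightarrow>
     (\<forall>n. module k (ob M n)) \<and>
     (\<forall>l m. \<forall>f \<in> epi_mor l m. arr M l m f \<in> module_homs k (ob M m) (ob M l)) \<and>
     (\<forall>n. \<forall>x \<in> carrier (ob M n). arr M n n (epi_id n) x = x) \<and>
     (\<forall>l m n. \<forall>f \<in> epi_mor l m. \<forall>g \<in> epi_mor m n. \<forall>x \<in> carrier (ob M n).
        arr M l n (compose {0..l} g f) x = arr M l m f (arr M m n g x))"

definition contra_nat ::
    "('k, 'z) ring_scheme \<Rightarrow> ('k, 'a) epi_functor \<Rightarrow> ('k, 'b) epi_functor \<Rightarrow> (nat \<Rightarrow> 'a \<Rightarrow> 'b) set" where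
  "contra_nat k M N = {\<eta>.
     (\<forall>n. \<eta> n \<in> module_homs k (ob M n) (ob N n)) \<and>
     (\<forall>l m. \<forall>f \<in> epi_mor l m. \<forall>x \<in> carrier (ob M m). \<eta> l (arr M l m f x) = arr N l m f (\<eta> m x))}"

definition contra_epi ::
    "('k, 'z) ring_scheme \<Rightarrow> ('k, 'a) epi_functor \<Rightarrow> ('k, 'b) epi_functor \<Rightarrow> (nat \<Rightarrow> 'a \<Rightarrow> 'b) set" where
  "contra_epi k M N = {\<eta> \<in> contra_nat k M N. \<forall>n. \<eta> n ` carrier (ob M n) = carrier (ob N n)}"


section \<open>Bar homology\<close>

text \<open>\<open>bar_diff k F n\<close> is \<open>b' : F[n + 1] \<rightarrow> F[n]\<close>.\<close>

definition bar_diff ::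
    "('k, 'z) ring_scheme \<Rightarrow> ('k, 'a) epi_functor \<Rightarrow> nat \<Rightarrow> 'a \<Rightarrow> 'a" where
  "bar_diff k F n x =
     (\<Oplus>\<^bsub>ob F n\<^esub>i \<in> {0..n}. ((\<ominus>\<^bsub>k\<^esub> \<one>\<^bsub>k\<^esub>) [^]\<^bsub>k\<^esub> i) \<odot>\<^bsub>ob F n\<^esub> arr F (Suc n) n (face (Suc n) i) x)"

definition bar_homology ::
    "('k, 'z) ring_scheme \<Rightarrow> ('k, 'a) epi_functor \<Rightarrow> nat \<Rightarrow> ('k, 'a set) module" where
  "bar_homology k F = homology (ob F) (bar_diff k F)"


section \<open>Representable functors and the functor \<open>b\<^sup>e\<^sup>p\<^sup>i\<close>\<close>

definition representable ::
    "('k, 'z) ring_scheme \<Rightarrow> nat \<Rightarrow> ('k, (nat \<Rightarrow> nat) \<Rightarrow> 'k) epi_functor" where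
  "representable k n =
     \<lparr>ob = (\<lambda>l. free_module k (epi_mor l n)),
      arr = (\<lambda>l m f. free_map k (epi_mor m n) (\<lambda>g. compose {0..l} g f))\<rparr>"

definition representable_map ::
    "('k, 'z) ring_scheme \<Rightarrow> nat \<Rightarrow> (nat \<Rightarrow> nat) \<Rightarrow> nat \<Rightarrow> ((nat \<Rightarrow> nat) \<Rightarrow> 'k) \<Rightarrow> (nat \<Rightarrow> nat) \<Rightarrow> 'k" where
  "representable_map k m g l = free_map k (epi_mor l m) (\<lambda>f. compose {0..l} g f)"

definition cokernel ::
    "('k, 'a) epi_functor \<Rightarrow> ('k, 'b) epi_functor \<Rightarrow> (nat \<Rightarrow> 'a \<Rightarrow> 'b) \<Rightarrow> ('k, 'b set) epi_functor" where
  "cokernel M N \<eta> =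
     \<lparr>ob = (\<lambda>l. quotient_module (ob N l) (\<eta> l ` carrier (ob M l))),
      arr = (\<lambda>l m f. quotient_map (ob N l) (\<eta> l ` carrier (ob M l)) (arr N l m f))\<rparr>"

definition b_epi :: "('k, 'z) ring_scheme \<Rightarrow> ('k, ((nat \<Rightarrow> nat) \<Rightarrow> 'k) set) epi_functor" where
  "b_epi k = cokernel (representable k 1) (representable k 0) (representable_map k 1 (face 1 0))"


section \<open>The tensor product of functors\<close>

text \<open>The coend of \<open>M[m] \<otimes>\<^sub>k F[n]\<close> is the quotient of \<open>\<Oplus>\<^sub>n M[n] \<otimes>\<^sub>k F[n]\<close> identifying \<open>M(f) x \<otimes> y\<close>
  with \<open>x \<otimes> F(f) y\<close>. It is presented here by the generators \<open>x \<otimes> y\<close>, written \<open>(n, x, y)\<close> for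
  \<open>x \<in> M[n]\<close> and \<open>y \<in> F[n]\<close>, subject to the bilinearity relations and these identifications.\<close>

definition tensor_gens ::
    "('k, 'a) epi_functor \<Rightarrow> ('k, 'b) epi_functor \<Rightarrow> (nat \<times> 'a \<times> 'b) set" where
  "tensor_gens M F = {(n, x, y). x \<in> carrier (ob M n) \<and> y \<in> carrier (ob F n)}"

definition tensor_rels ::
    "('k, 'z) ring_scheme \<Rightarrow> ('k, 'a) epi_functor \<Rightarrow> ('k, 'b) epi_functor \<Rightarrow> (nat \<times> 'a \<times> 'b \<Rightarrow> 'k) set" where
  "tensor_rels k M F =
    (let A = free_module k (tensor_gens M F); e = (\<lambda>n x y. free_gen k (n, x, y)) in
     {e n (x \<oplus>\<^bsub>ob M n\<^esub> x') y \<ominus>\<^bsub>A\<^esub> (e n x y \<oplus>\<^bsub>A\<^esub> e n x' y) | n x x' y.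
        x \<in> carrier (ob M n) \<and> x' \<in> carrier (ob M n) \<and> y \<in> carrier (ob F n)} \<union>
     {e n x (y \<oplus>\<^bsub>ob F n\<^esub> y') \<ominus>\<^bsub>A\<^esub> (e n x y \<oplus>\<^bsub>A\<^esub> e n x y') | n x y y'.
        x \<in> carrier (ob M n) \<and> y \<in> carrier (ob F n) \<and> y' \<in> carrier (ob F n)} \<union>
     {e n (a \<odot>\<^bsub>ob M n\<^esub> x) y \<ominus>\<^bsub>A\<^esub> a \<odot>\<^bsub>A\<^esub> e n x y | n a x y.
        a \<in> carrier k \<and> x \<in> carrier (ob M n) \<and> y \<in> carrier (ob F n)} \<union>
     {e n x (a \<odot>\<^bsub>ob F n\<^esub> y) \<ominus>\<^bsub>A\<^esub> a \<odot>\<^bsub>A\<^esub> e n x y | n a x y.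
        a \<in> carrier k \<and> x \<in> carrier (ob M n) \<and> y \<in> carrier (ob F n)} \<union>
     {e l (arr M l m f x) y \<ominus>\<^bsub>A\<^esub> e m x (arr F l m f y) | l m f x y.
        f \<in> epi_mor l m \<and> x \<in> carrier (ob M m) \<and> y \<in> carrier (ob F l)})"

definition tensor_ker ::
    "('k, 'z) ring_scheme \<Rightarrow> ('k, 'a) epi_functor \<Rightarrow> ('k, 'b) epi_functor \<Rightarrow> (nat \<times> 'a \<times> 'b \<Rightarrow> 'k) set" where
  "tensor_ker k M F = module_span k (free_module k (tensor_gens M F)) (tensor_rels k M F)"

definition tensor ::
    "('k, 'z) ring_scheme \<Rightarrow> ('k, 'a) epi_functor \<Rightarrow> ('k, 'b) epi_functor \<Rightarrow>
     ('k, (nat \<times> 'a \<times> 'b \<Rightarrow> 'k) set) module" where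
  "tensor k M F = quotient_module (free_module k (tensor_gens M F)) (tensor_ker k M F)"

text \<open>\<open>\<eta> \<otimes> F : M \<otimes> F \<rightarrow> M' \<otimes> F\<close> for a natural transformation \<open>\<eta> : M \<rightarrow> M'\<close>.\<close>

definition tensor_map ::
    "('k, 'z) ring_scheme \<Rightarrow> ('k, 'a) epi_functor \<Rightarrow> ('k, 'c) epi_functor \<Rightarrow> ('k, 'b) epi_functor \<Rightarrow>
     (nat \<Rightarrow> 'a \<Rightarrow> 'c) \<Rightarrow> (nat \<times> 'a \<times> 'b \<Rightarrow> 'k) set \<Rightarrow> (nat \<times> 'c \<times> 'b \<Rightarrow> 'k) set" where
  "tensor_map k M M' F \<eta> =
     quotient_map (free_module k (tensor_gens M' F)) (tensor_ker k M' F)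
       (free_map k (tensor_gens M F) (\<lambda>(n, x, y). (n, \<eta> n x, y)))"


section \<open>Projective resolutions and Tor\<close>

text \<open>Projectivity is the lifting property against epimorphisms \<open>\<pi> : E \<rightarrow> B\<close>. A definition cannot
  quantify over types, so the types of the elements of \<open>E\<close> and \<open>B\<close> have to be fixed. They are
  chosen such that \<open>\<pi>\<close> can be the canonical free cover
  \<open>\<Oplus>\<^bsub>m, x \<in> P[m]\<^esub> k[epi_mor(-, [m])] \<rightarrow> P\<close>: elements of its source at \<open>[l]\<close> are
  finitely supported functions on triples \<open>(m, x, f)\<close> with \<open>f : [l] \<rightarrow> [m]\<close>. Lifting the identity
  of \<open>P\<close> along it makes \<open>P\<close> a direct summand of a sum of representable functors, so \<open>P\<close> then has
  the lifting property against epimorphisms between functors on arbitrary types.\<close>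

definition projective :: "('k, 'z) ring_scheme \<Rightarrow> ('k, 'c) epi_functor \<Rightarrow> bool" where
  "projective k P \<longleftrightarrow> contravariant k P \<and>
     (\<forall>(E :: ('k, nat \<times> 'c \<times> (nat \<Rightarrow> nat) \<Rightarrow> 'k) epi_functor) (B :: ('k, 'c) epi_functor) \<pi> \<phi>.
        contravariant k E \<and> contravariant k B \<and> \<pi> \<in> contra_epi k E B \<and> \<phi> \<in> contra_nat k P B \<longrightarrow>
        (\<exists>\<psi> \<in> contra_nat k P E. \<forall>n. \<forall>x \<in> carrier (ob P n). \<pi> n (\<psi> n x) = \<phi> n x))"

text \<open>\<open>\<dots> \<rightarrow> P 2 \<rightarrow> P 1 \<rightarrow> P 0 \<rightarrow> M \<rightarrow> 0\<close> with \<open>D q : P (q + 1) \<rightarrow> P q\<close> and augmentation \<open>\<epsilon>\<close>.\<close>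

definition projective_resolution ::
    "('k, 'z) ring_scheme \<Rightarrow> ('k, 'm) epi_functor \<Rightarrow> (nat \<Rightarrow> ('k, 'c) epi_functor) \<Rightarrow>
     (nat \<Rightarrow> nat \<Rightarrow> 'c \<Rightarrow> 'c) \<Rightarrow> (nat \<Rightarrow> 'c \<Rightarrow> 'm) \<Rightarrow> bool" where
  "projective_resolution k M P D \<epsilon> \<longleftrightarrow>
     (\<forall>q. projective k (P q)) \<and>
     (\<forall>q. D q \<in> contra_nat k (P (Suc q)) (P q)) \<and>
     \<epsilon> \<in> contra_epi k (P 0) M \<and>
     (\<forall>n. D 0 n ` carrier (ob (P 1) n) = {x \<in> carrier (ob (P 0) n). \<epsilon> n x = \<zero>\<^bsub>ob M n\<^esub>}) \<and>
     (\<forall>q n. D (Suc q) n ` carrier (ob (P (Suc (Suc q))) n) =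
        {x \<in> carrier (ob (P (Suc q)) n). D q n x = \<zero>\<^bsub>ob (P q) n\<^esub>})"

text \<open>\<open>Tor k q M F\<close> is the value at \<open>M\<close> of the \<open>q\<close>-th left derived functor of \<open>- \<otimes> F\<close>, computed by
  a chosen projective resolution of \<open>M\<close>. Its terms have elements in the type \<open>('m \<times> 'k) list\<close>.
  This type is infinite and at least as large as both \<open>'m\<close> and \<open>'k\<close>, hence it has room for the
  free cover of every functor with at most as many elements, so every contravariant \<open>M\<close> has a
  projective resolution of this type.\<close>

definition chosen_resolution ::
    "('k, 'z) ring_scheme \<Rightarrow> ('k, 'm) epi_functor \<Rightarrow>
     (nat \<Rightarrow> ('k, ('m \<times> 'k) list) epi_functor) \<times>
     (nat \<Rightarrow> nat \<Rightarrow> ('m \<times> 'k) list \<Rightarrow> ('m \<times> 'k) list)" where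
  "chosen_resolution k M = (SOME (P, D). \<exists>\<epsilon>. projective_resolution k M P D \<epsilon>)"

definition Tor ::
    "('k, 'z) ring_scheme \<Rightarrow> nat \<Rightarrow> ('k, 'm) epi_functor \<Rightarrow> ('k, 'b) epi_functor \<Rightarrow>
     ('k, (nat \<times> ('m \<times> 'k) list \<times> 'b \<Rightarrow> 'k) set set) module" where
  "Tor k q M F = (case chosen_resolution k M of (P, D) \<Rightarrow>
     homology (\<lambda>r. tensor k (P r) F) (\<lambda>r. tensor_map k (P (Suc r)) (P r) F (D r)) q)"

end

theory Submission
  imports Defs
begin

text \<open>Tor does not depend on the projective resolution, and \<open>b\<^sup>e\<^sup>p\<^sup>i\<close> is resolved by the representable
  functors \<open>R\<^sub>n = k[\<Delta>\<^sup>e\<^sup>p\<^sup>i(-, [n])]\<close> with differential \<open>\<Sum>\<^sub>i (-1)\<^sup>i (d\<^sub>i)\<^sub>*\<close>: at \<open>[l]\<close> with \<open>l > 0\<close> this is the augmented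
  chain complex of a simplex on the \<open>l\<close> possible jumps of a surjection out of \<open>[l]\<close>, hence contractible.
  By Yoneda \<open>R\<^sub>n \<otimes> F = F[n]\<close>, which turns the differential into \<open>b'\<close>. The identification is made for the
  chosen resolution \<open>Q\<close> directly: with comparison maps \<open>f : R \<rightarrow> Q\<close> and \<open>g : Q \<rightarrow> R\<close>, the maps
  \<open>y \<mapsto> f(id) \<otimes> y\<close> and \<open>x \<otimes> y \<mapsto> \<Sum>\<^sub>h g(x)\<^sub>h F(h) y\<close> between \<open>F[n]\<close> and \<open>Q\<^sub>n \<otimes> F\<close> are mutually inverse up
  to homotopy.\<close>

section \<open>Modules and quotients\<close>

text \<open>\<open>Tor\<close> is computed from a resolution picked by choice among those whose
  elements are lists. The representables have elements of another type, and the choice carries no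
  information until some resolution on lists is known to exist. Copying the representables to lists
  settles existence and nothing more: the chosen resolution stays unknown and is accessible only
  through comparison maps, so lifting must work between functors on different types. Comparing
  \<open>ob F n\<close> directly with the chosen complex avoids forming the tensor product of a
  representable with \<open>F\<close>. One of the two homotopies is trivial. The identity of
  \<open>[q]\<close> lives at an object where the representable of degree \<open>q + 1\<close> is
  zero, so there is no room for a boundary there and \<open>g\<close> after \<open>f\<close> is the
  identity on the nose. Hence the bar complex is a direct summand of the chosen complex, and only
  the other composite requires a homotopy, obtained by applying a homotopy of resolutions to the
  first tensor factor.\<close>

lemma module_homsI:
  assumes "\<And>x. x \<in> carrier M \<Longrightarrow> h x \<in> carrier N"
    and "\<And>x y. x \<in> carrier M \<Longrightarrow> y \<in> carrier M \<Longrightarrow> h (x \<oplus>\<^bsub>M\<^esub> y) = h x \<oplus>\<^bsub>N\<^esub> h y"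
    and "\<And>a x. a \<in> carrier k \<Longrightarrow> x \<in> carrier M \<Longrightarrow> h (a \<odot>\<^bsub>M\<^esub> x) = a \<odot>\<^bsub>N\<^esub> h x"
  shows "h \<in> module_homs k M N"
  using assms unfolding module_homs_def by auto

lemma module_homs_closed: "h \<in> module_homs k M N \<Longrightarrow> x \<in> carrier M \<Longrightarrow> h x \<in> carrier N"
  and module_homs_add: "h \<in> module_homs k M N \<Longrightarrow> x \<in> carrier M \<Longrightarrow> y \<in> carrier M \<Longrightarrow>
    h (x \<oplus>\<^bsub>M\<^esub> y) = h x \<oplus>\<^bsub>N\<^esub> h y"
  and module_homs_smult: "h \<in> module_homs k M N \<Longrightarrow> a \<in> carrier k \<Longrightarrow> x \<in> carrier M \<Longrightarrow>
    h (a \<odot>\<^bsub>M\<^esub> x) = a \<odot>\<^bsub>N\<^esub> h x"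
  unfolding module_homs_def by auto

lemma (in abelian_group) right_minus_eq:
  assumes "x \<in> carrier G" "y \<in> carrier G"
  shows "x \<ominus> y = \<zero> \<longleftrightarrow> x = y"
  using assms by (metis a_minus_def add.inv_closed minus_equality r_neg)

lemma (in abelian_group) a_inv_zero: "\<ominus> \<zero> = \<zero>"
  by (metis r_neg l_zero zero_closed a_inv_closed)

lemma module_homs_zero:
  assumes "module k M" "module k N" "h \<in> module_homs k M N"
  shows "h \<zero>\<^bsub>M\<^esub> = \<zero>\<^bsub>N\<^esub>"
proof -
  interpret M: module k M by fact
  interpret N: module k N by fact
  have "h (\<zero>\<^bsub>k\<^esub> \<odot>\<^bsub>M\<^esub> \<zero>\<^bsub>M\<^esub>) = \<zero>\<^bsub>k\<^esub> \<odot>\<^bsub>N\<^esub> h \<zero>\<^bsub>M\<^esub>"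
    by (rule module_homs_smult[OF assms(3)]) auto
  then show ?thesis
    using module_homs_closed[OF assms(3), of "\<zero>\<^bsub>M\<^esub>"] by simp
qed

lemma module_homs_uminus:
  assumes "module k M" "module k N" "h \<in> module_homs k M N" "x \<in> carrier M"
  shows "h (\<ominus>\<^bsub>M\<^esub> x) = \<ominus>\<^bsub>N\<^esub> h x"
proof -
  interpret M: module k M by fact
  interpret N: module k N by fact
  have "h (\<ominus>\<^bsub>M\<^esub> x) \<oplus>\<^bsub>N\<^esub> h x = \<zero>\<^bsub>N\<^esub>"
    using module_homs_add[OF assms(3), of "\<ominus>\<^bsub>M\<^esub> x" x] assms module_homs_zero[OF assms(1-3)]
    by (simp add: M.M.l_neg)
  then show ?thesis
    using module_homs_closed[OF assms(3)] assms(4) by (simp add: N.M.minus_equality)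
qed

lemma module_homs_minus:
  assumes "module k M" "module k N" "h \<in> module_homs k M N" "x \<in> carrier M" "y \<in> carrier M"
  shows "h (x \<ominus>\<^bsub>M\<^esub> y) = h x \<ominus>\<^bsub>N\<^esub> h y"
proof -
  interpret M: module k M by fact
  show ?thesis
    using assms by (simp add: a_minus_def module_homs_add[OF assms(3)] module_homs_uminus)
qed

lemma module_homs_finsum:
  assumes "module k M" "module k N" "h \<in> module_homs k M N" "f \<in> I \<rightarrow> carrier M"
  shows "h (finsum M f I) = (\<Oplus>\<^bsub>N\<^esub>i\<in>I. h (f i))"
proof -
  interpret M: module k M by fact
  interpret N: module k N by fact
  note h0 = module_homs_zero[OF assms(1-3)]
  show ?thesis
  proof (cases "finite I")
    case True
    then show ?thesis using assms(4)
    proof (induction I rule: finite_induct)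
      case empty
      then show ?case by (simp add: h0)
    next
      case (insert i I)
      then have "f \<in> I \<rightarrow> carrier M" "f i \<in> carrier M" "(\<lambda>i. h (f i)) \<in> I \<rightarrow> carrier N"
        "h (f i) \<in> carrier N"
        using module_homs_closed[OF assms(3)] by auto
      then show ?case using insert by (simp add: module_homs_add[OF assms(3)])
    qed
  \<comment> \<open>Over an infinite index set \<open>finsum\<close> is zero by convention, and
    \<open>h\<close> preserves zero.\<close>
  qed (simp add: M.M.finsum_infinite N.M.finsum_infinite h0)
qed

text \<open>Linearity only concerns values on the carrier. Maps such as \<open>free_map\<close> and
  \<open>tensor_map\<close> are given by explicit formulas; they are shown linear by agreeing there
  with a map that is linear by construction.\<close>

lemma module_homs_cong:
  assumes "module k M" "h \<in> module_homs k M N" "\<And>x. x \<in> carrier M \<Longrightarrow> g x = h x"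
  shows "g \<in> module_homs k M N"
proof -
  interpret M: module k M by fact
  show ?thesis using assms(2,3) by (auto simp: module_homs_def Pi_iff)
qed

lemma module_homs_id: "(\<lambda>x. x) \<in> module_homs k M M"
  by (rule module_homsI) auto

lemma module_homs_comp:
  assumes "g \<in> module_homs k N L" "h \<in> module_homs k M N"
  shows "(\<lambda>x. g (h x)) \<in> module_homs k M L"
  using assms unfolding module_homs_def Pi_def by auto

lemma module_homs_add_map:
  assumes "module k N" "g \<in> module_homs k M N" "h \<in> module_homs k M N"
  shows "(\<lambda>x. g x \<oplus>\<^bsub>N\<^esub> h x) \<in> module_homs k M N"
proof -
  interpret N: module k N by fact
  show ?thesis
    using module_homs_closed[OF assms(2)] module_homs_closed[OF assms(3)]
    by (intro module_homsI) (auto simp: module_homs_add[OF assms(2)] module_homs_add[OF assms(3)]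
        module_homs_smult[OF assms(2)] module_homs_smult[OF assms(3)] N.smult_r_distr N.M.a_ac)
qed

lemma module_homs_smult_map:
  assumes "module k N" "h \<in> module_homs k M N" "a \<in> carrier k"
  shows "(\<lambda>x. a \<odot>\<^bsub>N\<^esub> h x) \<in> module_homs k M N"
proof -
  interpret N: module k N by fact
  show ?thesis
    using module_homs_closed[OF assms(2)] assms(3)
    by (intro module_homsI) (auto simp: module_homs_add[OF assms(2)]
        module_homs_smult[OF assms(2)] N.smult_r_distr N.smult_assoc1[symmetric] N.R.m_comm)
qed

lemma module_homs_uminus_map:
  assumes "module k N" "h \<in> module_homs k M N"
  shows "(\<lambda>x. \<ominus>\<^bsub>N\<^esub> h x) \<in> module_homs k M N"
proof -
  interpret N: module k N by fact
  show ?thesis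
    using module_homs_closed[OF assms(2)]
    by (intro module_homsI) (auto simp: module_homs_add[OF assms(2)]
        module_homs_smult[OF assms(2)] N.smult_r_minus N.M.minus_add)
qed

lemma module_homs_minus_map:
  assumes "module k N" "g \<in> module_homs k M N" "h \<in> module_homs k M N"
  shows "(\<lambda>x. g x \<ominus>\<^bsub>N\<^esub> h x) \<in> module_homs k M N"
  unfolding a_minus_def
  by (intro module_homs_add_map module_homs_uminus_map assms)

lemma module_homs_zero_map:
  assumes "module k N"
  shows "(\<lambda>x. \<zero>\<^bsub>N\<^esub>) \<in> module_homs k M N"
proof -
  interpret N: module k N by fact
  show ?thesis by (rule module_homsI) auto
qed

lemma module_homs_finsum_map:
  assumes "module k N" "\<And>i. i \<in> I \<Longrightarrow> h i \<in> module_homs k M N"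
  shows "(\<lambda>x. \<Oplus>\<^bsub>N\<^esub>i\<in>I. h i x) \<in> module_homs k M N"
proof -
  interpret N: module k N by fact
  note cl = module_homs_closed[OF assms(2)]
  have c: "\<And>x. x \<in> carrier M \<Longrightarrow> (\<lambda>i. h i x) \<in> I \<rightarrow> carrier N" using cl by auto
  show ?thesis
  proof (cases "finite I")
    case True
    show ?thesis
    proof (rule module_homsI)
      fix x y assume x: "x \<in> carrier M" and y: "y \<in> carrier M"
      have "(\<Oplus>\<^bsub>N\<^esub>i\<in>I. h i (x \<oplus>\<^bsub>M\<^esub> y)) = (\<Oplus>\<^bsub>N\<^esub>i\<in>I. h i x \<oplus>\<^bsub>N\<^esub> h i y)"
        by (rule N.M.finsum_cong') (use x y cl module_homs_add[OF assms(2)] in auto)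
      then show "(\<Oplus>\<^bsub>N\<^esub>i\<in>I. h i (x \<oplus>\<^bsub>M\<^esub> y)) = (\<Oplus>\<^bsub>N\<^esub>i\<in>I. h i x) \<oplus>\<^bsub>N\<^esub> (\<Oplus>\<^bsub>N\<^esub>i\<in>I. h i y)"
        using N.M.finsum_addf[OF c[OF x] c[OF y]] by simp
    next
      fix a x assume a: "a \<in> carrier k" and x: "x \<in> carrier M"
      have "(\<Oplus>\<^bsub>N\<^esub>i\<in>I. h i (a \<odot>\<^bsub>M\<^esub> x)) = (\<Oplus>\<^bsub>N\<^esub>i\<in>I. a \<odot>\<^bsub>N\<^esub> h i x)"
        by (rule N.M.finsum_cong') (use x a cl module_homs_smult[OF assms(2)] in auto)
      then show "(\<Oplus>\<^bsub>N\<^esub>i\<in>I. h i (a \<odot>\<^bsub>M\<^esub> x)) = a \<odot>\<^bsub>N\<^esub> (\<Oplus>\<^bsub>N\<^esub>i\<in>I. h i x)"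
        using N.finsum_smult_ldistr[OF True a c[OF x]] by simp
    qed (use c in auto)
  qed (simp add: N.M.finsum_infinite module_homs_zero_map[OF assms(1)])
qed

lemma submodule_image:
  assumes "module k M" "module k N" "h \<in> module_homs k M N"
  shows "submodule (h ` carrier M) k N"
proof -
  interpret M: module k M by fact
  interpret N: module k N by fact
  note cl = module_homs_closed[OF assms(3)]
  show ?thesis
  proof (rule N.submoduleI)
    show "\<zero>\<^bsub>N\<^esub> \<in> h ` carrier M"
      by (rule image_eqI[of _ _ "\<zero>\<^bsub>M\<^esub>"]) (simp_all add: module_homs_zero[OF assms])
    fix a assume "a \<in> h ` carrier M"
    then obtain x where x: "x \<in> carrier M" "a = h x" by blast
    show "\<ominus>\<^bsub>N\<^esub> a \<in> h ` carrier M"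
      by (rule image_eqI[of _ _ "\<ominus>\<^bsub>M\<^esub> x"]) (simp_all add: x module_homs_uminus[OF assms])
    show "c \<odot>\<^bsub>N\<^esub> a \<in> h ` carrier M" if "c \<in> carrier k" for c
      by (rule image_eqI[of _ _ "c \<odot>\<^bsub>M\<^esub> x"]) (simp_all add: x that module_homs_smult[OF assms(3)])
    fix b assume "b \<in> h ` carrier M"
    then obtain y where y: "y \<in> carrier M" "b = h y" by blast
    show "a \<oplus>\<^bsub>N\<^esub> b \<in> h ` carrier M"
      by (rule image_eqI[of _ _ "x \<oplus>\<^bsub>M\<^esub> y"]) (simp_all add: x y module_homs_add[OF assms(3)])
  qed (use cl in auto)
qed

lemma submodule_kernel:
  assumes "module k M" "module k N" "h \<in> module_homs k M N"
  shows "submodule {x \<in> carrier M. h x = \<zero>\<^bsub>N\<^esub>} k M"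
proof -
  interpret M: module k M by fact
  interpret N: module k N by fact
  show ?thesis
  proof (rule M.submoduleI)
    show "\<ominus>\<^bsub>M\<^esub> a \<in> {x \<in> carrier M. h x = \<zero>\<^bsub>N\<^esub>}" if "a \<in> {x \<in> carrier M. h x = \<zero>\<^bsub>N\<^esub>}" for a
      using that by (simp add: module_homs_uminus[OF assms])
    show "a \<oplus>\<^bsub>M\<^esub> b \<in> {x \<in> carrier M. h x = \<zero>\<^bsub>N\<^esub>}"
      if "a \<in> {x \<in> carrier M. h x = \<zero>\<^bsub>N\<^esub>}" "b \<in> {x \<in> carrier M. h x = \<zero>\<^bsub>N\<^esub>}" for a b
      using that by (simp add: module_homs_add[OF assms(3)])
    show "a \<odot>\<^bsub>M\<^esub> b \<in> {x \<in> carrier M. h x = \<zero>\<^bsub>N\<^esub>}"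
      if "a \<in> carrier k" "b \<in> {x \<in> carrier M. h x = \<zero>\<^bsub>N\<^esub>}" for a b
      using that by (simp add: module_homs_smult[OF assms(3)])
  qed (use module_homs_zero[OF assms] in auto)
qed

text \<open>\<open>homology\<close> divides by the boundaries inside the module of cycles, whose
  record is that of the ambient module with the carrier cut down; the boundaries must be a submodule
  there.\<close>

lemma submodule_inside:
  assumes "module k M" "submodule Z k M" "submodule B k M" "B \<subseteq> Z"
  shows "submodule B k (M\<lparr>carrier := Z\<rparr>)"
proof -
  interpret M: module k M by fact
  interpret Z: module k "M\<lparr>carrier := Z\<rparr>" by (rule submodule.submodule_is_module) fact+
  interpret B: module k "M\<lparr>carrier := B\<rparr>" by (rule submodule.submodule_is_module) fact+
  show ?thesis
    by (rule Z.module_incl_imp_submodule) (use assms(4) B.module_axioms in auto)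
qed

section \<open>Cosets and quotient modules\<close>

context
  fixes R :: "('k, 'z) ring_scheme" (structure) and M :: "('k, 'a) module" (structure)
  assumes module: "module R M"
begin

interpretation module R M by (rule module)

lemma abelian_subgroup_submodule: "submodule N R M \<Longrightarrow> abelian_subgroup N M"
  using submodule.axioms(1) additive_subgroup.intro abelian_subgroupI3 M.abelian_group_axioms
  by blast

lemma coset_eq_iff:
  assumes "submodule N R M" "x \<in> carrier M" "y \<in> carrier M"
  shows "N +>\<^bsub>M\<^esub> x = N +>\<^bsub>M\<^esub> y \<longleftrightarrow> x \<ominus>\<^bsub>M\<^esub> y \<in> N"
proof -
  interpret N: abelian_subgroup N M by (rule abelian_subgroup_submodule) fact
  show ?thesis
  proof
    assume "N +>\<^bsub>M\<^esub> x = N +>\<^bsub>M\<^esub> y"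
    then show "x \<ominus>\<^bsub>M\<^esub> y \<in> N"
      using N.a_rcos_self[OF assms(2)] N.a_rcos_module[OF assms(3,2)] by (simp add: a_minus_def)
  next
    assume "x \<ominus>\<^bsub>M\<^esub> y \<in> N"
    then have "x \<in> N +>\<^bsub>M\<^esub> y"
      using N.a_rcos_module[OF assms(3,2)] by (simp add: a_minus_def)
    then show "N +>\<^bsub>M\<^esub> x = N +>\<^bsub>M\<^esub> y"
      using M.a_repr_independence[OF _ assms(3) N.a_subgroup] by metis
  qed
qed

lemma coset_eq_zero_iff:
  assumes "submodule N R M" "x \<in> carrier M"
  shows "N +>\<^bsub>M\<^esub> x = N \<longleftrightarrow> x \<in> N"
proof -
  interpret N: abelian_subgroup N M by (rule abelian_subgroup_submodule) fact
  show ?thesis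
    using M.a_coset_join1[OF _ assms(2) N.a_subgroup] M.a_coset_join2[OF assms(2) N.a_subgroup]
    by metis
qed

lemma carrier_quotient:
  "carrier (quotient_module M N) = (\<lambda>x. N +>\<^bsub>M\<^esub> x) ` carrier M"
  by (auto simp: quotient_module_def A_RCOSETS_def')

end

context
  fixes R :: "('k, 'z) ring_scheme" (structure) and M :: "('k, 'a) module" (structure)
  assumes module: "module R M"
begin

interpretation module R M by (rule module)

text \<open>Two elements of one coset differ by an element of \<open>N\<close>, which
  \<open>h\<close> sends into \<open>N'\<close>; so the union defining \<open>quotient_map\<close>
  is over equal cosets, and \<open>x\<close> itself contributes one of them.\<close>

lemma quotient_map_coset:
  assumes M': "module R M'" and N: "submodule N R M" and N': "submodule N' R M'"
    and h: "h \<in> module_homs R M M'" and sub: "\<And>x. x \<in> N \<Longrightarrow> h x \<in> N'" and x: "x \<in> carrier M"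
  shows "quotient_map M' N' h (N +>\<^bsub>M\<^esub> x) = N' +>\<^bsub>M'\<^esub> h x"
proof -
  interpret M': module R M' by fact
  interpret N: abelian_subgroup N M by (rule abelian_subgroup_submodule[OF module]) fact
  have "N' +>\<^bsub>M'\<^esub> h y = N' +>\<^bsub>M'\<^esub> h x" if y: "y \<in> N +>\<^bsub>M\<^esub> x" for y
  proof -
    obtain n where n: "n \<in> N" "y = n \<oplus>\<^bsub>M\<^esub> x" using y by (auto simp: a_r_coset_def')
    have nM: "n \<in> carrier M" using n N.a_subset by auto
    have "h y \<ominus>\<^bsub>M'\<^esub> h x = h n"
      using nM x module_homs_closed[OF h]
      by (simp add: n module_homs_add[OF h] a_minus_def M'.M.a_assoc M'.M.r_neg)
    then show ?thesis
      using sub[OF n(1)] coset_eq_iff[OF M' N'] module_homs_closed[OF h] nM x n by auto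
  qed
  moreover have "x \<in> N +>\<^bsub>M\<^esub> x" using N.a_rcos_self x by auto
  ultimately show ?thesis unfolding quotient_map_def by blast
qed

lemma quotient_smult:
  assumes "submodule N R M" "a \<in> carrier R" "x \<in> carrier M"
  shows "a \<odot>\<^bsub>quotient_module M N\<^esub> (N +>\<^bsub>M\<^esub> x) = N +>\<^bsub>M\<^esub> (a \<odot>\<^bsub>M\<^esub> x)"
proof -
  have "(\<lambda>x. a \<odot>\<^bsub>M\<^esub> x) \<in> module_homs R M M"
    using module_homs_smult_map[OF module_axioms module_homs_id assms(2)] .
  then show ?thesis
    unfolding quotient_module_def
    using quotient_map_coset[OF module_axioms assms(1,1) _ _ assms(3)] assms
    by (simp add: submoduleE(4)[OF assms(1)])
qed

lemma quotient_add:
  assumes "submodule N R M" "x \<in> carrier M" "y \<in> carrier M"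
  shows "(N +>\<^bsub>M\<^esub> x) \<oplus>\<^bsub>quotient_module M N\<^esub> (N +>\<^bsub>M\<^esub> y) = N +>\<^bsub>M\<^esub> (x \<oplus>\<^bsub>M\<^esub> y)"
proof -
  interpret N: abelian_subgroup N M by (rule abelian_subgroup_submodule[OF module]) fact
  show ?thesis using assms by (simp add: quotient_module_def N.a_rcos_sum)
qed

lemma quotient_zero: "\<zero>\<^bsub>quotient_module M N\<^esub> = N"
  by (simp add: quotient_module_def)

lemma quotient_is_module:
  assumes N: "submodule N R M"
  shows "module R (quotient_module M N)"
proof (rule moduleI[OF R.cring_axioms])
  let ?Q = "quotient_module M N"
  have 0: "N = N +>\<^bsub>M\<^esub> \<zero>\<^bsub>M\<^esub>"
    using coset_eq_zero_iff[OF module N, of "\<zero>\<^bsub>M\<^esub>"] subgroup.one_closed[OF submodule.axioms(1)[OF N]]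
    by simp
  note S = carrier_quotient[OF module] quotient_add[OF N] quotient_smult[OF N]
  show "abelian_group ?Q"
  proof (rule abelian_groupI)
    show "\<exists>y\<in>carrier ?Q. y \<oplus>\<^bsub>?Q\<^esub> x = \<zero>\<^bsub>?Q\<^esub>" if x: "x \<in> carrier ?Q" for x
    proof -
      obtain z where z: "z \<in> carrier M" "x = N +>\<^bsub>M\<^esub> z" using x by (auto simp: S)
      then have "(N +>\<^bsub>M\<^esub> (\<ominus>\<^bsub>M\<^esub> z)) \<oplus>\<^bsub>?Q\<^esub> x = \<zero>\<^bsub>?Q\<^esub>"
        using 0 by (simp add: S quotient_zero M.l_neg)
      then show ?thesis using z by (auto simp: S)
    qed
    show "\<zero>\<^bsub>?Q\<^esub> \<oplus>\<^bsub>?Q\<^esub> x = x" if x: "x \<in> carrier ?Q" for x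
    proof -
      obtain z where z: "z \<in> carrier M" "x = N +>\<^bsub>M\<^esub> z" using x by (auto simp: S)
      then have "(N +>\<^bsub>M\<^esub> \<zero>\<^bsub>M\<^esub>) \<oplus>\<^bsub>?Q\<^esub> x = x" by (simp add: S)
      then show ?thesis using 0 by (simp add: quotient_zero)
    qed
    show "\<zero>\<^bsub>?Q\<^esub> \<in> carrier ?Q" using 0 by (auto simp: S quotient_zero)
  qed (auto simp: S M.a_ac)
qed (auto simp: carrier_quotient[OF module] quotient_add[OF N] quotient_smult[OF N] smult_l_distr
       smult_r_distr smult_assoc1)

lemma quotient_proj:
  assumes N: "submodule N R M"
  shows "(\<lambda>x. N +>\<^bsub>M\<^esub> x) \<in> module_homs R M (quotient_module M N)"
  by (rule module_homsI) (auto simp: carrier_quotient[OF module] quotient_add[OF N] quotient_smult[OF N])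

text \<open>The map takes the value of \<open>h\<close> at a chosen representative. Another
  representative differs by an element of \<open>N\<close>, where \<open>h\<close> vanishes.\<close>

lemma quotient_lift:
  assumes N: "submodule N R M" and W: "module R W" and h: "h \<in> module_homs R M W"
    and sub: "\<And>x. x \<in> N \<Longrightarrow> h x = \<zero>\<^bsub>W\<^esub>"
  obtains h' where "h' \<in> module_homs R (quotient_module M N) W"
    "\<And>x. x \<in> carrier M \<Longrightarrow> h' (N +>\<^bsub>M\<^esub> x) = h x"
proof -
  interpret W: module R W by fact
  define h' where "h' X = h (SOME x. x \<in> carrier M \<and> X = N +>\<^bsub>M\<^esub> x)" for X
  have *: "h' (N +>\<^bsub>M\<^esub> x) = h x" if x: "x \<in> carrier M" for x
  proof -
    define y where "y = (SOME y. y \<in> carrier M \<and> N +>\<^bsub>M\<^esub> x = N +>\<^bsub>M\<^esub> y)"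
    have y: "y \<in> carrier M \<and> N +>\<^bsub>M\<^esub> x = N +>\<^bsub>M\<^esub> y"
      unfolding y_def by (rule someI[of _ x]) (use x in auto)
    then have "x \<ominus>\<^bsub>M\<^esub> y \<in> N" using coset_eq_iff[OF module N x] by auto
    then have "h x \<ominus>\<^bsub>W\<^esub> h y = \<zero>\<^bsub>W\<^esub>"
      using sub[of "x \<ominus>\<^bsub>M\<^esub> y"] module_homs_minus[OF module_axioms W h x, of y] y by simp
    then have "h x = h y" using module_homs_closed[OF h] x y by (simp add: W.M.right_minus_eq)
    then show ?thesis unfolding h'_def y_def by simp
  qed
  have "h' \<in> module_homs R (quotient_module M N) W"
    by (rule module_homsI) (auto simp: carrier_quotient[OF module] quotient_add[OF N] quotient_smult[OF N] *
      module_homs_closed[OF h] module_homs_add[OF h] module_homs_smult[OF h])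
  then show ?thesis using that * by blast
qed

lemma submodule_span:
  assumes "S \<subseteq> carrier M"
  shows "submodule (module_span R M S) R M"
proof (rule submoduleI)
  \<comment> \<open>The whole module is one of the intersected submodules, so the intersection is
    not over an empty family.\<close>
  show "module_span R M S \<subseteq> carrier M"
    unfolding module_span_def using carrier_is_submodule assms by auto
  show "\<zero>\<^bsub>M\<^esub> \<in> module_span R M S"
    unfolding module_span_def using subgroup.one_closed[OF submodule.axioms(1)] by fastforce
  show "\<ominus>\<^bsub>M\<^esub> a \<in> module_span R M S" if "a \<in> module_span R M S" for a
    using that submoduleE(3) unfolding module_span_def by blast
  show "a \<oplus>\<^bsub>M\<^esub> b \<in> module_span R M S" if "a \<in> module_span R M S" "b \<in> module_span R M S" for a b
    using that submoduleE(5) unfolding module_span_def by blast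
  show "a \<odot>\<^bsub>M\<^esub> b \<in> module_span R M S" if "a \<in> carrier R" "b \<in> module_span R M S" for a b
    using that submoduleE(4) unfolding module_span_def by blast
qed

lemma span_superset: "S \<subseteq> module_span R M S"
  unfolding module_span_def by auto

lemma span_least: "submodule N R M \<Longrightarrow> S \<subseteq> N \<Longrightarrow> module_span R M S \<subseteq> N"
  unfolding module_span_def by auto

end

section \<open>Free modules\<close>

text \<open>The linear map that takes the basis element \<open>x\<close> to \<open>\<phi> x\<close>.
  The sum runs over the support of \<open>c\<close> because the basis may be infinite, as for
  \<open>tensor_gens\<close>, and \<open>finsum\<close> over an infinite set is zero.\<close>

definition free_lift ::
    "('k, 'z) ring_scheme \<Rightarrow> ('k, 'b) module \<Rightarrow> ('x \<Rightarrow> 'b) \<Rightarrow> ('x \<Rightarrow> 'k) \<Rightarrow> 'b" where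
  "free_lift k N \<phi> c = (\<Oplus>\<^bsub>N\<^esub>x \<in> {x. c x \<noteq> \<zero>\<^bsub>k\<^esub>}. c x \<odot>\<^bsub>N\<^esub> \<phi> x)"

lemma free_carrier_iff: "c \<in> carrier (free_module k X) \<longleftrightarrow>
    (\<forall>x. c x \<in> carrier k) \<and> (\<forall>x. x \<notin> X \<longrightarrow> c x = \<zero>\<^bsub>k\<^esub>) \<and> finite {x. c x \<noteq> \<zero>\<^bsub>k\<^esub>}"
  by (simp add: free_module_def)

lemma free_zero: "\<zero>\<^bsub>free_module k X\<^esub> = (\<lambda>x. \<zero>\<^bsub>k\<^esub>)"
  and free_add: "c \<oplus>\<^bsub>free_module k X\<^esub> d = (\<lambda>x. c x \<oplus>\<^bsub>k\<^esub> d x)"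
  and free_smult: "a \<odot>\<^bsub>free_module k X\<^esub> c = (\<lambda>x. a \<otimes>\<^bsub>k\<^esub> c x)"
  by (simp_all add: free_module_def)

context
  fixes k :: "('k, 'z) ring_scheme" (structure)
  assumes cring: "cring k"
begin

interpretation cring k by (rule cring)

lemma free_is_module: "module k (free_module k X)"
proof (rule moduleI[OF cring])
  have fin_add: "finite {x. c x \<oplus> d x \<noteq> \<zero>}"
    if "finite {x. c x \<noteq> \<zero>}" "finite {x. d x \<noteq> \<zero>}" for c d :: "'x \<Rightarrow> 'k"
    by (rule finite_subset[OF _ finite_UnI[OF that]]) auto
  have fin_smult: "finite {x. a \<otimes> c x \<noteq> \<zero>}" if "finite {x. c x \<noteq> \<zero>}" "a \<in> carrier k"
    for a and c :: "'x \<Rightarrow> 'k"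
    by (rule finite_subset[OF _ that(1)]) (use that(2) in auto)
  show "abelian_group (free_module k X)"
  proof (rule abelian_groupI)
    fix c assume c: "c \<in> carrier (free_module k X)"
    have "(\<lambda>x. \<ominus> c x) \<in> carrier (free_module k X)"
      using c by (auto simp: free_carrier_iff elim!: rev_finite_subset)
    moreover have "(\<lambda>x. \<ominus> c x) \<oplus>\<^bsub>free_module k X\<^esub> c = \<zero>\<^bsub>free_module k X\<^esub>"
      using c by (auto simp: free_carrier_iff free_add free_zero l_neg)
    ultimately show "\<exists>d\<in>carrier (free_module k X). d \<oplus>\<^bsub>free_module k X\<^esub> c = \<zero>\<^bsub>free_module k X\<^esub>"
      by blast
  qed (auto simp: free_carrier_iff free_add free_zero fin_add a_ac)
  show "a \<odot>\<^bsub>free_module k X\<^esub> c \<in> carrier (free_module k X)"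
    if "a \<in> carrier k" "c \<in> carrier (free_module k X)" for a c
    using that by (auto simp: free_carrier_iff free_smult fin_smult)
qed (auto simp: free_carrier_iff free_add free_smult l_distr r_distr m_assoc)

lemma free_gen_closed: "x \<in> X \<Longrightarrow> free_gen k x \<in> carrier (free_module k X)"
  by (auto simp: free_carrier_iff free_gen_def elim!: rev_finite_subset[of "{x}"])

text \<open>Sums for vectors with different supports can be added term by term once they are
  extended to a common finite index set; the added terms vanish.\<close>

lemma free_lift_superset:
  assumes "module k N" "finite A" "{x. c x \<noteq> \<zero>} \<subseteq> A" "\<And>x. c x \<in> carrier k" "\<phi> \<in> A \<rightarrow> carrier N"
  shows "free_lift k N \<phi> c = (\<Oplus>\<^bsub>N\<^esub>x \<in> A. c x \<odot>\<^bsub>N\<^esub> \<phi> x)"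
proof -
  interpret N: module k N by fact
  show ?thesis
    unfolding free_lift_def
    by (rule N.M.add.finprod_mono_neutral_cong_left)
      (use assms in \<open>auto intro!: N.smult_l_null N.smult_closed\<close>)
qed

lemma free_lift_hom:
  assumes N: "module k N" and \<phi>: "\<phi> \<in> X \<rightarrow> carrier N"
  shows "free_lift k N \<phi> \<in> module_homs k (free_module k X) N"
proof (rule module_homsI)
  interpret N: module k N by fact
  let ?S = "\<lambda>c. {x. c x \<noteq> \<zero>}"
  have S: "?S c \<subseteq> X" "finite (?S c)" "\<And>x. c x \<in> carrier k" if "c \<in> carrier (free_module k X)" for c
    using that by (auto simp: free_carrier_iff)
  show "free_lift k N \<phi> c \<in> carrier N" if c: "c \<in> carrier (free_module k X)" for c
    unfolding free_lift_def by (rule N.M.finsum_closed) (use S[OF c] \<phi> in auto)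
  fix c assume c: "c \<in> carrier (free_module k X)"
  note Sc = S[OF c]
  {
    fix d assume d: "d \<in> carrier (free_module k X)"
    note Sd = S[OF d]
    have cd: "c \<oplus>\<^bsub>free_module k X\<^esub> d \<in> carrier (free_module k X)"
      using abelian_groupE(1)[OF module.axioms(2)[OF free_is_module] c d] .
    define A where "A = ?S c \<union> ?S d \<union> ?S (c \<oplus>\<^bsub>free_module k X\<^esub> d)"
    have A: "finite A" "\<phi> \<in> A \<rightarrow> carrier N"
      using Sc Sd S[OF cd] \<phi> by (auto simp: A_def)
    have L: "free_lift k N \<phi> e = (\<Oplus>\<^bsub>N\<^esub>x \<in> A. e x \<odot>\<^bsub>N\<^esub> \<phi> x)"
      if "e \<in> carrier (free_module k X)" "?S e \<subseteq> A" for e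
      by (rule free_lift_superset) (use that N A S(3) in auto)
    have "(\<Oplus>\<^bsub>N\<^esub>x \<in> A. (c \<oplus>\<^bsub>free_module k X\<^esub> d) x \<odot>\<^bsub>N\<^esub> \<phi> x) =
        (\<Oplus>\<^bsub>N\<^esub>x \<in> A. c x \<odot>\<^bsub>N\<^esub> \<phi> x \<oplus>\<^bsub>N\<^esub> d x \<odot>\<^bsub>N\<^esub> \<phi> x)"
      by (rule N.M.finsum_cong') (use Sc Sd A in \<open>auto simp: free_add N.smult_l_distr Pi_iff\<close>)
    also have "\<dots> = (\<Oplus>\<^bsub>N\<^esub>x \<in> A. c x \<odot>\<^bsub>N\<^esub> \<phi> x) \<oplus>\<^bsub>N\<^esub> (\<Oplus>\<^bsub>N\<^esub>x \<in> A. d x \<odot>\<^bsub>N\<^esub> \<phi> x)"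
      by (rule N.M.finsum_addf) (use Sc Sd A in auto)
    finally show "free_lift k N \<phi> (c \<oplus>\<^bsub>free_module k X\<^esub> d) = free_lift k N \<phi> c \<oplus>\<^bsub>N\<^esub> free_lift k N \<phi> d"
      using L[OF cd] L[OF c] L[OF d] by (metis (lifting) A_def Un_upper1 Un_upper2 le_supI1 order_refl)
  }
  fix a assume a: "a \<in> carrier k"
  have "free_lift k N \<phi> (a \<odot>\<^bsub>free_module k X\<^esub> c) = (\<Oplus>\<^bsub>N\<^esub>x \<in> ?S c. (a \<otimes> c x) \<odot>\<^bsub>N\<^esub> \<phi> x)"
    unfolding free_smult
    by (rule free_lift_superset) (use N Sc \<phi> a in auto)
  also have "\<dots> = (\<Oplus>\<^bsub>N\<^esub>x \<in> ?S c. a \<odot>\<^bsub>N\<^esub> (c x \<odot>\<^bsub>N\<^esub> \<phi> x))"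
    by (rule N.M.finsum_cong') (use Sc \<phi> a in \<open>auto simp: N.smult_assoc1 Pi_iff subset_iff\<close>)
  also have "\<dots> = a \<odot>\<^bsub>N\<^esub> free_lift k N \<phi> c"
    unfolding free_lift_def
    by (rule N.finsum_smult_ldistr[symmetric]) (use Sc \<phi> a in auto)
  finally show "free_lift k N \<phi> (a \<odot>\<^bsub>free_module k X\<^esub> c) = a \<odot>\<^bsub>N\<^esub> free_lift k N \<phi> c" .
qed

lemma free_lift_gen:
  assumes "module k N" "\<phi> x \<in> carrier N"
  shows "free_lift k N \<phi> (free_gen k x) = \<phi> x"
proof -
  interpret N: module k N by fact
  have "free_lift k N \<phi> (free_gen k x) = (\<Oplus>\<^bsub>N\<^esub>y \<in> {x}. free_gen k x y \<odot>\<^bsub>N\<^esub> \<phi> y)"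
    by (rule free_lift_superset) (use assms in \<open>auto simp: free_gen_def\<close>)
  then show ?thesis using assms(2) by (simp add: free_gen_def)
qed

lemma free_finsum_apply:
  assumes "finite A" "\<And>i. i \<in> A \<Longrightarrow> h i \<in> carrier (free_module k X)"
  shows "(\<Oplus>\<^bsub>free_module k X\<^esub>i\<in>A. h i) y = (\<Oplus>i\<in>A. h i y)"
proof -
  interpret X: module k "free_module k X" by (rule free_is_module)
  show ?thesis using assms
  proof (induction A rule: finite_induct)
    case (insert i A)
    then have "h \<in> A \<rightarrow> carrier (free_module k X)" "h i \<in> carrier (free_module k X)" by auto
    moreover from this have "(\<lambda>i. h i y) \<in> A \<rightarrow> carrier k" "h i y \<in> carrier k"
      by (auto simp: free_carrier_iff[of "h _"] Pi_iff)
    ultimately show ?case using insert by (simp add: free_add)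
  qed (simp add: free_zero)
qed

lemma free_lift_free_apply:
  assumes "\<And>x. x \<in> X \<Longrightarrow> \<phi> x \<in> carrier (free_module k Y)" "c \<in> carrier (free_module k X)"
  shows "free_lift k (free_module k Y) \<phi> c y = (\<Oplus>x\<in>{x. c x \<noteq> \<zero>}. c x \<otimes> \<phi> x y)"
proof -
  interpret Y: module k "free_module k Y" by (rule free_is_module)
  have "free_lift k (free_module k Y) \<phi> c y = (\<Oplus>x\<in>{x. c x \<noteq> \<zero>}. (c x \<odot>\<^bsub>free_module k Y\<^esub> \<phi> x) y)"
    unfolding free_lift_def
    by (rule free_finsum_apply) (use assms in \<open>auto simp: free_carrier_iff[of c] intro!: Y.smult_closed\<close>)
  then show ?thesis by (simp add: free_smult)
qed

lemma free_expand:
  assumes c: "c \<in> carrier (free_module k X)"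
  shows "free_lift k (free_module k X) (free_gen k) c = c"
proof
  fix y
  note cc = c[unfolded free_carrier_iff]
  have "free_lift k (free_module k X) (free_gen k) c y = (\<Oplus>x\<in>{x. c x \<noteq> \<zero>}. c x \<otimes> free_gen k x y)"
    by (rule free_lift_free_apply) (use c in \<open>auto simp: free_gen_closed\<close>)
  \<comment> \<open>The index \<open>y\<close> is put in because it may lie outside the support;
    then exactly one term, \<open>c y\<close>, is possibly nonzero.\<close>
  also have "\<dots> = (\<Oplus>x\<in>insert y {x. c x \<noteq> \<zero>}. c x \<otimes> free_gen k x y)"
    by (rule add.finprod_mono_neutral_cong_left) (use cc in \<open>auto simp: free_gen_def\<close>)
  also have "\<dots> = (\<Oplus>x\<in>insert y {x. c x \<noteq> \<zero>}. if y = x then c x else \<zero>)"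
    by (rule finsum_cong') (use cc in \<open>auto simp: free_gen_def\<close>)
  also have "\<dots> = c y"
    by (rule add.finprod_singleton) (use cc in auto)
  finally show "free_lift k (free_module k X) (free_gen k) c y = c y" .
qed

lemma free_hom_eq_lift:
  assumes N: "module k N" and h: "h \<in> module_homs k (free_module k X) N"
    and c: "c \<in> carrier (free_module k X)"
  shows "h c = free_lift k N (\<lambda>x. h (free_gen k x)) c"
proof -
  interpret N: module k N by fact
  interpret X: module k "free_module k X" by (rule free_is_module)
  have g: "free_gen k x \<in> carrier (free_module k X)" "c x \<in> carrier k" if "c x \<noteq> \<zero>" for x
    using that c by (auto simp: free_carrier_iff[of c] intro!: free_gen_closed)
  have "h c = h (free_lift k (free_module k X) (free_gen k) c)"
    by (simp add: free_expand[OF c])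
  also have "\<dots> = (\<Oplus>\<^bsub>N\<^esub>x\<in>{x. c x \<noteq> \<zero>}. h (c x \<odot>\<^bsub>free_module k X\<^esub> free_gen k x))"
    unfolding free_lift_def
    by (rule module_homs_finsum[OF X.module_axioms N h]) (use g in auto)
  also have "\<dots> = free_lift k N (\<lambda>x. h (free_gen k x)) c"
    unfolding free_lift_def
    by (rule N.M.finsum_cong')
      (use g in \<open>auto simp: module_homs_smult[OF h] module_homs_closed[OF h]\<close>)
  finally show ?thesis .
qed

lemma free_lift_cong:
  assumes "module k N" "\<And>x. x \<in> X \<Longrightarrow> \<phi> x = \<psi> x" "\<psi> \<in> X \<rightarrow> carrier N"
    "c \<in> carrier (free_module k X)"
  shows "free_lift k N \<phi> c = free_lift k N \<psi> c"
proof -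
  interpret N: module k N by fact
  have "x \<in> X" "c x \<in> carrier k" if "c x \<noteq> \<zero>" for x
    using that assms(4) by (auto simp: free_carrier_iff)
  then show ?thesis
    unfolding free_lift_def by (intro N.M.finsum_cong') (use assms in \<open>auto simp: Pi_iff\<close>)
qed

lemma free_hom_ext:
  assumes "module k N" "g \<in> module_homs k (free_module k X) N" "h \<in> module_homs k (free_module k X) N"
    and "\<And>x. x \<in> X \<Longrightarrow> g (free_gen k x) = h (free_gen k x)" and c: "c \<in> carrier (free_module k X)"
  shows "g c = h c"
proof -
  have "free_lift k N (\<lambda>x. g (free_gen k x)) c = free_lift k N (\<lambda>x. h (free_gen k x)) c"
    by (rule free_lift_cong[OF assms(1,4) _ c])
      (use module_homs_closed[OF assms(3) free_gen_closed] in auto)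
  then show ?thesis
    using free_hom_eq_lift[OF assms(1,2) c] free_hom_eq_lift[OF assms(1,3) c] by simp
qed

text \<open>\<open>free_map\<close> adds up coefficients along the fibres of \<open>\<phi>\<close>,
  which is the coordinate at \<open>y\<close> of the lift. In the latter form linearity is already
  known.\<close>

lemma free_map_eq_lift:
  assumes \<phi>: "\<And>x. x \<in> X \<Longrightarrow> \<phi> x \<in> Y" and c: "c \<in> carrier (free_module k X)"
  shows "free_map k X \<phi> c = free_lift k (free_module k Y) (\<lambda>x. free_gen k (\<phi> x)) c"
proof
  fix y
  note cc = c[unfolded free_carrier_iff]
  have "free_lift k (free_module k Y) (\<lambda>x. free_gen k (\<phi> x)) c y =
      (\<Oplus>x\<in>{x. c x \<noteq> \<zero>}. c x \<otimes> free_gen k (\<phi> x) y)"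
    by (rule free_lift_free_apply) (use c \<phi> in \<open>auto simp: free_gen_closed\<close>)
  also have "\<dots> = free_map k X \<phi> c y"
    unfolding free_map_def
    by (rule add.finprod_mono_neutral_cong_right) (use cc in \<open>auto simp: free_gen_def\<close>)
  finally show "free_map k X \<phi> c y = free_lift k (free_module k Y) (\<lambda>x. free_gen k (\<phi> x)) c y" ..
qed

lemma free_map_hom:
  assumes \<phi>: "\<And>x. x \<in> X \<Longrightarrow> \<phi> x \<in> Y"
  shows "free_map k X \<phi> \<in> module_homs k (free_module k X) (free_module k Y)"
proof -
  have "free_lift k (free_module k Y) (\<lambda>x. free_gen k (\<phi> x)) \<in> module_homs k (free_module k X) (free_module k Y)"
    by (rule free_lift_hom) (use \<phi> in \<open>auto simp: free_is_module free_gen_closed\<close>)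
  then show ?thesis
    by (rule module_homs_cong[OF free_is_module]) (rule free_map_eq_lift[OF \<phi>])
qed

lemma free_map_gen:
  assumes "\<And>x. x \<in> X \<Longrightarrow> \<phi> x \<in> Y" "x \<in> X"
  shows "free_map k X \<phi> (free_gen k x) = free_gen k (\<phi> x)"
proof -
  have "free_lift k (free_module k Y) (\<lambda>x. free_gen k (\<phi> x)) (free_gen k x) = free_gen k (\<phi> x)"
    by (rule free_lift_gen) (simp_all add: assms free_is_module free_gen_closed)
  then show ?thesis
    using free_map_eq_lift[of X \<phi> Y "free_gen k x"] assms free_gen_closed by metis
qed

end

section \<open>The tensor product\<close>

lemma covariant_module: "covariant k F \<Longrightarrow> module k (ob F n)"
  and covariant_arr: "covariant k F \<Longrightarrow> f \<in> epi_mor l m \<Longrightarrow> arr F l m f \<in> module_homs k (ob F l) (ob F m)"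
  and covariant_id: "covariant k F \<Longrightarrow> x \<in> carrier (ob F n) \<Longrightarrow> arr F n n (epi_id n) x = x"
  and covariant_comp: "covariant k F \<Longrightarrow> f \<in> epi_mor l m \<Longrightarrow> g \<in> epi_mor m n \<Longrightarrow> x \<in> carrier (ob F l) \<Longrightarrow>
    arr F l n (compose {0..l} g f) x = arr F m n g (arr F l m f x)"
  unfolding covariant_def by auto

lemma contravariant_module: "contravariant k M \<Longrightarrow> module k (ob M n)"
  and contravariant_arr: "contravariant k M \<Longrightarrow> f \<in> epi_mor l m \<Longrightarrow> arr M l m f \<in> module_homs k (ob M m) (ob M l)"
  and contravariant_id: "contravariant k M \<Longrightarrow> x \<in> carrier (ob M n) \<Longrightarrow> arr M n n (epi_id n) x = x"
  and contravariant_comp: "contravariant k M \<Longrightarrow> f \<in> epi_mor l m \<Longrightarrow> g \<in> epi_mor m n \<Longrightarrow> x \<in> carrier (ob M n) \<Longrightarrow>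
    arr M l n (compose {0..l} g f) x = arr M l m f (arr M m n g x)"
  unfolding contravariant_def by auto

lemma contra_nat_hom: "\<eta> \<in> contra_nat k M N \<Longrightarrow> \<eta> n \<in> module_homs k (ob M n) (ob N n)"
  and contra_nat_arr: "\<eta> \<in> contra_nat k M N \<Longrightarrow> f \<in> epi_mor l m \<Longrightarrow> x \<in> carrier (ob M m) \<Longrightarrow>
    \<eta> l (arr M l m f x) = arr N l m f (\<eta> m x)"
  unfolding contra_nat_def by auto

lemma contra_nat_closed:
  "\<eta> \<in> contra_nat k M N \<Longrightarrow> x \<in> carrier (ob M n) \<Longrightarrow> \<eta> n x \<in> carrier (ob N n)"
  by (rule module_homs_closed[OF contra_nat_hom])

text \<open>The maps that factor through the coend: linear in each variable and compatible with
  moving a morphism across, mirroring the five families in \<open>tensor_rels\<close>.\<close>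

definition balanced ::
    "('k, 'z) ring_scheme \<Rightarrow> ('k, 'a) epi_functor \<Rightarrow> ('k, 'b) epi_functor \<Rightarrow> ('k, 'w) module \<Rightarrow>
     (nat \<Rightarrow> 'a \<Rightarrow> 'b \<Rightarrow> 'w) \<Rightarrow> bool" where
  "balanced k M F W b \<longleftrightarrow>
     (\<forall>n. \<forall>y \<in> carrier (ob F n). (\<lambda>x. b n x y) \<in> module_homs k (ob M n) W) \<and>
     (\<forall>n. \<forall>x \<in> carrier (ob M n). (\<lambda>y. b n x y) \<in> module_homs k (ob F n) W) \<and>
     (\<forall>l m. \<forall>f \<in> epi_mor l m. \<forall>x \<in> carrier (ob M m). \<forall>y \<in> carrier (ob F l).
        b l (arr M l m f x) y = b m x (arr F l m f y))"

text \<open>The pure tensor of \<open>x\<close> and \<open>y\<close> at the object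
  \<open>n\<close>.\<close>

definition tensor_elem ::
    "('k, 'z) ring_scheme \<Rightarrow> ('k, 'a) epi_functor \<Rightarrow> ('k, 'b) epi_functor \<Rightarrow> nat \<Rightarrow> 'a \<Rightarrow> 'b \<Rightarrow>
     (nat \<times> 'a \<times> 'b \<Rightarrow> 'k) set" where
  "tensor_elem k M F n x y =
     tensor_ker k M F +>\<^bsub>free_module k (tensor_gens M F)\<^esub> free_gen k (n, x, y)"

lemma balancedD:
  assumes "balanced k M F W b"
  shows "y \<in> carrier (ob F n) \<Longrightarrow> (\<lambda>x. b n x y) \<in> module_homs k (ob M n) W"
    and "x \<in> carrier (ob M n) \<Longrightarrow> (\<lambda>y. b n x y) \<in> module_homs k (ob F n) W"
    and "f \<in> epi_mor l m \<Longrightarrow> x \<in> carrier (ob M m) \<Longrightarrow> y \<in> carrier (ob F l) \<Longrightarrow>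
        b l (arr M l m f x) y = b m x (arr F l m f y)"
  using assms unfolding balanced_def by auto

context
  fixes k :: "('k, 'z) ring_scheme" (structure)
    and M :: "('k, 'a) epi_functor" and F :: "('k, 'b) epi_functor"
  assumes cring: "cring k" and M: "contravariant k M" and F: "covariant k F"
begin

private abbreviation "A \<equiv> free_module k (tensor_gens M F)"

private lemma A: "module k A"
  by (rule free_is_module[OF cring])

interpretation cring k by (rule cring)
interpretation A: module k A by (rule A)

private lemmas clM = module.smult_closed[OF contravariant_module[OF M]]
  abelian_groupE(1)[OF module.axioms(2)[OF contravariant_module[OF M]]]
  module_homs_closed[OF contravariant_arr[OF M]]
private lemmas clF = module.smult_closed[OF covariant_module[OF F]]
  abelian_groupE(1)[OF module.axioms(2)[OF covariant_module[OF F]]]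
  module_homs_closed[OF covariant_arr[OF F]]

lemma tensor_gen_closed:
  "x \<in> carrier (ob M n) \<Longrightarrow> y \<in> carrier (ob F n) \<Longrightarrow> free_gen k (n, x, y) \<in> carrier A"
  by (rule free_gen_closed[OF cring]) (simp add: tensor_gens_def)

lemma tensor_rels_subset: "tensor_rels k M F \<subseteq> carrier A"
  unfolding tensor_rels_def Let_def a_minus_def
  by (auto intro!: A.M.a_closed A.M.a_inv_closed A.smult_closed tensor_gen_closed clM clF)

lemma tensor_ker_submodule: "submodule (tensor_ker k M F) k A"
  unfolding tensor_ker_def by (rule submodule_span[OF A tensor_rels_subset])

lemma tensor_is_module: "module k (tensor k M F)"
  unfolding tensor_def by (rule quotient_is_module[OF A tensor_ker_submodule])

text \<open>The kernel of \<open>h\<close> is a submodule, so it contains the span of the relators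
  as soon as it contains each of them. Only the values of \<open>h\<close> on generators are
  prescribed, so the lemma serves a \<open>free_lift\<close> as well as a \<open>free_map\<close>
  followed by a projection.\<close>

lemma tensor_ker_vanish:
  assumes W: "module k W" and b: "balanced k M F W b" and h: "h \<in> module_homs k A W"
    and hb: "\<And>n x y. x \<in> carrier (ob M n) \<Longrightarrow> y \<in> carrier (ob F n) \<Longrightarrow> h (free_gen k (n, x, y)) = b n x y"
    and c: "c \<in> tensor_ker k M F"
  shows "h c = \<zero>\<^bsub>W\<^esub>"
proof -
  interpret W: module k W by fact
  let ?K = "{c \<in> carrier A. h c = \<zero>\<^bsub>W\<^esub>}"
  have sub: "submodule ?K k A"
    by (rule submodule_kernel[OF A W h])
  have eq: "u \<ominus>\<^bsub>A\<^esub> v \<in> ?K" if "u \<in> carrier A" "v \<in> carrier A" "h u = h v" for u v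
    using that module_homs_minus[OF A W h] module_homs_closed[OF h]
    by (simp add: W.M.right_minus_eq)
  note h_simps = hb module_homs_add[OF h] module_homs_smult[OF h] tensor_gen_closed
    clM clF balancedD(3)[OF b]
    module_homs_add[OF balancedD(1)[OF b]] module_homs_add[OF balancedD(2)[OF b]]
    module_homs_smult[OF balancedD(1)[OF b]] module_homs_smult[OF balancedD(2)[OF b]]
  have "tensor_rels k M F \<subseteq> ?K"
    unfolding tensor_rels_def Let_def
    \<comment> \<open>Every relator is a difference of two vectors; \<open>eq\<close> reduces its
      membership to equality of their images, and each of these equalities is a clause of
      \<open>balanced\<close>.\<close>
    by (intro Un_least subsetI; elim CollectE exE conjE; hypsubst; rule eq; simp add: h_simps)
  then have "tensor_ker k M F \<subseteq> ?K"
    unfolding tensor_ker_def by (rule span_least[OF A sub])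
  with c show ?thesis by auto
qed

lemma tensor_elem_closed:
  "x \<in> carrier (ob M n) \<Longrightarrow> y \<in> carrier (ob F n) \<Longrightarrow> tensor_elem k M F n x y \<in> carrier (tensor k M F)"
  unfolding tensor_def tensor_elem_def
  by (rule module_homs_closed[OF quotient_proj[OF A tensor_ker_submodule] tensor_gen_closed])

lemma tensor_elem_balanced: "balanced k M F (tensor k M F) (tensor_elem k M F)"
proof -
  \<comment> \<open>Each identity required of pure tensors is the vanishing of one relator, so it
    suffices to find the difference in \<open>tensor_rels\<close>.\<close>
  have eq: "tensor_ker k M F +>\<^bsub>A\<^esub> u = tensor_ker k M F +>\<^bsub>A\<^esub> v"
    if "u \<ominus>\<^bsub>A\<^esub> v \<in> tensor_rels k M F" "u \<in> carrier A" "v \<in> carrier A" for u v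
    using that(1) span_superset[OF A, of "tensor_rels k M F"]
    unfolding coset_eq_iff[OF A tensor_ker_submodule that(2,3)] tensor_ker_def[symmetric] by blast
  note q = quotient_add[OF A tensor_ker_submodule] quotient_smult[OF A tensor_ker_submodule]
    tensor_gen_closed clM clF
  show ?thesis
    unfolding balanced_def
  proof (intro conjI allI ballI module_homsI)
    fix n x x' y
    assume "y \<in> carrier (ob F n)" "x \<in> carrier (ob M n)" "x' \<in> carrier (ob M n)"
    then show "tensor_elem k M F n (x \<oplus>\<^bsub>ob M n\<^esub> x') y =
        tensor_elem k M F n x y \<oplus>\<^bsub>tensor k M F\<^esub> tensor_elem k M F n x' y"
      unfolding tensor_elem_def tensor_def
      by (simp add: q, intro eq) (auto simp: tensor_rels_def Let_def q)
  next
    fix n x y y'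
    assume "x \<in> carrier (ob M n)" "y \<in> carrier (ob F n)" "y' \<in> carrier (ob F n)"
    then show "tensor_elem k M F n x (y \<oplus>\<^bsub>ob F n\<^esub> y') =
        tensor_elem k M F n x y \<oplus>\<^bsub>tensor k M F\<^esub> tensor_elem k M F n x y'"
      unfolding tensor_elem_def tensor_def
      by (simp add: q, intro eq) (auto simp: tensor_rels_def Let_def q)
  next
    fix n x y a
    assume "y \<in> carrier (ob F n)" "a \<in> carrier k" "x \<in> carrier (ob M n)"
    then show "tensor_elem k M F n (a \<odot>\<^bsub>ob M n\<^esub> x) y =
        a \<odot>\<^bsub>tensor k M F\<^esub> tensor_elem k M F n x y"
      unfolding tensor_elem_def tensor_def
      by (simp add: q, intro eq) (auto simp: tensor_rels_def Let_def q)
  next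
    fix n x y a
    assume "x \<in> carrier (ob M n)" "a \<in> carrier k" "y \<in> carrier (ob F n)"
    then show "tensor_elem k M F n x (a \<odot>\<^bsub>ob F n\<^esub> y) =
        a \<odot>\<^bsub>tensor k M F\<^esub> tensor_elem k M F n x y"
      unfolding tensor_elem_def tensor_def
      by (simp add: q, intro eq) (auto simp: tensor_rels_def Let_def q)
  next
    fix l m f x y
    assume "f \<in> epi_mor l m" "x \<in> carrier (ob M m)" "y \<in> carrier (ob F l)"
    then show "tensor_elem k M F l (arr M l m f x) y = tensor_elem k M F m x (arr F l m f y)"
      unfolding tensor_elem_def
      by (intro eq) (auto simp: tensor_rels_def Let_def q)
  qed (simp_all add: tensor_elem_closed)
qed

text \<open>The existence half of the universal property of the coend; \<open>tensor_hom_ext\<close>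
  is the uniqueness half, and reduces later identities between maps out of a tensor product to pure
  tensors.\<close>

lemma tensor_lift:
  assumes W: "module k W" and b: "balanced k M F W b"
  obtains h where "h \<in> module_homs k (tensor k M F) W"
    "\<And>n x y. x \<in> carrier (ob M n) \<Longrightarrow> y \<in> carrier (ob F n) \<Longrightarrow> h (tensor_elem k M F n x y) = b n x y"
proof -
  let ?b = "\<lambda>(n, x, y). b n x y"
  have bc: "?b \<in> tensor_gens M F \<rightarrow> carrier W"
    using module_homs_closed[OF balancedD(1)[OF b]] by (auto simp: tensor_gens_def)
  have h: "free_lift k W ?b \<in> module_homs k A W"
    by (rule free_lift_hom[OF cring W bc])
  have hb: "free_lift k W ?b (free_gen k (n, x, y)) = b n x y"
    if "x \<in> carrier (ob M n)" "y \<in> carrier (ob F n)" for n x y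
    using free_lift_gen[OF cring W, of ?b "(n, x, y)"] that module_homs_closed[OF balancedD(1)[OF b]]
    by simp
  obtain h' where h': "h' \<in> module_homs k (tensor k M F) W"
    "\<And>c. c \<in> carrier A \<Longrightarrow> h' (tensor_ker k M F +>\<^bsub>A\<^esub> c) = free_lift k W ?b c"
    using quotient_lift[OF A tensor_ker_submodule W h tensor_ker_vanish[OF W b h hb]]
    unfolding tensor_def by metis
  show ?thesis
    by (rule that[OF h'(1)]) (simp add: tensor_elem_def h'(2) tensor_gen_closed hb)
qed

lemma tensor_hom_ext:
  assumes W: "module k W" and g: "g \<in> module_homs k (tensor k M F) W"
    and h: "h \<in> module_homs k (tensor k M F) W"
    and eq: "\<And>n x y. x \<in> carrier (ob M n) \<Longrightarrow> y \<in> carrier (ob F n) \<Longrightarrow>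
      g (tensor_elem k M F n x y) = h (tensor_elem k M F n x y)"
    and t: "t \<in> carrier (tensor k M F)"
  shows "g t = h t"
proof -
  let ?p = "\<lambda>c. tensor_ker k M F +>\<^bsub>A\<^esub> c"
  have p: "?p \<in> module_homs k A (tensor k M F)"
    unfolding tensor_def by (rule quotient_proj[OF A tensor_ker_submodule])
  obtain c where c: "c \<in> carrier A" "t = ?p c"
    using t unfolding tensor_def by (auto simp: carrier_quotient[OF A])
  have "g (?p c) = h (?p c)"
  proof (rule free_hom_ext[OF cring W module_homs_comp[OF g p] module_homs_comp[OF h p] _ c(1)])
    fix z assume "z \<in> tensor_gens M F"
    then obtain n x y where "z = (n, x, y)" "x \<in> carrier (ob M n)" "y \<in> carrier (ob F n)"
      by (auto simp: tensor_gens_def)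
    then show "g (?p (free_gen k z)) = h (?p (free_gen k z))"
      using eq[of x n y] unfolding tensor_elem_def by simp
  qed
  then show ?thesis using c by simp
qed

end

text \<open>Relators need not be traced one by one: following \<open>free_map\<close> by the
  projection gives the linear map attached to the balanced map \<open>tensor_elem\<close> after
  \<open>\<eta>\<close>, so it kills \<open>tensor_ker\<close>, and hence \<open>free_map\<close>
  sends one kernel into the other.\<close>

lemma tensor_map:
  fixes k :: "('k, 'z) ring_scheme" and M :: "('k, 'a) epi_functor"
    and M' :: "('k, 'c) epi_functor" and F :: "('k, 'b) epi_functor"
  assumes cring: "cring k" and M: "contravariant k M" and M': "contravariant k M'"
    and F: "covariant k F" and \<eta>: "\<eta> \<in> contra_nat k M M'"
  shows tensor_map_hom: "tensor_map k M M' F \<eta> \<in> module_homs k (tensor k M F) (tensor k M' F)"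
    and tensor_map_elem: "x \<in> carrier (ob M n) \<Longrightarrow> y \<in> carrier (ob F n) \<Longrightarrow>
      tensor_map k M M' F \<eta> (tensor_elem k M F n x y) = tensor_elem k M' F n (\<eta> n x) y"
proof -
  let ?A = "free_module k (tensor_gens M F)" and ?A' = "free_module k (tensor_gens M' F)"
  let ?\<phi> = "\<lambda>(n, x, y :: 'b). (n, \<eta> n x, y)"
  let ?p = "\<lambda>c. tensor_ker k M' F +>\<^bsub>?A'\<^esub> c"
  note A = free_is_module[OF cring, of "tensor_gens M F"]
    and A' = free_is_module[OF cring, of "tensor_gens M' F"]
    and K = tensor_ker_submodule[OF cring M F] and K' = tensor_ker_submodule[OF cring M' F]
  have \<phi>: "?\<phi> g \<in> tensor_gens M' F" if "g \<in> tensor_gens M F" for g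
    using that contra_nat_closed[OF \<eta>] by (auto simp: tensor_gens_def)
  note h = free_map_hom[OF cring, of "tensor_gens M F" ?\<phi>, OF \<phi>]
  have p: "?p \<in> module_homs k ?A' (tensor k M' F)"
    unfolding tensor_def by (rule quotient_proj[OF A' K'])
  have hgen: "free_map k (tensor_gens M F) ?\<phi> (free_gen k (n, x, y)) = free_gen k (n, \<eta> n x, y)"
    if "x \<in> carrier (ob M n)" "y \<in> carrier (ob F n)" for n x y
    using free_map_gen[OF cring, of "tensor_gens M F" ?\<phi>, OF \<phi>, of "(n, x, y)"] that
    by (simp add: tensor_gens_def)
  have phgen: "?p (free_map k (tensor_gens M F) ?\<phi> (free_gen k (n, x, y))) = tensor_elem k M' F n (\<eta> n x) y"
    if "x \<in> carrier (ob M n)" "y \<in> carrier (ob F n)" for n x y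
    unfolding hgen[OF that] tensor_elem_def ..
  note b' = tensor_elem_balanced[OF cring M' F]
  have b: "balanced k M F (tensor k M' F) (\<lambda>n x y. tensor_elem k M' F n (\<eta> n x) y)"
    unfolding balanced_def
    using module_homs_comp[OF balancedD(1)[OF b'] contra_nat_hom[OF \<eta>]]
      balancedD(2,3)[OF b'] contra_nat_closed[OF \<eta>] contra_nat_arr[OF \<eta>] by auto
  have vanish: "?p (free_map k (tensor_gens M F) ?\<phi> c) = \<zero>\<^bsub>tensor k M' F\<^esub>"
    if c: "c \<in> tensor_ker k M F" for c
    by (rule tensor_ker_vanish[OF cring M F tensor_is_module[OF cring M' F] b
          module_homs_comp[OF p h] phgen c])
  have ker: "free_map k (tensor_gens M F) ?\<phi> c \<in> tensor_ker k M' F" if c: "c \<in> tensor_ker k M F" for c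
  proof -
    have cA: "c \<in> carrier ?A" using c subgroup.subset[OF submodule.axioms(1)[OF K]] by auto
    show ?thesis
      using vanish[OF c] coset_eq_zero_iff[OF A' K' module_homs_closed[OF h cA]]
      by (simp add: tensor_def quotient_zero[OF A'])
  qed
  have coset: "tensor_map k M M' F \<eta> (tensor_ker k M F +>\<^bsub>?A\<^esub> c) = ?p (free_map k (tensor_gens M F) ?\<phi> c)"
    if "c \<in> carrier ?A" for c
    unfolding tensor_map_def
    by (rule quotient_map_coset[OF A A' K K' h ker that])
  show "tensor_map k M M' F \<eta> \<in> module_homs k (tensor k M F) (tensor k M' F)"
  proof -
    obtain g where g: "g \<in> module_homs k (tensor k M F) (tensor k M' F)"
      "\<And>c. c \<in> carrier ?A \<Longrightarrow> g (tensor_ker k M F +>\<^bsub>?A\<^esub> c) = ?p (free_map k (tensor_gens M F) ?\<phi> c)"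
      by (rule quotient_lift[OF A K tensor_is_module[OF cring M' F] module_homs_comp[OF p h] vanish])
        (assumption, auto simp: tensor_def)
    show ?thesis
      by (rule module_homs_cong[OF tensor_is_module[OF cring M F] g(1)])
        (auto simp: tensor_def carrier_quotient[OF A] coset g(2))
  qed
  show "tensor_map k M M' F \<eta> (tensor_elem k M F n x y) = tensor_elem k M' F n (\<eta> n x) y"
    if "x \<in> carrier (ob M n)" "y \<in> carrier (ob F n)"
    unfolding tensor_elem_def
    using coset[OF tensor_gen_closed[OF cring M F that]] hgen[OF that] by simp
qed

section \<open>Homology\<close>

lemma cycles_submodule:
  assumes "\<And>n. module k (C n)" "\<And>n. d n \<in> module_homs k (C (Suc n)) (C n)"
  shows "submodule (cycles C d n) k (C n)"
  using submodule_kernel[OF assms(1,1,2)] module.carrier_is_submodule[OF assms(1)]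
  by (cases n) (simp_all add: cycles_def)

lemma boundaries_submodule:
  assumes "\<And>n. module k (C n)" "\<And>n. d n \<in> module_homs k (C (Suc n)) (C n)"
  shows "submodule (boundaries C d n) k (C n)"
  unfolding boundaries_def by (rule submodule_image[OF assms(1,1,2)])

lemma cycles_chain_map:
  assumes "\<And>n. module k (C n)" "\<And>n. module k (C' n)"
    and "\<And>n. h n \<in> module_homs k (C n) (C' n)"
    and "\<And>n x. x \<in> carrier (C (Suc n)) \<Longrightarrow> d' n (h (Suc n) x) = h n (d n x)"
    and "x \<in> cycles C d n"
  shows "h n x \<in> cycles C' d' n"
  using assms(5) module_homs_closed[OF assms(3)] module_homs_zero[OF assms(1,2,3)]
  by (cases n) (auto simp: cycles_def assms(4))

text \<open>A strict left inverse makes the induced map injective. It is surjective because the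
  class of \<open>\<beta> p z\<close> is sent to that of \<open>z\<close>; this asks the other
  composite to be the identity only modulo boundaries, on cycles of degree \<open>p\<close>.\<close>

lemma homology_iso:
  fixes C :: "nat \<Rightarrow> ('k, 'a) module" and C' :: "nat \<Rightarrow> ('k, 'b) module"
  assumes C: "\<And>n. module k (C n)" and d: "\<And>n. d n \<in> module_homs k (C (Suc n)) (C n)"
    and dd: "\<And>n x. x \<in> carrier (C (Suc (Suc n))) \<Longrightarrow> d n (d (Suc n) x) = \<zero>\<^bsub>C n\<^esub>"
    and C': "\<And>n. module k (C' n)" and d': "\<And>n. d' n \<in> module_homs k (C' (Suc n)) (C' n)"
    and dd': "\<And>n x. x \<in> carrier (C' (Suc (Suc n))) \<Longrightarrow> d' n (d' (Suc n) x) = \<zero>\<^bsub>C' n\<^esub>"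
    and \<alpha>: "\<And>n. \<alpha> n \<in> module_homs k (C n) (C' n)" and \<beta>: "\<And>n. \<beta> n \<in> module_homs k (C' n) (C n)"
    and \<alpha>d: "\<And>n x. x \<in> carrier (C (Suc n)) \<Longrightarrow> d' n (\<alpha> (Suc n) x) = \<alpha> n (d n x)"
    and \<beta>d: "\<And>n x. x \<in> carrier (C' (Suc n)) \<Longrightarrow> d n (\<beta> (Suc n) x) = \<beta> n (d' n x)"
    and \<beta>\<alpha>: "\<And>n x. x \<in> carrier (C n) \<Longrightarrow> \<beta> n (\<alpha> n x) = x"
    and \<alpha>\<beta>: "\<And>z. z \<in> cycles C' d' p \<Longrightarrow> \<alpha> p (\<beta> p z) \<ominus>\<^bsub>C' p\<^esub> z \<in> boundaries C' d' p"
  shows "module_iso k (homology C d p) (homology C' d' p)"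
proof -
  let ?Z = "cycles C d p" and ?B = "boundaries C d p"
  let ?Z' = "cycles C' d' p" and ?B' = "boundaries C' d' p"
  let ?M = "(C p)\<lparr>carrier := ?Z\<rparr>" and ?M' = "(C' p)\<lparr>carrier := ?Z'\<rparr>"
  note Z = cycles_submodule[where C = C and d = d, OF C d, of p] and B = boundaries_submodule[where C = C and d = d, OF C d, of p]
  note Z' = cycles_submodule[where C = C' and d = d', OF C' d', of p] and B' = boundaries_submodule[where C = C' and d = d', OF C' d', of p]
  have BZ: "?B \<subseteq> ?Z"
    using module_homs_closed[OF d] dd by (cases p) (auto simp: cycles_def boundaries_def)
  have BZ': "?B' \<subseteq> ?Z'"
    using module_homs_closed[OF d'] dd' by (cases p) (auto simp: cycles_def boundaries_def)
  note M = submodule.submodule_is_module[OF Z C] and BM = submodule_inside[OF C Z B BZ]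
  note M' = submodule.submodule_is_module[OF Z' C'] and BM' = submodule_inside[OF C' Z' B' BZ']
  have sub: "?Z \<subseteq> carrier (C p)" "?Z' \<subseteq> carrier (C' p)"
    using Z Z' by (auto dest!: submodule.axioms(1) subgroup.subset)
  have \<alpha>Z: "\<alpha> p x \<in> ?Z'" if "x \<in> ?Z" for x
    by (rule cycles_chain_map[where C = C and d = d, OF C C' \<alpha> \<alpha>d that])
  have \<beta>Z: "\<beta> p x \<in> ?Z" if "x \<in> ?Z'" for x
    by (rule cycles_chain_map[where C = C' and d = d', OF C' C \<beta> \<beta>d that])
  have \<alpha>M: "\<alpha> p \<in> module_homs k ?M ?M'"
    using \<alpha>Z sub(1) by (intro module_homsI)
      (auto simp: subset_iff module_homs_add[OF \<alpha>] module_homs_smult[OF \<alpha>])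
  have \<beta>M: "\<beta> p \<in> module_homs k ?M' ?M"
    using \<beta>Z sub(2) by (intro module_homsI)
      (auto simp: subset_iff module_homs_add[OF \<beta>] module_homs_smult[OF \<beta>])
  have \<alpha>B: "\<alpha> p x \<in> ?B'" if "x \<in> ?B" for x
    using that \<alpha>d module_homs_closed[OF \<alpha>] by (auto simp: boundaries_def intro!: rev_image_eqI)
  have \<beta>B: "\<beta> p x \<in> ?B" if "x \<in> ?B'" for x
    using that \<beta>d module_homs_closed[OF \<beta>] by (auto simp: boundaries_def intro!: rev_image_eqI)
  \<comment> \<open>Negation in a record depends on its carrier, so differences computed among the
    cycles and in \<open>C' p\<close> are identified through linearity of the inclusion.\<close>
  have incl: "(\<lambda>x. x) \<in> module_homs k ?M' (C' p)"
    using sub(2) by (intro module_homsI) auto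
  obtain h where h: "h \<in> module_homs k (homology C d p) (homology C' d' p)"
    "\<And>x. x \<in> ?Z \<Longrightarrow> h (?B +>\<^bsub>?M\<^esub> x) = ?B' +>\<^bsub>?M'\<^esub> \<alpha> p x"
  proof (rule quotient_lift[OF M BM quotient_is_module[OF M' BM']
        module_homs_comp[OF quotient_proj[OF M' BM'] \<alpha>M]])
    show "?B' +>\<^bsub>?M'\<^esub> \<alpha> p x = \<zero>\<^bsub>quotient_module ?M' ?B'\<^esub>" if "x \<in> ?B" for x
      using coset_eq_zero_iff[OF M' BM', of "\<alpha> p x"] \<alpha>B[OF that] BZ'
      by (auto simp: quotient_zero[OF M'])
  qed (auto simp: homology_def)
  have "inj_on h (carrier (homology C d p))"
  proof (rule inj_onI)
    fix X Y assume "X \<in> carrier (homology C d p)" "Y \<in> carrier (homology C d p)" and eq: "h X = h Y"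
    then obtain x y where x: "x \<in> ?Z" "X = ?B +>\<^bsub>?M\<^esub> x" and y: "y \<in> ?Z" "Y = ?B +>\<^bsub>?M\<^esub> y"
      by (auto simp: homology_def carrier_quotient[OF M])
    then have "\<alpha> p x \<ominus>\<^bsub>?M'\<^esub> \<alpha> p y \<in> ?B'"
      using eq coset_eq_iff[OF M' BM', of "\<alpha> p x" "\<alpha> p y"] \<alpha>Z by (simp add: h)
    then have "\<beta> p (\<alpha> p x \<ominus>\<^bsub>?M'\<^esub> \<alpha> p y) \<in> ?B" by (rule \<beta>B)
    then have "x \<ominus>\<^bsub>?M\<^esub> y \<in> ?B"
      using module_homs_minus[OF M' M \<beta>M, of "\<alpha> p x" "\<alpha> p y"] \<alpha>Z x(1) y(1)
        \<beta>\<alpha>[OF subsetD[OF sub(1)]] by simp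
    then show "X = Y"
      using coset_eq_iff[OF M BM, of x y] x y by simp
  qed
  moreover have "carrier (homology C' d' p) \<subseteq> h ` carrier (homology C d p)"
  proof
    fix X assume "X \<in> carrier (homology C' d' p)"
    then obtain z where z: "z \<in> ?Z'" "X = ?B' +>\<^bsub>?M'\<^esub> z"
      by (auto simp: homology_def carrier_quotient[OF M'])
    have "\<alpha> p (\<beta> p z) \<ominus>\<^bsub>?M'\<^esub> z \<in> ?B'"
      using \<alpha>\<beta>[OF z(1)] module_homs_minus[OF M' C' incl, of "\<alpha> p (\<beta> p z)" z] z \<alpha>Z \<beta>Z by simp
    then have "h (?B +>\<^bsub>?M\<^esub> \<beta> p z) = X"
      using coset_eq_iff[OF M' BM', of "\<alpha> p (\<beta> p z)" z] z \<alpha>Z \<beta>Z by (simp add: h)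
    then show "X \<in> h ` carrier (homology C d p)"
      using \<beta>Z[OF z(1)] by (auto simp: homology_def carrier_quotient[OF M])
  qed
  ultimately show ?thesis
    unfolding module_iso_def bij_betw_def using h(1) module_homs_closed[OF h(1)] by blast
qed

section \<open>Order-preserving surjections\<close>

lemma epi_mor_maps: "f \<in> epi_mor l m \<Longrightarrow> f \<in> {0..l} \<rightarrow> {0..m}"
  unfolding epi_mor_def by auto

lemma epi_mor_le: "f \<in> epi_mor l m \<Longrightarrow> j \<le> l \<Longrightarrow> f j \<le> m"
  using epi_mor_maps by fastforce

lemma epi_morI:
  assumes "f \<in> extensional {0..l}" "\<And>i j. i \<le> j \<Longrightarrow> j \<le> l \<Longrightarrow> f i \<le> f j"
    and "\<And>j. j \<le> l \<Longrightarrow> f j \<le> m" "\<And>i. i \<le> m \<Longrightarrow> \<exists>j\<le>l. f j = i"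
  shows "f \<in> epi_mor l m"
proof -
  have "{0..m} \<subseteq> f ` {0..l}"
  proof
    fix i assume "i \<in> {0..m}"
    then obtain j where "j \<le> l" "f j = i" using assms(4)[of i] by auto
    then show "i \<in> f ` {0..l}" by (intro image_eqI[of _ _ j]) auto
  qed
  then show ?thesis
    unfolding epi_mor_def using assms(1-3) by (auto intro!: mono_onI)
qed

lemma epi_mor_mono: "f \<in> epi_mor l m \<Longrightarrow> i \<le> j \<Longrightarrow> j \<le> l \<Longrightarrow> f i \<le> f j"
  unfolding epi_mor_def by (auto intro: mono_onD[of "{0..l}"])

lemma epi_mor_surj: "f \<in> epi_mor l m \<Longrightarrow> i \<le> m \<Longrightarrow> \<exists>j\<le>l. f j = i"
  unfolding epi_mor_def by (auto simp: set_eq_iff image_iff) (metis atLeastAtMost_iff zero_le)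

lemma epi_mor_ext:
  "f \<in> epi_mor l m \<Longrightarrow> g \<in> epi_mor l m' \<Longrightarrow> (\<And>j. j \<le> l \<Longrightarrow> f j = g j) \<Longrightarrow> f = g"
  unfolding epi_mor_def by (auto intro: extensionalityI)

lemma epi_mor_id: "epi_id n \<in> epi_mor n n"
  by (rule epi_morI) auto

lemma epi_mor_compose:
  assumes f: "f \<in> epi_mor l m" and g: "g \<in> epi_mor m n"
  shows "compose {0..l} g f \<in> epi_mor l n"
proof (rule epi_morI)
  fix i assume "i \<le> n"
  then obtain j where "j \<le> m" "g j = i" using epi_mor_surj[OF g] by auto
  moreover obtain j' where "j' \<le> l" "f j' = j" using epi_mor_surj[OF f \<open>j \<le> m\<close>] by auto
  ultimately show "\<exists>j\<le>l. compose {0..l} g f j = i" by (auto simp: compose_def)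
qed (auto simp: compose_def epi_mor_le[OF f] epi_mor_le[OF g] intro!: epi_mor_mono[OF f] epi_mor_mono[OF g])

lemma epi_mor_assoc:
  "f \<in> epi_mor l m \<Longrightarrow> compose {0..l} h (compose {0..l} g f) = compose {0..l} (compose {0..m} h g) f"
  by (rule compose_assoc[OF epi_mor_maps])

lemma epi_mor_compose_id: "f \<in> epi_mor l m \<Longrightarrow> compose {0..l} f (epi_id l) = f"
  by (rule epi_mor_ext[OF epi_mor_compose[OF epi_mor_id]]) (auto simp: compose_def)

lemma epi_mor_id_compose: "f \<in> epi_mor l m \<Longrightarrow> compose {0..l} (epi_id m) f = f"
  by (rule epi_mor_ext[OF epi_mor_compose[OF _ epi_mor_id]]) (auto simp: compose_def epi_mor_le)

text \<open>A surjection cannot increase cardinality. This makes the representable of degree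
  \<open>m\<close> vanish at objects below \<open>m\<close>, on which the rigidity of the
  representable resolution rests.\<close>

lemma epi_mor_empty:
  assumes "l < m"
  shows "epi_mor l m = {}"
proof -
  have "card {0..m} \<le> card {0..l}" if "f \<in> epi_mor l m" for f
    using that card_image_le[of "{0..l}" f] by (simp add: epi_mor_def)
  then show ?thesis using assms by fastforce
qed

lemma finite_epi_mor: "finite (epi_mor l m)"
  by (rule finite_subset[of _ "{0..l} \<rightarrow>\<^sub>E {0..m}"])
    (auto simp: epi_mor_def PiE_iff extensional_def intro!: finite_PiE)

lemma epi_mor_0: "f \<in> epi_mor l m \<Longrightarrow> f 0 = 0"
  using epi_mor_surj[of f l m 0] epi_mor_mono[of f l m 0] by fastforce

lemma face_epi:
  assumes "i \<le> n"
  shows "face (Suc n) i \<in> epi_mor (Suc n) n"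
proof (rule epi_morI)
  fix j assume "j \<le> n"
  \<comment> \<open>The preimage comes from the section of \<open>face (Suc n) i\<close> that skips
    \<open>Suc i\<close>, one of the two points identified.\<close>
  then have "(if j \<le> i then j else Suc j) \<le> Suc n" "face (Suc n) i (if j \<le> i then j else Suc j) = j"
    by (auto simp: face_def)
  then show "\<exists>j'\<le>Suc n. face (Suc n) i j' = j" by blast
qed (use assms in \<open>auto simp: face_def\<close>)

text \<open>Both composites identify \<open>i\<close> with \<open>Suc i\<close> and \<open>j\<close>
  with \<open>Suc j\<close>. This simplicial identity is the reason why \<open>bar_diff\<close> and
  \<open>rep_diff\<close> square to zero.\<close>

lemma face_face:
  assumes "i < j" "j \<le> Suc n"
  shows "compose {0..Suc (Suc n)} (face (Suc n) i) (face (Suc (Suc n)) j) =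
    compose {0..Suc (Suc n)} (face (Suc n) (j - 1)) (face (Suc (Suc n)) i)"
  by (rule epi_mor_ext[OF epi_mor_compose[OF face_epi face_epi] epi_mor_compose[OF face_epi face_epi]])
    (use assms in \<open>auto simp: compose_def face_def\<close>)

section \<open>Natural transformations and free functors\<close>

lemma contra_natI:
  assumes "\<And>n. \<eta> n \<in> module_homs k (ob M n) (ob N n)"
    and "\<And>l m f x. f \<in> epi_mor l m \<Longrightarrow> x \<in> carrier (ob M m) \<Longrightarrow> \<eta> l (arr M l m f x) = arr N l m f (\<eta> m x)"
  shows "\<eta> \<in> contra_nat k M N"
  using assms unfolding contra_nat_def by auto

lemma contra_nat_comp:
  assumes "\<theta> \<in> contra_nat k N L" "\<eta> \<in> contra_nat k M N"
  shows "(\<lambda>n x. \<theta> n (\<eta> n x)) \<in> contra_nat k M L"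
  by (rule contra_natI)
    (auto intro!: module_homs_comp[OF contra_nat_hom[OF assms(1)] contra_nat_hom[OF assms(2)]]
      simp: contra_nat_arr[OF assms(1)] contra_nat_arr[OF assms(2)] contra_nat_closed[OF assms(2)])

lemma contra_nat_id: "(\<lambda>n x. x) \<in> contra_nat k M M"
  by (rule contra_natI) (auto simp: module_homs_id)

lemma contra_nat_minus:
  assumes N: "contravariant k N" and "\<eta> \<in> contra_nat k M N" "\<theta> \<in> contra_nat k M N"
  shows "(\<lambda>n x. \<eta> n x \<ominus>\<^bsub>ob N n\<^esub> \<theta> n x) \<in> contra_nat k M N"
proof (rule contra_natI)
  fix l m f x assume fx: "f \<in> epi_mor l m" "x \<in> carrier (ob M m)"
  show "\<eta> l (arr M l m f x) \<ominus>\<^bsub>ob N l\<^esub> \<theta> l (arr M l m f x) = arr N l m f (\<eta> m x \<ominus>\<^bsub>ob N m\<^esub> \<theta> m x)"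
    using fx by (simp add: contra_nat_arr[OF assms(2)] contra_nat_arr[OF assms(3)]
      contra_nat_closed[OF assms(2)] contra_nat_closed[OF assms(3)]
      module_homs_minus[OF contravariant_module[OF N] contravariant_module[OF N] contravariant_arr[OF N]])
qed (rule module_homs_minus_map[OF contravariant_module[OF N] contra_nat_hom[OF assms(2)] contra_nat_hom[OF assms(3)]])

text \<open>Linearization of a contravariant functor \<open>S\<close> to sets with action
  \<open>act\<close>. Representables and free covers are both of this form, so functoriality and
  naturality are checked on basis elements, once for both.\<close>

definition free_functor ::
    "('k, 'z) ring_scheme \<Rightarrow> (nat \<Rightarrow> 'x set) \<Rightarrow> (nat \<Rightarrow> nat \<Rightarrow> (nat \<Rightarrow> nat) \<Rightarrow> 'x \<Rightarrow> 'x) \<Rightarrow>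
     ('k, 'x \<Rightarrow> 'k) epi_functor" where
  "free_functor k S act =
     \<lparr>ob = (\<lambda>l. free_module k (S l)), arr = (\<lambda>l m f. free_map k (S m) (act l m f))\<rparr>"

lemma free_functor_contravariant:
  assumes k: "cring k"
    and act: "\<And>l m f s. f \<in> epi_mor l m \<Longrightarrow> s \<in> S m \<Longrightarrow> act l m f s \<in> S l"
    and act_id: "\<And>n s. s \<in> S n \<Longrightarrow> act n n (epi_id n) s = s"
    and act_comp: "\<And>l m n f g s. f \<in> epi_mor l m \<Longrightarrow> g \<in> epi_mor m n \<Longrightarrow> s \<in> S n \<Longrightarrow>
      act l n (compose {0..l} g f) s = act l m f (act m n g s)"
  shows "contravariant k (free_functor k S act)"
proof -
  have hom: "free_map k (S m) (act l m f) \<in> module_homs k (free_module k (S m)) (free_module k (S l))"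
    if "f \<in> epi_mor l m" for l m f
    by (rule free_map_hom[OF k act[OF that]])
  note gen = free_map_gen[OF k act]
  note M = free_is_module[OF k]
  show ?thesis
    unfolding contravariant_def free_functor_def
  proof (simp add: M hom, intro conjI allI ballI)
    fix n x assume "x \<in> carrier (free_module k (S n))"
    then show "free_map k (S n) (act n n (epi_id n)) x = x"
      by (rule free_hom_ext[OF k M hom[OF epi_mor_id] module_homs_id, rotated])
        (simp add: gen[OF epi_mor_id] act_id)
  next
    fix l m n f g x
    assume f: "f \<in> epi_mor l m" and g: "g \<in> epi_mor m n" and x: "x \<in> carrier (free_module k (S n))"
    show "free_map k (S n) (act l n (compose {0..l} g f)) x =
        free_map k (S m) (act l m f) (free_map k (S n) (act m n g) x)"
      by (rule free_hom_ext[OF k M hom[OF epi_mor_compose[OF f g]] module_homs_comp[OF hom[OF f] hom[OF g]] _ x])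
        (simp add: gen[OF epi_mor_compose[OF f g]] gen[OF f] gen[OF g] act f g act_comp[OF f g])
  qed
qed

lemma free_functor_nat:
  assumes k: "cring k" and N: "contravariant k N"
    and act: "\<And>l m f s. f \<in> epi_mor l m \<Longrightarrow> s \<in> S m \<Longrightarrow> act l m f s \<in> S l"
    and \<eta>: "\<And>l. \<eta> l \<in> module_homs k (free_module k (S l)) (ob N l)"
    and nat: "\<And>l m f s. f \<in> epi_mor l m \<Longrightarrow> s \<in> S m \<Longrightarrow>
      \<eta> l (free_gen k (act l m f s)) = arr N l m f (\<eta> m (free_gen k s))"
  shows "\<eta> \<in> contra_nat k (free_functor k S act) N"
proof (rule contra_natI)
  fix l m f x
  assume f: "f \<in> epi_mor l m" and x: "x \<in> carrier (ob (free_functor k S act) m)"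
  have "\<eta> l (free_map k (S m) (act l m f) x) = arr N l m f (\<eta> m x)"
  proof (rule free_hom_ext[OF k contravariant_module[OF N] module_homs_comp[OF \<eta> free_map_hom[OF k]]
        module_homs_comp[OF contravariant_arr[OF N f] \<eta>]])
    show "x \<in> carrier (free_module k (S m))" using x by (simp add: free_functor_def)
  qed (simp_all add: act[OF f] free_map_gen[OF k act[OF f]] nat[OF f])
  then show "\<eta> l (arr (free_functor k S act) l m f x) = arr N l m f (\<eta> m x)"
    by (simp add: free_functor_def)
qed (simp add: free_functor_def \<eta>)

section \<open>Projective functors\<close>

text \<open>The cover has one copy of a representable for every element \<open>x\<close> of every
  \<open>P[m]\<close>; the triple \<open>(m, x, f)\<close> is the morphism \<open>f\<close> in the
  copy belonging to \<open>x\<close>.\<close>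

definition cover_gens :: "('k, 'c) epi_functor \<Rightarrow> nat \<Rightarrow> (nat \<times> 'c \<times> (nat \<Rightarrow> nat)) set" where
  "cover_gens P l = {(m, x, f). x \<in> carrier (ob P m) \<and> f \<in> epi_mor l m}"

definition free_cover ::
    "('k, 'z) ring_scheme \<Rightarrow> ('k, 'c) epi_functor \<Rightarrow> ('k, nat \<times> 'c \<times> (nat \<Rightarrow> nat) \<Rightarrow> 'k) epi_functor" where
  "free_cover k P = free_functor k (cover_gens P) (\<lambda>l m f (n, x, g). (n, x, compose {0..l} g f))"

lemma cover_act:
  "f \<in> epi_mor l m \<Longrightarrow> s \<in> cover_gens P m \<Longrightarrow>
    (case s of (n, x, g) \<Rightarrow> (n, x, compose {0..l} g f)) \<in> cover_gens P l"
  by (auto simp: cover_gens_def epi_mor_compose)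

lemma free_cover_contravariant:
  assumes "cring k"
  shows "contravariant k (free_cover k P)"
  unfolding free_cover_def
  by (rule free_functor_contravariant[OF assms cover_act])
    (auto simp: cover_gens_def epi_mor_compose_id epi_mor_assoc)

text \<open>The Yoneda lemma in each summand. The family \<open>v\<close> may be an arbitrary choice
  of elements, neither linear nor natural, since every element of \<open>P\<close> labels a summand
  of its own.\<close>

lemma free_cover_nat:
  fixes k :: "('k, 'z) ring_scheme" and P :: "('k, 'c) epi_functor"
  assumes k: "cring k" and N: "contravariant k N"
    and v: "\<And>m x. x \<in> carrier (ob P m) \<Longrightarrow> v m x \<in> carrier (ob N m)"
  obtains \<eta> where "\<eta> \<in> contra_nat k (free_cover k P) N"
    "\<And>l m x f. x \<in> carrier (ob P m) \<Longrightarrow> f \<in> epi_mor l m \<Longrightarrow> \<eta> l (free_gen k (m, x, f)) = arr N l m f (v m x)"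
proof -
  let ?v = "\<lambda>l (m, x, f). arr N l m f (v m x)"
  let ?\<eta> = "\<lambda>l. free_lift k (ob N l) (?v l)"
  note cl = module_homs_closed[OF contravariant_arr[OF N]]
  have gen: "?\<eta> l (free_gen k (m, x, f)) = arr N l m f (v m x)"
    if "x \<in> carrier (ob P m)" "f \<in> epi_mor l m" for l m x f
    using free_lift_gen[OF k contravariant_module[OF N], of "?v l" "(m, x, f)" l] that v cl by simp
  have "?\<eta> \<in> contra_nat k (free_cover k P) N"
    unfolding free_cover_def
  proof (rule free_functor_nat[OF k N cover_act])
    show "?\<eta> l \<in> module_homs k (free_module k (cover_gens P l)) (ob N l)" for l
      by (rule free_lift_hom[OF k contravariant_module[OF N]]) (auto simp: cover_gens_def v intro!: cl)
    show "?\<eta> l (free_gen k (case s of (n, x, g) \<Rightarrow> (n, x, compose {0..l} g f))) = arr N l m f (?\<eta> m (free_gen k s))"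
      if f: "f \<in> epi_mor l m" and s: "s \<in> cover_gens P m" for l m f s
    proof -
      obtain n x g where "s = (n, x, g)" "x \<in> carrier (ob P n)" "g \<in> epi_mor m n"
        using s by (auto simp: cover_gens_def)
      then show ?thesis
        using f v by (simp add: gen epi_mor_compose contravariant_comp[OF N])
    qed
  qed
  then show ?thesis using that gen by blast
qed

lemma free_cover_ext:
  assumes k: "cring k" and N: "contravariant k N" and \<eta>: "\<eta> \<in> contra_nat k (free_cover k P) N"
    and \<theta>: "\<theta> \<in> contra_nat k (free_cover k P) N"
    and "\<And>m x f. x \<in> carrier (ob P m) \<Longrightarrow> f \<in> epi_mor l m \<Longrightarrow>
      \<eta> l (free_gen k (m, x, f)) = \<theta> l (free_gen k (m, x, f))"
    and c: "c \<in> carrier (ob (free_cover k P) l)"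
  shows "\<eta> l c = \<theta> l c"
proof (rule free_hom_ext[where X = "cover_gens P l", OF k contravariant_module[OF N]])
  have ob: "ob (free_cover k P) l = free_module k (cover_gens P l)"
    by (simp add: free_cover_def free_functor_def)
  show "\<eta> l \<in> module_homs k (free_module k (cover_gens P l)) (ob N l)"
    "\<theta> l \<in> module_homs k (free_module k (cover_gens P l)) (ob N l)"
    using contra_nat_hom[OF \<eta>, of l] contra_nat_hom[OF \<theta>, of l] by (simp_all add: ob)
  show "c \<in> carrier (free_module k (cover_gens P l))" using c by (simp add: ob)
  show "\<eta> l (free_gen k s) = \<theta> l (free_gen k s)" if "s \<in> cover_gens P l" for s
    using that assms(5) by (auto simp: cover_gens_def)
qed

text \<open>Splitting the free cover of \<open>P\<close> reduces the lifting problem to a choice of preimages for the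
  generators, which is possible for functors on arbitrary types.\<close>

lemma projective_lift:
  fixes k :: "('k, 'z) ring_scheme" and P :: "('k, 'c) epi_functor"
    and E :: "('k, 'e) epi_functor" and B :: "('k, 'b) epi_functor"
  assumes k: "cring k" and P: "projective k P" and E: "contravariant k E" and B: "contravariant k B"
    and d: "d \<in> contra_nat k E B" and \<phi>: "\<phi> \<in> contra_nat k P B"
    and sub: "\<And>n x. x \<in> carrier (ob P n) \<Longrightarrow> \<phi> n x \<in> d n ` carrier (ob E n)"
  obtains \<psi> where "\<psi> \<in> contra_nat k P E" "\<And>n x. x \<in> carrier (ob P n) \<Longrightarrow> d n (\<psi> n x) = \<phi> n x"
proof -
  have cP: "contravariant k P" using P by (simp add: projective_def)
  note cC = free_cover_contravariant[OF k, of P]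
  obtain \<pi> where \<pi>: "\<pi> \<in> contra_nat k (free_cover k P) P"
    "\<And>l m x f. x \<in> carrier (ob P m) \<Longrightarrow> f \<in> epi_mor l m \<Longrightarrow> \<pi> l (free_gen k (m, x, f)) = arr P l m f x"
    using free_cover_nat[OF k cP, of P "\<lambda>m x. x"] by blast
  have ob: "ob (free_cover k P) l = free_module k (cover_gens P l)" for l
    by (simp add: free_cover_def free_functor_def)
  have "\<pi> \<in> contra_epi k (free_cover k P) P"
    unfolding contra_epi_def
  proof (intro CollectI conjI \<pi> allI equalityI subsetI)
    fix n x assume x: "x \<in> carrier (ob P n)"
    then have "x = \<pi> n (free_gen k (n, x, epi_id n))"
      by (simp add: \<pi>(2) epi_mor_id contravariant_id[OF cP])
    moreover have "free_gen k (n, x, epi_id n) \<in> carrier (ob (free_cover k P) n)"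
      unfolding ob by (rule free_gen_closed[OF k]) (simp add: x cover_gens_def epi_mor_id)
    ultimately show "x \<in> \<pi> n ` carrier (ob (free_cover k P) n)" by (rule image_eqI)
  qed (use contra_nat_closed[OF \<pi>(1)] in auto)
  \<comment> \<open>The lifting property is applied to the cover and the identity of
    \<open>P\<close>, with element types as \<open>projective\<close> prescribes;
    \<open>\<sigma>\<close> splits the cover.\<close>
  then obtain \<sigma> where \<sigma>: "\<sigma> \<in> contra_nat k P (free_cover k P)"
    "\<And>n x. x \<in> carrier (ob P n) \<Longrightarrow> \<pi> n (\<sigma> n x) = x"
    using P[unfolded projective_def] cC cP contra_nat_id[of k P]
    by (metis (no_types, lifting))
  define v where "v n x = (SOME y. y \<in> carrier (ob E n) \<and> d n y = \<phi> n x)" for n x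
  have v: "v n x \<in> carrier (ob E n)" "d n (v n x) = \<phi> n x" if "x \<in> carrier (ob P n)" for n x
  proof -
    have "v n x \<in> carrier (ob E n) \<and> d n (v n x) = \<phi> n x"
      unfolding v_def by (rule someI_ex) (use sub[OF that] in force)
    then show "v n x \<in> carrier (ob E n)" "d n (v n x) = \<phi> n x" by auto
  qed
  obtain \<eta> where \<eta>: "\<eta> \<in> contra_nat k (free_cover k P) E"
    "\<And>l m x f. x \<in> carrier (ob P m) \<Longrightarrow> f \<in> epi_mor l m \<Longrightarrow> \<eta> l (free_gen k (m, x, f)) = arr E l m f (v m x)"
    using free_cover_nat[OF k E, of P v] v by blast
  \<comment> \<open>On generators this holds by the choice of \<open>v\<close>. Precomposing with
    the section \<open>\<sigma>\<close> removes \<open>\<pi>\<close> and yields the lift.\<close>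
  have "d n (\<eta> n c) = \<phi> n (\<pi> n c)" if "c \<in> carrier (ob (free_cover k P) n)" for n c
    by (rule free_cover_ext[OF k B contra_nat_comp[OF d \<eta>(1)] contra_nat_comp[OF \<phi> \<pi>(1)] _ that])
      (simp add: \<eta>(2) \<pi>(2) contra_nat_arr[OF d] contra_nat_arr[OF \<phi>] v)
  then have "d n (\<eta> n (\<sigma> n x)) = \<phi> n x" if "x \<in> carrier (ob P n)" for n x
    using that contra_nat_closed[OF \<sigma>(1)] \<sigma>(2) by simp
  then show ?thesis
    using that[OF contra_nat_comp[OF \<eta>(1) \<sigma>(1)]] by blast
qed

section \<open>Alternating sums\<close>

text \<open>The common shape of \<open>bar_diff\<close> and \<open>rep_diff\<close>, separated so
  that the sign manipulations take place once, in an arbitrary module.\<close>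

definition alt_sum :: "('k, 'z) ring_scheme \<Rightarrow> ('k, 'a) module \<Rightarrow> nat \<Rightarrow> (nat \<Rightarrow> 'a) \<Rightarrow> 'a" where
  "alt_sum k W n a = (\<Oplus>\<^bsub>W\<^esub>i \<in> {0..n}. ((\<ominus>\<^bsub>k\<^esub> \<one>\<^bsub>k\<^esub>) [^]\<^bsub>k\<^esub> i) \<odot>\<^bsub>W\<^esub> a i)"

lemma alt_sum_closed:
  assumes "module k W" "\<And>i. i \<le> n \<Longrightarrow> a i \<in> carrier W"
  shows "alt_sum k W n a \<in> carrier W"
proof -
  interpret W: module k W by fact
  show ?thesis unfolding alt_sum_def by (rule W.M.finsum_closed) (auto simp: assms(2))
qed

lemma alt_sum_cong:
  assumes "module k W" "\<And>i. i \<le> n \<Longrightarrow> a i = b i" "\<And>i. i \<le> n \<Longrightarrow> b i \<in> carrier W"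
  shows "alt_sum k W n a = alt_sum k W n b"
proof -
  interpret W: module k W by fact
  show ?thesis unfolding alt_sum_def by (rule W.M.finsum_cong') (auto simp: assms(2,3))
qed

lemma alt_sum_hom:
  assumes "module k W" "module k V" "h \<in> module_homs k W V" "\<And>i. i \<le> n \<Longrightarrow> a i \<in> carrier W"
  shows "h (alt_sum k W n a) = alt_sum k V n (\<lambda>i. h (a i))"
proof -
  interpret W: module k W by fact
  interpret V: module k V by fact
  have "h (alt_sum k W n a) = (\<Oplus>\<^bsub>V\<^esub>i \<in> {0..n}. h (((\<ominus>\<^bsub>k\<^esub> \<one>\<^bsub>k\<^esub>) [^]\<^bsub>k\<^esub> i) \<odot>\<^bsub>W\<^esub> a i))"
    unfolding alt_sum_def by (rule module_homs_finsum[OF assms(1-3)]) (auto simp: assms(4))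
  also have "\<dots> = alt_sum k V n (\<lambda>i. h (a i))"
    unfolding alt_sum_def
    by (rule V.M.finsum_cong')
      (auto simp: assms(4) module_homs_smult[OF assms(3)] module_homs_closed[OF assms(3)])
  finally show ?thesis .
qed

lemma alt_sum_hom_map:
  assumes "module k W" "\<And>i. i \<le> n \<Longrightarrow> h i \<in> module_homs k M W"
  shows "(\<lambda>x. alt_sum k W n (\<lambda>i. h i x)) \<in> module_homs k M W"
proof -
  interpret W: module k W by fact
  show ?thesis
    unfolding alt_sum_def
    by (intro module_homs_finsum_map module_homs_smult_map assms) auto
qed

lemma alt_sum_0:
  assumes "module k W" "a 0 \<in> carrier W"
  shows "alt_sum k W 0 a = a 0"
proof -
  interpret W: module k W by fact
  show ?thesis by (simp add: alt_sum_def assms(2))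
qed

lemma alt_sum_zero:
  assumes "module k W"
  shows "alt_sum k W n (\<lambda>i. \<zero>\<^bsub>W\<^esub>) = \<zero>\<^bsub>W\<^esub>"
proof -
  interpret W: module k W by fact
  show ?thesis unfolding alt_sum_def by (rule W.M.add.finprod_one_eqI) auto
qed

lemma alt_sum_uminus:
  assumes "module k W" "\<And>i. i \<le> n \<Longrightarrow> a i \<in> carrier W"
  shows "alt_sum k W n (\<lambda>i. \<ominus>\<^bsub>W\<^esub> a i) = \<ominus>\<^bsub>W\<^esub> alt_sum k W n a"
  using alt_sum_hom[OF assms(1,1) module_homs_uminus_map[OF assms(1) module_homs_id]] assms(2)
  by metis

lemma alt_sum_minus:
  assumes "module k W" "\<And>i. i \<le> n \<Longrightarrow> a i \<in> carrier W" "\<And>i. i \<le> n \<Longrightarrow> b i \<in> carrier W"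
  shows "alt_sum k W n (\<lambda>i. a i \<ominus>\<^bsub>W\<^esub> b i) = alt_sum k W n a \<ominus>\<^bsub>W\<^esub> alt_sum k W n b"
proof -
  interpret W: module k W by fact
  have "alt_sum k W n (\<lambda>i. a i \<ominus>\<^bsub>W\<^esub> b i) = (\<Oplus>\<^bsub>W\<^esub>i \<in> {0..n}.
      ((\<ominus>\<^bsub>k\<^esub> \<one>\<^bsub>k\<^esub>) [^]\<^bsub>k\<^esub> i) \<odot>\<^bsub>W\<^esub> a i \<oplus>\<^bsub>W\<^esub> ((\<ominus>\<^bsub>k\<^esub> \<one>\<^bsub>k\<^esub>) [^]\<^bsub>k\<^esub> i) \<odot>\<^bsub>W\<^esub> (\<ominus>\<^bsub>W\<^esub> b i))"
    unfolding alt_sum_def a_minus_def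
    by (rule W.M.finsum_cong') (auto simp: W.smult_r_distr assms(2,3))
  also have "\<dots> = alt_sum k W n a \<oplus>\<^bsub>W\<^esub> alt_sum k W n (\<lambda>i. \<ominus>\<^bsub>W\<^esub> b i)"
    unfolding alt_sum_def by (rule W.M.finsum_addf) (auto simp: assms(2,3))
  finally show ?thesis by (simp add: alt_sum_uminus[OF assms(1,3)] a_minus_def)
qed

text \<open>Shifting the index by one flips every sign. This form without explicit powers is what
  the square of the differential and the cone contraction use.\<close>

lemma alt_sum_Suc:
  assumes "module k W" "\<And>i. i \<le> Suc n \<Longrightarrow> a i \<in> carrier W"
  shows "alt_sum k W (Suc n) a = a 0 \<ominus>\<^bsub>W\<^esub> alt_sum k W n (\<lambda>i. a (Suc i))"
proof -
  interpret W: module k W by fact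
  let ?s = "\<lambda>i. (\<ominus>\<^bsub>k\<^esub> \<one>\<^bsub>k\<^esub>) [^]\<^bsub>k\<^esub> (i :: nat)"
  have "alt_sum k W (Suc n) a = (\<Oplus>\<^bsub>W\<^esub>i \<in> {..n}. ?s (Suc i) \<odot>\<^bsub>W\<^esub> a (Suc i)) \<oplus>\<^bsub>W\<^esub> ?s 0 \<odot>\<^bsub>W\<^esub> a 0"
    unfolding alt_sum_def atLeast0AtMost by (rule W.M.finsum_Suc2) (auto simp: assms(2))
  also have "(\<Oplus>\<^bsub>W\<^esub>i \<in> {..n}. ?s (Suc i) \<odot>\<^bsub>W\<^esub> a (Suc i)) = alt_sum k W n (\<lambda>i. \<ominus>\<^bsub>W\<^esub> a (Suc i))"
    unfolding alt_sum_def atLeast0AtMost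
    by (rule W.M.finsum_cong')
      (auto simp: assms(2) W.R.r_minus W.smult_l_minus W.smult_r_minus)
  also have "\<dots> = \<ominus>\<^bsub>W\<^esub> alt_sum k W n (\<lambda>i. a (Suc i))"
    by (rule alt_sum_uminus[OF assms(1)]) (simp add: assms(2))
  finally show ?thesis
    using alt_sum_closed[OF assms(1), of n "\<lambda>i. a (Suc i)"] assms(2)
    by (simp add: W.M.a_comm a_minus_def)
qed

text \<open>The usual pairwise cancellation in a double sum, done by induction: peel off column 0
  and then row 0. They cancel by the symmetry \<open>a 0 (Suc j) = a j 0\<close>, and the remaining
  array, with both indices shifted, satisfies the hypotheses for the smaller size.\<close>

lemma alt_sum_alt_sum:
  assumes W: "module k W"
    and "\<And>i j. i \<le> n \<Longrightarrow> j \<le> Suc n \<Longrightarrow> a i j \<in> carrier W"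
    and "\<And>i j. i < j \<Longrightarrow> j \<le> Suc n \<Longrightarrow> a i j = a (j - 1) i"
  shows "alt_sum k W n (\<lambda>i. alt_sum k W (Suc n) (a i)) = \<zero>\<^bsub>W\<^esub>"
  using assms(2,3)
proof (induction n arbitrary: a)
  case 0
  interpret W: module k W by fact
  have "alt_sum k W 0 (\<lambda>i. alt_sum k W (Suc 0) (a i)) = a 0 0 \<ominus>\<^bsub>W\<^esub> a 0 1"
    using 0(1) by (simp add: alt_sum_0[OF W] alt_sum_Suc[OF W])
  also have "a 0 1 = a 0 0" using 0(2)[of 0 1] by simp
  finally show ?case using 0(1)[of 0 0] by (simp add: W.M.right_minus_eq)
next
  case (Suc n)
  interpret W: module k W by fact
  note cl = alt_sum_closed[OF W]
  let ?N = "Suc n"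
  have IH: "alt_sum k W n (\<lambda>i. alt_sum k W ?N (\<lambda>j. a (Suc i) (Suc j))) = \<zero>\<^bsub>W\<^esub>"
  proof (rule Suc.IH)
    fix i j assume "i < j" "j \<le> Suc n"
    then show "a (Suc i) (Suc j) = a (Suc (j - 1)) (Suc i)" using Suc.prems(2)[of "Suc i" "Suc j"] by simp
  qed (simp add: Suc.prems(1))
  have "alt_sum k W ?N (\<lambda>i. alt_sum k W (Suc ?N) (a i)) =
      alt_sum k W ?N (\<lambda>i. a i 0 \<ominus>\<^bsub>W\<^esub> alt_sum k W ?N (\<lambda>j. a i (Suc j)))"
    by (rule alt_sum_cong[OF W]) (simp_all add: alt_sum_Suc[OF W] Suc.prems(1) cl)
  also have "\<dots> = alt_sum k W ?N (\<lambda>i. a i 0) \<ominus>\<^bsub>W\<^esub> alt_sum k W ?N (\<lambda>i. alt_sum k W ?N (\<lambda>j. a i (Suc j)))"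
    by (rule alt_sum_minus[OF W]) (simp_all add: Suc.prems(1) cl)
  also have "alt_sum k W ?N (\<lambda>i. alt_sum k W ?N (\<lambda>j. a i (Suc j))) =
      alt_sum k W ?N (\<lambda>j. a 0 (Suc j)) \<ominus>\<^bsub>W\<^esub> alt_sum k W n (\<lambda>i. alt_sum k W ?N (\<lambda>j. a (Suc i) (Suc j)))"
    by (rule alt_sum_Suc[OF W]) (simp add: Suc.prems(1) cl)
  also have "alt_sum k W ?N (\<lambda>j. a 0 (Suc j)) = alt_sum k W ?N (\<lambda>j. a j 0)"
    by (rule alt_sum_cong[OF W]) (use Suc.prems(2)[of 0 "Suc _"] in \<open>simp_all add: Suc.prems(1)\<close>)
  finally show ?case
    using cl[of ?N "\<lambda>j. a j 0"] Suc.prems(1)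
    by (simp add: IH a_minus_def W.M.a_inv_zero W.M.r_neg)
qed

section \<open>The resolution of \<open>b\<^sup>e\<^sup>p\<^sup>i\<close> by representable functors\<close>

lemma representable_free_functor:
  "representable k n = free_functor k (\<lambda>l. epi_mor l n) (\<lambda>l m f g. compose {0..l} g f)"
  by (simp add: representable_def free_functor_def)

lemma ob_representable: "ob (representable k n) l = free_module k (epi_mor l n)"
  by (simp add: representable_def)

text \<open>The transformation out of the representable of degree \<open>n\<close> that takes the
  identity of \<open>[n]\<close> to \<open>x\<close>.\<close>

definition yoneda ::
    "('k, 'z) ring_scheme \<Rightarrow> ('k, 'a) epi_functor \<Rightarrow> nat \<Rightarrow> 'a \<Rightarrow> nat \<Rightarrow> ((nat \<Rightarrow> nat) \<Rightarrow> 'k) \<Rightarrow> 'a" where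
  "yoneda k N n x l = free_lift k (ob N l) (\<lambda>f. arr N l n f x)"

definition rep_diff ::
    "('k, 'z) ring_scheme \<Rightarrow> nat \<Rightarrow> nat \<Rightarrow> ((nat \<Rightarrow> nat) \<Rightarrow> 'k) \<Rightarrow> (nat \<Rightarrow> nat) \<Rightarrow> 'k" where
  "rep_diff k n l c = alt_sum k (ob (representable k n) l) n
     (\<lambda>i. representable_map k (Suc n) (face (Suc n) i) l c)"

context
  fixes k :: "('k, 'z) ring_scheme"
  assumes k: "cring k"
begin

lemma representable_contravariant: "contravariant k (representable k n)"
  unfolding representable_free_functor
  by (rule free_functor_contravariant[OF k])
    (simp_all add: epi_mor_compose epi_mor_compose_id epi_mor_assoc)

lemma representable_module: "module k (ob (representable k n) l)"
  by (rule contravariant_module[OF representable_contravariant])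

lemma representable_gen: "f \<in> epi_mor l n \<Longrightarrow> free_gen k f \<in> carrier (ob (representable k n) l)"
  unfolding ob_representable by (rule free_gen_closed[OF k])

lemma representable_arr_gen:
  "f \<in> epi_mor l m \<Longrightarrow> g \<in> epi_mor m n \<Longrightarrow>
    arr (representable k n) l m f (free_gen k g) = free_gen k (compose {0..l} g f)"
  unfolding representable_def epi_functor.simps
  by (rule free_map_gen[OF k, of _ _ "epi_mor l n"]) (simp_all add: epi_mor_compose)

lemma representable_hom_ext:
  assumes "module k N" "g \<in> module_homs k (ob (representable k n) l) N"
    "h \<in> module_homs k (ob (representable k n) l) N"
    "\<And>f. f \<in> epi_mor l n \<Longrightarrow> g (free_gen k f) = h (free_gen k f)"
    "c \<in> carrier (ob (representable k n) l)"
  shows "g c = h c"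
  using free_hom_ext[OF k assms(1)] assms(2-5) unfolding ob_representable by blast

lemma representable_empty:
  assumes "l < n" "c \<in> carrier (ob (representable k n) l)"
  shows "c = \<zero>\<^bsub>ob (representable k n) l\<^esub>"
  using assms by (auto simp: ob_representable free_carrier_iff free_zero epi_mor_empty)

lemma representable_map_gen:
  "f \<in> epi_mor l m \<Longrightarrow> g \<in> epi_mor m n \<Longrightarrow>
    representable_map k m g l (free_gen k f) = free_gen k (compose {0..l} g f)"
  unfolding representable_map_def
  by (rule free_map_gen[OF k, of _ _ "epi_mor l n"]) (simp_all add: epi_mor_compose)

lemma representable_map_nat:
  assumes g: "g \<in> epi_mor m n"
  shows "representable_map k m g \<in> contra_nat k (representable k m) (representable k n)"
  unfolding representable_free_functor[of k m]
proof (rule free_functor_nat[OF k representable_contravariant])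
  show "representable_map k m g l \<in> module_homs k (free_module k (epi_mor l m)) (ob (representable k n) l)" for l
    unfolding representable_map_def ob_representable
    by (rule free_map_hom[OF k epi_mor_compose[OF _ g]])
qed (simp_all add: epi_mor_compose[OF _ g] epi_mor_compose representable_map_gen[OF _ g]
      representable_arr_gen epi_mor_assoc)

lemma yoneda:
  assumes N: "contravariant k N" and x: "x \<in> carrier (ob N n)"
  shows yoneda_nat: "yoneda k N n x \<in> contra_nat k (representable k n) N"
    and yoneda_gen: "f \<in> epi_mor l n \<Longrightarrow> yoneda k N n x l (free_gen k f) = arr N l n f x"
proof -
  note cl = module_homs_closed[OF contravariant_arr[OF N]]
  show gen: "yoneda k N n x l (free_gen k f) = arr N l n f x" if "f \<in> epi_mor l n" for f l
    unfolding yoneda_def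
    by (rule free_lift_gen[of k "ob N l" "\<lambda>f. arr N l n f x", OF k contravariant_module[OF N] cl[OF that x]])
  show "yoneda k N n x \<in> contra_nat k (representable k n) N"
    unfolding representable_free_functor
  proof (rule free_functor_nat[OF k N])
    show "yoneda k N n x l \<in> module_homs k (free_module k (epi_mor l n)) (ob N l)" for l
      unfolding yoneda_def
      by (rule free_lift_hom[OF k contravariant_module[OF N]]) (auto intro: cl[OF _ x])
  qed (simp_all add: gen epi_mor_compose contravariant_comp[OF N] x)
qed

text \<open>A basis element \<open>f\<close> is the image of the identity of \<open>[n]\<close>
  under the structure map of \<open>f\<close>, so naturality propagates the agreement.\<close>

lemma yoneda_ext:
  assumes N: "contravariant k N" and \<eta>: "\<eta> \<in> contra_nat k (representable k n) N"
    and \<theta>: "\<theta> \<in> contra_nat k (representable k n) N"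
    and eq: "\<eta> n (free_gen k (epi_id n)) = \<theta> n (free_gen k (epi_id n))"
    and c: "c \<in> carrier (ob (representable k n) l)"
  shows "\<eta> l c = \<theta> l c"
proof (rule representable_hom_ext[OF contravariant_module[OF N] contra_nat_hom[OF \<eta>] contra_nat_hom[OF \<theta>] _ c])
  fix f assume f: "f \<in> epi_mor l n"
  have "free_gen k f = arr (representable k n) l n f (free_gen k (epi_id n))"
    by (simp add: representable_arr_gen[OF f epi_mor_id] epi_mor_id_compose[OF f])
  then show "\<eta> l (free_gen k f) = \<theta> l (free_gen k f)"
    using contra_nat_arr[OF \<eta> f representable_gen[OF epi_mor_id]]
      contra_nat_arr[OF \<theta> f representable_gen[OF epi_mor_id]] eq by simp
qed

lemma representable_map_closed:
  "g \<in> epi_mor m n \<Longrightarrow> c \<in> carrier (ob (representable k m) l) \<Longrightarrow>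
    representable_map k m g l c \<in> carrier (ob (representable k n) l)"
  by (rule contra_nat_closed[OF representable_map_nat])

lemma rep_diff_nat: "rep_diff k n \<in> contra_nat k (representable k (Suc n)) (representable k n)"
proof (rule contra_natI)
  show "rep_diff k n l \<in> module_homs k (ob (representable k (Suc n)) l) (ob (representable k n) l)" for l
    unfolding rep_diff_def
    by (rule alt_sum_hom_map[OF representable_module contra_nat_hom[OF representable_map_nat[OF face_epi]]])
  fix l m f c assume f: "f \<in> epi_mor l m" and c: "c \<in> carrier (ob (representable k (Suc n)) m)"
  have "arr (representable k n) l m f (rep_diff k n m c) = alt_sum k (ob (representable k n) l) n
      (\<lambda>i. arr (representable k n) l m f (representable_map k (Suc n) (face (Suc n) i) m c))"
    unfolding rep_diff_def
    by (rule alt_sum_hom[OF representable_module representable_module contravariant_arr[OF representable_contravariant f]])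
      (simp add: representable_map_closed face_epi c)
  also have "\<dots> = rep_diff k n l (arr (representable k (Suc n)) l m f c)"
    unfolding rep_diff_def
    by (rule alt_sum_cong[OF representable_module])
      (simp_all add: contra_nat_arr[OF representable_map_nat[OF face_epi] f c] representable_map_closed
        face_epi c module_homs_closed[OF contravariant_arr[OF representable_contravariant f]])
  finally show "rep_diff k n l (arr (representable k (Suc n)) l m f c) =
      arr (representable k n) l m f (rep_diff k n m c)" ..
qed

lemma rep_diff_gen:
  assumes f: "f \<in> epi_mor l (Suc n)"
  shows "rep_diff k n l (free_gen k f) =
    alt_sum k (ob (representable k n) l) n (\<lambda>i. free_gen k (compose {0..l} (face (Suc n) i) f))"
  unfolding rep_diff_def
  by (rule alt_sum_cong[OF representable_module])
    (simp_all add: representable_map_gen[OF f face_epi] representable_gen epi_mor_compose[OF f face_epi])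

text \<open>In the lowest degree the alternating sum has one term, the map whose cokernel defines
  \<open>b_epi\<close>.\<close>

lemma rep_diff_0:
  assumes "c \<in> carrier (ob (representable k 1) l)"
  shows "rep_diff k 0 l c = representable_map k 1 (face 1 0) l c"
  using alt_sum_0[OF representable_module[of 0 l], of "\<lambda>i. representable_map k (Suc 0) (face (Suc 0) i) l c"]
    representable_map_closed[OF face_epi[of 0 0]] assms
  by (simp add: rep_diff_def)

text \<open>On a basis element \<open>f\<close> this is the double alternating sum obtained by
  composing \<open>f\<close> with two faces, and \<open>face_face\<close> supplies the symmetry that
  \<open>alt_sum_alt_sum\<close> asks for.\<close>

lemma rep_diff_rep_diff:
  assumes c: "c \<in> carrier (ob (representable k (Suc (Suc n))) l)"
  shows "rep_diff k n l (rep_diff k (Suc n) l c) = \<zero>\<^bsub>ob (representable k n) l\<^esub>"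
proof (rule representable_hom_ext[OF representable_module _ _ _ c])
  show "(\<lambda>c. rep_diff k n l (rep_diff k (Suc n) l c)) \<in>
      module_homs k (ob (representable k (Suc (Suc n))) l) (ob (representable k n) l)"
    by (rule module_homs_comp[OF contra_nat_hom[OF rep_diff_nat] contra_nat_hom[OF rep_diff_nat]])
  show "(\<lambda>c. \<zero>\<^bsub>ob (representable k n) l\<^esub>) \<in>
      module_homs k (ob (representable k (Suc (Suc n))) l) (ob (representable k n) l)"
    by (rule module_homs_zero_map[OF representable_module])
  fix f assume f: "f \<in> epi_mor l (Suc (Suc n))"
  let ?R = "ob (representable k n) l" and ?d = "face (Suc n)" and ?d' = "face (Suc (Suc n))"
  have f': "compose {0..l} (?d' j) f \<in> epi_mor l (Suc n)" if "j \<le> Suc n" for j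
    using epi_mor_compose[OF f face_epi[OF that]] .
  have f'': "compose {0..l} (?d i) (compose {0..l} (?d' j) f) \<in> epi_mor l n" if "i \<le> n" "j \<le> Suc n" for i j
    using epi_mor_compose[OF f'[OF that(2)] face_epi[OF that(1)]] .
  let ?a = "\<lambda>i j. free_gen k (compose {0..l} (?d i) (compose {0..l} (?d' j) f))"
  have "rep_diff k n l (rep_diff k (Suc n) l (free_gen k f)) =
      alt_sum k ?R n (\<lambda>i. representable_map k (Suc n) (?d i) l (rep_diff k (Suc n) l (free_gen k f)))"
    by (simp add: rep_diff_def[of k n])
  also have "\<dots> = alt_sum k ?R n (\<lambda>i. alt_sum k ?R (Suc n) (?a i))"
  proof (rule alt_sum_cong[OF representable_module])
    fix i assume i: "i \<le> n"
    have "representable_map k (Suc n) (?d i) l (rep_diff k (Suc n) l (free_gen k f)) =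
        alt_sum k ?R (Suc n) (\<lambda>j. representable_map k (Suc n) (?d i) l (free_gen k (compose {0..l} (?d' j) f)))"
      unfolding rep_diff_gen[OF f]
      by (rule alt_sum_hom[OF representable_module representable_module
            contra_nat_hom[OF representable_map_nat[OF face_epi[OF i]]]]) (simp add: representable_gen f')
    also have "\<dots> = alt_sum k ?R (Suc n) (?a i)"
      by (rule alt_sum_cong[OF representable_module])
        (simp_all add: representable_map_gen[OF f' face_epi[OF i]] representable_gen f'' i)
    finally show "representable_map k (Suc n) (?d i) l (rep_diff k (Suc n) l (free_gen k f)) =
      alt_sum k ?R (Suc n) (?a i)" .
  qed (simp add: alt_sum_closed[OF representable_module] representable_gen f'')
  also have "\<dots> = \<zero>\<^bsub>?R\<^esub>"
    by (rule alt_sum_alt_sum[OF representable_module])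
      (simp add: representable_gen f'', simp add: epi_mor_assoc[OF f] face_face)
  finally show "rep_diff k n l (rep_diff k (Suc n) l (free_gen k f)) = \<zero>\<^bsub>?R\<^esub>" .
qed

end

text \<open>A surjection \<open>[l] \<rightarrow> [n]\<close> is determined by the \<open>n\<close>-element set of its jumps \<open>{j. f (j + 1) = f j + 1}\<close>,
  and composition with \<open>d\<^sub>i\<close> removes the \<open>i\<close>-th jump. So for \<open>l > 0\<close> the complex \<open>n \<mapsto> k[epi_mor l n]\<close>
  is the augmented chain complex of a full simplex; \<open>add_jump\<close> is the cone on the vertex \<open>0\<close>.\<close>

definition add_jump :: "nat \<Rightarrow> (nat \<Rightarrow> nat) \<Rightarrow> nat \<Rightarrow> nat" where
  "add_jump l f = (\<lambda>j\<in>{0..l}. if j = 0 then 0 else Suc (f j))"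

text \<open>\<open>f 1 = 0\<close> says that \<open>0\<close> is not yet a jump. After all values
  from position \<open>1\<close> on are raised, the value \<open>1\<close> is then attained at
  position \<open>1\<close>; otherwise it would be skipped.\<close>

lemma add_jump_epi:
  assumes f: "f \<in> epi_mor l n" and "f 1 = 0" "0 < l"
  shows "add_jump l f \<in> epi_mor l (Suc n)"
proof (rule epi_morI)
  fix i assume i: "i \<le> Suc n"
  show "\<exists>j\<le>l. add_jump l f j = i"
  proof (cases i)
    case 0
    then show ?thesis by (auto simp: add_jump_def)
  next
    case (Suc i')
    then obtain j where j: "j \<le> l" "f j = i'" using epi_mor_surj[OF f, of i'] i by auto
    \<comment> \<open>Position \<open>0\<close> keeps the value \<open>0\<close>, so if it is the
      preimage found, position \<open>1\<close> replaces it, where \<open>f\<close> is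
      \<open>0\<close> as well.\<close>
    then have "add_jump l f (if j = 0 then 1 else j) = i"
      using Suc assms epi_mor_0[OF f] by (auto simp: add_jump_def)
    then show ?thesis using j assms(3) by (metis Suc_leI One_nat_def)
  qed
qed (auto simp: add_jump_def epi_mor_le[OF f] epi_mor_mono[OF f])

lemma face_0_add_jump: "f \<in> epi_mor l n \<Longrightarrow> compose {0..l} (face (Suc n) 0) (add_jump l f) = f"
  using epi_mor_0[of f l n] epi_mor_le[of f l n]
  by (intro extensionalityI[of _ "{0..l}"]) (auto simp: compose_def face_def add_jump_def epi_mor_def)

text \<open>The new jump comes first, so the old jump number \<open>i\<close> becomes number
  \<open>Suc i\<close>; removing it commutes with adding the vertex.\<close>

lemma face_Suc_add_jump:
  "f \<in> epi_mor l (Suc n) \<Longrightarrow> i \<le> n \<Longrightarrow> compose {0..l} (face (Suc (Suc n)) (Suc i)) (add_jump l f) =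
    add_jump l (compose {0..l} (face (Suc n) i) f)"
  using epi_mor_le[of f l "Suc n"]
  by (intro extensionalityI[of _ "{0..l}"]) (auto simp: compose_def face_def add_jump_def)

text \<open>A nonzero \<open>f 1\<close> means that \<open>0\<close> is a jump, necessarily the
  first; it is removed and put back.\<close>

lemma add_jump_face_0:
  assumes f: "f \<in> epi_mor l (Suc n)" and "f 1 \<noteq> 0"
  shows "add_jump l (compose {0..l} (face (Suc n) 0) f) = f"
proof (rule extensionalityI[of _ "{0..l}"])
  fix j assume j: "j \<in> {0..l}"
  have "f j \<noteq> 0" if "j \<noteq> 0" using that epi_mor_mono[OF f, of 1 j] j assms(2) by auto
  then show "add_jump l (compose {0..l} (face (Suc n) 0) f) j = f j"
    using j epi_mor_0[OF f] epi_mor_le[OF f, of j]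
    by (cases "j = 0") (auto simp: add_jump_def compose_def face_def)
qed (use f in \<open>auto simp: add_jump_def epi_mor_def\<close>)

text \<open>The cone with vertex \<open>0\<close> is a contracting homotopy:
  \<open>d h + h d = id\<close>, so a cycle \<open>c\<close> equals \<open>d (h c)\<close>. It needs
  a position \<open>1\<close>, hence \<open>0 < l\<close>; at \<open>[0]\<close> the positive
  degrees are zero.\<close>

lemma rep_exact:
  assumes k: "cring k" and c: "c \<in> carrier (ob (representable k (Suc n)) l)"
    and z: "rep_diff k n l c = \<zero>\<^bsub>ob (representable k n) l\<^esub>"
  shows "c \<in> rep_diff k (Suc n) l ` carrier (ob (representable k (Suc (Suc n))) l)"
proof (cases "l = 0")
  case True
  let ?R = "\<lambda>n. ob (representable k n) l"
  note R = representable_module[OF k, of _ l]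
  have "c = rep_diff k (Suc n) l \<zero>\<^bsub>?R (Suc (Suc n))\<^esub>"
    using representable_empty[OF k _ c] True
      module_homs_zero[OF R R contra_nat_hom[OF rep_diff_nat[OF k]]] by simp
  then show ?thesis using abelian_groupE(2)[OF module.axioms(2)[OF R]] by (rule image_eqI)
next
  case False
  let ?R = "\<lambda>n. ob (representable k n) l"
  note R = representable_module[OF k, of _ l]
  note d = contra_nat_hom[OF rep_diff_nat[OF k], of _ l]
  interpret R: module k "?R (Suc n)" by (rule R)
  \<comment> \<open>If \<open>0\<close> is already a jump, adding the vertex gives a degenerate
    simplex, which counts as zero.\<close>
  define cone where
    "cone m = (\<lambda>f. if f 1 = 0 then free_gen k (add_jump l f) else \<zero>\<^bsub>?R (Suc m)\<^esub>)" for m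
  define h where "h m = free_lift k (?R (Suc m)) (cone m)" for m
  have cone: "cone m f \<in> carrier (?R (Suc m))" if "f \<in> epi_mor l m" for m f
    using that False abelian_groupE(2)[OF module.axioms(2)[OF R]]
    by (auto simp: cone_def intro!: representable_gen[OF k] add_jump_epi)
  have h: "h m \<in> module_homs k (?R m) (?R (Suc m))" for m
    unfolding h_def ob_representable[of k m] by (rule free_lift_hom[OF k R]) (auto intro: cone)
  have h_gen: "h m (free_gen k f) = cone m f" if "f \<in> epi_mor l m" for m f
    unfolding h_def by (rule free_lift_gen[of k _ "cone m", OF k R cone[OF that]])
  have "rep_diff k (Suc n) l (h (Suc n) c) = c \<ominus>\<^bsub>?R (Suc n)\<^esub> h n (rep_diff k n l c)"
  proof (rule representable_hom_ext[OF k R module_homs_comp[OF d h]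
        module_homs_minus_map[OF R module_homs_id module_homs_comp[OF h d]] _ c])
    fix f assume f: "f \<in> epi_mor l (Suc n)"
    have f': "compose {0..l} (face (Suc n) i) f \<in> epi_mor l n" if "i \<le> n" for i
      by (rule epi_mor_compose[OF f face_epi[OF that]])
    have f1: "compose {0..l} (face (Suc n) i) f 1 = face (Suc n) i (f 1)" for i
      using False by (simp add: compose_def)
    have "h n (rep_diff k n l (free_gen k f)) =
        alt_sum k (?R (Suc n)) n (\<lambda>i. h n (free_gen k (compose {0..l} (face (Suc n) i) f)))"
      unfolding rep_diff_gen[OF k f]
      by (rule alt_sum_hom[OF R R h representable_gen[OF k f']])
    also have "\<dots> = alt_sum k (?R (Suc n)) n (\<lambda>i. cone n (compose {0..l} (face (Suc n) i) f))"
      by (rule alt_sum_cong[OF R]) (simp_all add: h_gen f' cone)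
    finally have hd: "h n (rep_diff k n l (free_gen k f)) =
        alt_sum k (?R (Suc n)) n (\<lambda>i. cone n (compose {0..l} (face (Suc n) i) f))" .
    show "rep_diff k (Suc n) l (h (Suc n) (free_gen k f)) =
        free_gen k f \<ominus>\<^bsub>?R (Suc n)\<^esub> h n (rep_diff k n l (free_gen k f))"
    proof (cases "f 1 = 0")
      case True
      have F: "add_jump l f \<in> epi_mor l (Suc (Suc n))"
        by (rule add_jump_epi[OF f True]) (use False in simp)
      have "rep_diff k (Suc n) l (h (Suc n) (free_gen k f)) = alt_sum k (?R (Suc n)) (Suc n)
          (\<lambda>i. free_gen k (compose {0..l} (face (Suc (Suc n)) i) (add_jump l f)))"
        unfolding h_gen[OF f] using True by (simp add: cone_def rep_diff_gen[OF k F])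
      also have "\<dots> = free_gen k f \<ominus>\<^bsub>?R (Suc n)\<^esub> alt_sum k (?R (Suc n)) n
          (\<lambda>i. free_gen k (compose {0..l} (face (Suc (Suc n)) (Suc i)) (add_jump l f)))"
        by (subst alt_sum_Suc[OF R])
          (simp_all add: face_0_add_jump[OF f] representable_gen[OF k] epi_mor_compose[OF F face_epi])
      also have "alt_sum k (?R (Suc n)) n
          (\<lambda>i. free_gen k (compose {0..l} (face (Suc (Suc n)) (Suc i)) (add_jump l f))) =
          alt_sum k (?R (Suc n)) n (\<lambda>i. cone n (compose {0..l} (face (Suc n) i) f))"
        proof (rule alt_sum_cong[OF R])
          fix i assume i: "i \<le> n"
          show "cone n (compose {0..l} (face (Suc n) i) f) \<in> carrier (?R (Suc n))" by (rule cone[OF f'[OF i]])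
          \<comment> \<open>Removing a jump does not create one at \<open>0\<close>, so the cone
            over every face is again given by \<open>add_jump\<close>.\<close>
          have "compose {0..l} (face (Suc n) i) f 1 = 0" unfolding f1 True by (simp add: face_def)
          then show "free_gen k (compose {0..l} (face (Suc (Suc n)) (Suc i)) (add_jump l f)) =
              cone n (compose {0..l} (face (Suc n) i) f)"
            by (simp add: face_Suc_add_jump[OF f i] cone_def)
        qed
      finally show ?thesis by (simp add: hd)
    next
      case f_1: False
      \<comment> \<open>A surjection that is nonzero at \<open>1\<close> takes the value
        \<open>1\<close> there, since monotonicity forbids skipping it.\<close>
      obtain j where j: "j \<le> l" "f j = 1" using epi_mor_surj[OF f, of 1] by auto
      then have "j \<noteq> 0" using epi_mor_0[OF f] by (cases "j = 0") auto
      then have f_eq: "f 1 = 1" using epi_mor_mono[OF f, of 1 j] j f_1 by simp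
      \<comment> \<open>Of all faces only the first destroys the jump at \<open>0\<close>. The cone
        restores \<open>f\<close> from it and vanishes on the others, so \<open>h d\<close> fixes
        \<open>f\<close> while \<open>h\<close> sends \<open>f\<close> to zero.\<close>
      have zero_case: "cone n (compose {0..l} (face (Suc n) 0) f) = free_gen k f"
        unfolding cone_def f1 f_eq using add_jump_face_0[OF f f_1] by (simp add: face_def)
      have i: "cone n (compose {0..l} (face (Suc n) (Suc i)) f) = \<zero>\<^bsub>?R (Suc n)\<^esub>" for i
        unfolding cone_def f1 f_eq by (simp add: face_def)
      have "alt_sum k (?R (Suc n)) n (\<lambda>i. cone n (compose {0..l} (face (Suc n) i) f)) = free_gen k f"
      proof (cases n)
        case 0
        then show ?thesis using alt_sum_0[OF R] zero_case representable_gen[OF k f] by simp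
      next
        case (Suc m)
        have "alt_sum k (?R (Suc n)) (Suc m) (\<lambda>i. cone n (compose {0..l} (face (Suc n) i) f)) =
            free_gen k f \<ominus>\<^bsub>?R (Suc n)\<^esub> alt_sum k (?R (Suc n)) m (\<lambda>i. \<zero>\<^bsub>?R (Suc n)\<^esub>)"
          using alt_sum_Suc[OF R, of m "\<lambda>i. cone n (compose {0..l} (face (Suc n) i) f)" "Suc n"]
            cone[OF f'] Suc by (simp add: zero_case[unfolded Suc] i[unfolded Suc])
        also have "\<dots> = free_gen k f"
          by (simp only: alt_sum_zero[OF R] a_minus_def R.M.a_inv_zero R.M.r_zero[OF representable_gen[OF k f]])
        finally show ?thesis by (simp only: Suc)
      qed
      then have "h n (rep_diff k n l (free_gen k f)) = free_gen k f" using hd by metis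
      moreover have "h (Suc n) (free_gen k f) = \<zero>\<^bsub>?R (Suc (Suc n))\<^esub>"
        using f_1 h_gen[OF f] by (simp add: cone_def)
      ultimately show ?thesis
        using representable_gen[OF k f] module_homs_zero[OF R R d] R.M.right_minus_eq by metis
    qed
  qed
  then have "c = rep_diff k (Suc n) l (h (Suc n) c)"
    using c by (simp add: z module_homs_zero[OF R R h] a_minus_def R.M.a_inv_zero)
  then show ?thesis using module_homs_closed[OF h c] by (rule image_eqI)
qed

text \<open>Naturality of \<open>\<eta>\<close> makes the images stable under the structure maps of
  \<open>N\<close>, so these descend to cosets; the functor laws are then read off on
  representatives through the projection \<open>\<rho>\<close>.\<close>

lemma cokernel:
  fixes M :: "('k, 'a) epi_functor" and N :: "('k, 'b) epi_functor"
  assumes M: "contravariant k M" and N: "contravariant k N" and \<eta>: "\<eta> \<in> contra_nat k M N"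
  defines "\<rho> \<equiv> (\<lambda>l x. (\<eta> l ` carrier (ob M l)) +>\<^bsub>ob N l\<^esub> x)"
  shows cokernel_contravariant: "contravariant k (cokernel M N \<eta>)"
    and cokernel_proj: "\<rho> \<in> contra_epi k N (cokernel M N \<eta>)"
    and cokernel_proj_zero: "x \<in> carrier (ob N l) \<Longrightarrow>
      \<rho> l x = \<zero>\<^bsub>ob (cokernel M N \<eta>) l\<^esub> \<longleftrightarrow> x \<in> \<eta> l ` carrier (ob M l)"
proof -
  let ?I = "\<lambda>l. \<eta> l ` carrier (ob M l)"
  note mN = contravariant_module[OF N]
  have I: "submodule (?I l) k (ob N l)" for l
    by (rule submodule_image[OF contravariant_module[OF M] mN contra_nat_hom[OF \<eta>]])
  have ob: "ob (cokernel M N \<eta>) l = quotient_module (ob N l) (?I l)" for l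
    by (simp add: cokernel_def)
  have Q: "module k (ob (cokernel M N \<eta>) l)" for l
    unfolding ob by (rule quotient_is_module[OF mN I])
  have sub: "arr N l m f x \<in> ?I l" if "f \<in> epi_mor l m" "x \<in> ?I m" for l m f x
    using that contra_nat_arr[OF \<eta> that(1)] module_homs_closed[OF contravariant_arr[OF M that(1)]]
    by (auto intro!: rev_image_eqI)
  have arr: "arr (cokernel M N \<eta>) l m f (\<rho> m x) = \<rho> l (arr N l m f x)"
    if "f \<in> epi_mor l m" "x \<in> carrier (ob N m)" for l m f x
    unfolding \<rho>_def cokernel_def
    using quotient_map_coset[OF mN mN I I contravariant_arr[OF N that(1)] sub[OF that(1)] that(2)] by simp
  have \<rho>: "\<rho> l \<in> module_homs k (ob N l) (ob (cokernel M N \<eta>) l)" for l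
    unfolding \<rho>_def ob by (rule quotient_proj[OF mN I])
  have surj: "carrier (ob (cokernel M N \<eta>) l) = \<rho> l ` carrier (ob N l)" for l
    unfolding \<rho>_def ob by (rule carrier_quotient[OF mN])
  note cl = module_homs_closed[OF contravariant_arr[OF N]]
  have hom: "arr (cokernel M N \<eta>) l m f \<in> module_homs k (ob (cokernel M N \<eta>) m) (ob (cokernel M N \<eta>) l)"
    if f: "f \<in> epi_mor l m" for l m f
  proof -
    obtain h where h: "h \<in> module_homs k (ob (cokernel M N \<eta>) m) (ob (cokernel M N \<eta>) l)"
      "\<And>x. x \<in> carrier (ob N m) \<Longrightarrow> h (\<rho> m x) = \<rho> l (arr N l m f x)"
    proof (rule quotient_lift[OF mN I Q module_homs_comp[OF \<rho> contravariant_arr[OF N f]]])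
      show "\<rho> l (arr N l m f x) = \<zero>\<^bsub>ob (cokernel M N \<eta>) l\<^esub>" if "x \<in> ?I m" for x
        using coset_eq_zero_iff[OF mN I cl[OF f]] sub[OF f that] that
          contra_nat_closed[OF \<eta>] by (auto simp: \<rho>_def ob quotient_zero[OF mN])
    qed (auto simp: ob \<rho>_def)
    show ?thesis
      by (rule module_homs_cong[OF Q h(1)]) (auto simp: surj arr[OF f] h(2))
  qed
  show "contravariant k (cokernel M N \<eta>)"
    unfolding contravariant_def
    by (auto simp: Q hom surj arr epi_mor_id cl epi_mor_compose contravariant_id[OF N] contravariant_comp[OF N])
  show "\<rho> \<in> contra_epi k N (cokernel M N \<eta>)"
    unfolding contra_epi_def using \<rho> surj arr by (auto intro!: contra_natI)
  show "\<rho> l x = \<zero>\<^bsub>ob (cokernel M N \<eta>) l\<^esub> \<longleftrightarrow> x \<in> ?I l" if "x \<in> carrier (ob N l)"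
    using coset_eq_zero_iff[OF mN I that] by (simp add: \<rho>_def ob quotient_zero[OF mN])
qed

text \<open>The augmentation of the representable resolution.\<close>

definition b_epi_proj ::
    "('k, 'z) ring_scheme \<Rightarrow> nat \<Rightarrow> ((nat \<Rightarrow> nat) \<Rightarrow> 'k) \<Rightarrow> ((nat \<Rightarrow> nat) \<Rightarrow> 'k) set" where
  "b_epi_proj k l x = (representable_map k 1 (face 1 0) l ` carrier (ob (representable k 1) l))
     +>\<^bsub>ob (representable k 0) l\<^esub> x"

lemma b_epi:
  assumes k: "cring k"
  shows b_epi_contravariant: "contravariant k (b_epi k)"
    and b_epi_proj: "b_epi_proj k \<in> contra_epi k (representable k 0) (b_epi k)"
    and b_epi_proj_zero: "x \<in> carrier (ob (representable k 0) l) \<Longrightarrow>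
      b_epi_proj k l x = \<zero>\<^bsub>ob (b_epi k) l\<^esub> \<longleftrightarrow> x \<in> rep_diff k 0 l ` carrier (ob (representable k 1) l)"
proof -
  have f: "face 1 0 \<in> epi_mor 1 0" using face_epi[of 0 0] by simp
  note coker = cokernel[OF representable_contravariant[OF k] representable_contravariant[OF k]
      representable_map_nat[OF k f]]
  have p: "b_epi_proj k = (\<lambda>l x. (representable_map k 1 (face 1 0) l ` carrier (ob (representable k 1) l))
     +>\<^bsub>ob (representable k 0) l\<^esub> x)"
    by (intro ext) (simp add: b_epi_proj_def)
  show "contravariant k (b_epi k)" unfolding b_epi_def by (rule coker(1))
  show "b_epi_proj k \<in> contra_epi k (representable k 0) (b_epi k)" unfolding b_epi_def p by (rule coker(2))
  have "rep_diff k 0 l ` carrier (ob (representable k 1) l) =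
      representable_map k 1 (face 1 0) l ` carrier (ob (representable k 1) l)" for l
    by (rule image_cong[OF refl]) (rule rep_diff_0[OF k])
  then show "x \<in> carrier (ob (representable k 0) l) \<Longrightarrow>
      b_epi_proj k l x = \<zero>\<^bsub>ob (b_epi k) l\<^esub> \<longleftrightarrow> x \<in> rep_diff k 0 l ` carrier (ob (representable k 1) l)"
    unfolding b_epi_def p using coker(3) by simp
qed

section \<open>Transport along injections\<close>

text \<open>The structure on the image of an injective \<open>e\<close> that makes \<open>e\<close>
  an isomorphism, used to move the representables to the element type that
  \<open>chosen_resolution\<close> prescribes.\<close>

definition transport_module :: "('a \<Rightarrow> 'b) \<Rightarrow> ('k, 'a) module \<Rightarrow> ('k, 'b) module" where
  "transport_module e M =
     \<lparr>carrier = e ` carrier M, mult = undefined, one = undefined, zero = e \<zero>\<^bsub>M\<^esub>,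
      add = (\<lambda>x y. e (inv_into (carrier M) e x \<oplus>\<^bsub>M\<^esub> inv_into (carrier M) e y)),
      smult = (\<lambda>a x. e (a \<odot>\<^bsub>M\<^esub> inv_into (carrier M) e x))\<rparr>"

definition transport_functor :: "(nat \<Rightarrow> 'a \<Rightarrow> 'b) \<Rightarrow> ('k, 'a) epi_functor \<Rightarrow> ('k, 'b) epi_functor" where
  "transport_functor e M =
     \<lparr>ob = (\<lambda>l. transport_module (e l) (ob M l)),
      arr = (\<lambda>l m f x. e l (arr M l m f (inv_into (carrier (ob M m)) (e m) x)))\<rparr>"

lemma transport_module:
  assumes M: "module k M" and e: "inj_on e (carrier M)"
  shows "module k (transport_module e M)"
    and "e \<in> module_homs k M (transport_module e M)"
    and "inv_into (carrier M) e \<in> module_homs k (transport_module e M) M"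
proof -
  interpret M: module k M by fact
  have inv: "inv_into (carrier M) e (e x) = x" if "x \<in> carrier M" for x
    by (rule inv_into_f_f[OF e that])
  show "module k (transport_module e M)"
  proof (rule moduleI[OF M.R.cring_axioms])
    show "abelian_group (transport_module e M)"
    proof (rule abelian_groupI)
      fix x assume "x \<in> carrier (transport_module e M)"
      then obtain y where y: "y \<in> carrier M" "x = e y" by (auto simp: transport_module_def)
      then have "e (\<ominus>\<^bsub>M\<^esub> y) \<oplus>\<^bsub>transport_module e M\<^esub> x = \<zero>\<^bsub>transport_module e M\<^esub>"
        by (simp add: transport_module_def inv M.M.l_neg)
      then show "\<exists>y\<in>carrier (transport_module e M). y \<oplus>\<^bsub>transport_module e M\<^esub> x = \<zero>\<^bsub>transport_module e M\<^esub>"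
        using y by (auto simp: transport_module_def)
    qed (auto simp: transport_module_def inv M.M.a_ac)
  qed (auto simp: transport_module_def inv M.smult_l_distr M.smult_r_distr M.smult_assoc1)
  show "e \<in> module_homs k M (transport_module e M)"
    by (rule module_homsI) (auto simp: transport_module_def inv)
  show "inv_into (carrier M) e \<in> module_homs k (transport_module e M) M"
    by (rule module_homsI) (auto simp: transport_module_def inv)
qed

lemma transport_functor:
  assumes M: "contravariant k M" and e: "\<And>l. inj_on (e l) (carrier (ob M l))"
  defines "e' \<equiv> (\<lambda>l. inv_into (carrier (ob M l)) (e l))"
  shows "contravariant k (transport_functor e M)"
    and "e \<in> contra_nat k M (transport_functor e M)"
    and "e' \<in> contra_nat k (transport_functor e M) M"
    and "x \<in> carrier (ob M l) \<Longrightarrow> e' l (e l x) = x"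
    and "y \<in> carrier (ob (transport_functor e M) l) \<Longrightarrow> e l (e' l y) = y"
proof -
  note T = transport_module[OF contravariant_module[OF M] e]
  have ob: "ob (transport_functor e M) l = transport_module (e l) (ob M l)" for l
    by (simp add: transport_functor_def)
  have carrier: "carrier (ob (transport_functor e M) l) = e l ` carrier (ob M l)" for l
    by (simp add: ob transport_module_def)
  have arr: "arr (transport_functor e M) l m f = (\<lambda>x. e l (arr M l m f (e' m x)))" for l m f
    by (simp add: transport_functor_def e'_def)
  show inv: "e' l (e l x) = x" if "x \<in> carrier (ob M l)" for x l
    unfolding e'_def by (rule inv_into_f_f[OF e that])
  show "e l (e' l y) = y" if "y \<in> carrier (ob (transport_functor e M) l)"
    using that inv by (auto simp: carrier)
  have e_hom: "e l \<in> module_homs k (ob M l) (ob (transport_functor e M) l)" for l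
    unfolding ob by (rule T(2))
  have e'_hom: "e' l \<in> module_homs k (ob (transport_functor e M) l) (ob M l)" for l
    unfolding ob e'_def by (rule T(3))
  note cl = module_homs_closed[OF contravariant_arr[OF M]]
  have "arr (transport_functor e M) l m f \<in>
      module_homs k (ob (transport_functor e M) m) (ob (transport_functor e M) l)"
    if "f \<in> epi_mor l m" for l m f
    unfolding arr by (rule module_homs_comp[OF e_hom module_homs_comp[OF contravariant_arr[OF M that] e'_hom]])
  then show "contravariant k (transport_functor e M)"
    unfolding contravariant_def
    using T(1)[folded ob]
    by (auto simp: carrier arr inv cl epi_mor_id epi_mor_compose contravariant_id[OF M] contravariant_comp[OF M])
  show "e \<in> contra_nat k M (transport_functor e M)"
    by (rule contra_natI[OF e_hom]) (simp add: arr inv)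
  show "e' \<in> contra_nat k (transport_functor e M) M"
    by (rule contra_natI[OF e'_hom]) (auto simp: arr inv carrier cl)
qed

text \<open>Since \<open>\<pi> n\<close> is surjective, the element of \<open>B[n]\<close> that
  corresponds to the identity of \<open>[n]\<close> has a preimage, and Yoneda extends it to the
  lift. Stated for a retract \<open>P\<close>, so that it applies both to a representable and to its
  copy on another type.\<close>

lemma projective_representable_iso:
  assumes k: "cring k" and P: "contravariant k P" and e: "e \<in> contra_nat k (representable k n) P"
    and e': "e' \<in> contra_nat k P (representable k n)"
    and inv: "\<And>l x. x \<in> carrier (ob P l) \<Longrightarrow> e l (e' l x) = x"
  shows "projective k P"
  unfolding projective_def
proof (intro conjI P allI impI, elim conjE)
  fix E B \<pi> \<phi>
  assume E: "contravariant k E" and B: "contravariant k B" and \<pi>: "\<pi> \<in> contra_epi k E B"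
    and \<phi>: "\<phi> \<in> contra_nat k P B"
  let ?i = "free_gen k (epi_id n)"
  have i: "?i \<in> carrier (ob (representable k n) n)" by (rule representable_gen[OF k epi_mor_id])
  have \<pi>n: "\<pi> \<in> contra_nat k E B" using \<pi> by (simp add: contra_epi_def)
  have "\<phi> n (e n ?i) \<in> \<pi> n ` carrier (ob E n)"
    using \<pi> contra_nat_closed[OF \<phi> contra_nat_closed[OF e i]] by (simp add: contra_epi_def)
  then obtain x where x: "x \<in> carrier (ob E n)" "\<pi> n x = \<phi> n (e n ?i)" by auto
  note y = yoneda_nat[OF k E x(1)]
  have "\<pi> l (yoneda k E n x l c) = \<phi> l (e l c)" if "c \<in> carrier (ob (representable k n) l)" for l c
    by (rule yoneda_ext[OF k B contra_nat_comp[OF \<pi>n y] contra_nat_comp[OF \<phi> e] _ that])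
      (simp add: yoneda_gen[OF k E x(1) epi_mor_id] contravariant_id[OF E x(1)] x(2))
  then have "\<forall>l. \<forall>x'\<in>carrier (ob P l). \<pi> l (yoneda k E n x l (e' l x')) = \<phi> l x'"
    by (simp add: contra_nat_closed[OF e'] inv)
  then show "\<exists>\<psi>\<in>contra_nat k P E. \<forall>n. \<forall>x\<in>carrier (ob P n). \<pi> n (\<psi> n x) = \<phi> n x"
    by (rule bexI[OF _ contra_nat_comp[OF y e']])
qed

text \<open>There are finitely many surjections from \<open>[l]\<close> to \<open>[n]\<close>, so a
  vector is encoded by its coefficients along a chosen enumeration. The first components are padding
  to reach the prescribed type.\<close>

definition rep_code :: "nat \<Rightarrow> nat \<Rightarrow> ((nat \<Rightarrow> nat) \<Rightarrow> 'k) \<Rightarrow> ('m \<times> 'k) list" where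
  "rep_code n l c = map (\<lambda>f. (undefined, c f)) (SOME xs. set xs = epi_mor l n)"

lemma rep_code_inj: "inj_on (rep_code n l) (carrier (ob (representable k n) l))"
proof (rule inj_onI)
  fix c d :: "(nat \<Rightarrow> nat) \<Rightarrow> 'a"
  assume c: "c \<in> carrier (ob (representable k n) l)" and d: "d \<in> carrier (ob (representable k n) l)"
    and eq: "rep_code n l c = rep_code n l d"
  have "set (SOME xs. set xs = epi_mor l n) = epi_mor l n"
    by (rule someI_ex) (rule finite_list[OF finite_epi_mor])
  \<comment> \<open>On the enumerated set the lists give the coefficients; outside it both vectors
    vanish.\<close>
  then have "c f = d f" for f
    using c d eq unfolding rep_code_def map_eq_conv ob_representable free_carrier_iff
    by (cases "f \<in> epi_mor l n") auto
  then show "c = d" by (rule ext)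
qed

section \<open>Comparison of resolutions\<close>

lemma contra_nat_zero:
  assumes "contravariant k M" "contravariant k N" "\<eta> \<in> contra_nat k M N"
  shows "\<eta> n \<zero>\<^bsub>ob M n\<^esub> = \<zero>\<^bsub>ob N n\<^esub>"
  by (rule module_homs_zero[OF contravariant_module[OF assms(1)] contravariant_module[OF assms(2)]
        contra_nat_hom[OF assms(3)]])

lemma projective_resolutionD:
  assumes "projective_resolution k M P D \<epsilon>"
  shows "projective k (P q)" and "contravariant k (P q)"
    and "D q \<in> contra_nat k (P (Suc q)) (P q)"
    and "\<epsilon> \<in> contra_nat k (P 0) M"
    and "\<epsilon> n ` carrier (ob (P 0) n) = carrier (ob M n)"
    and "x \<in> carrier (ob (P (Suc 0)) n) \<Longrightarrow> \<epsilon> n (D 0 n x) = \<zero>\<^bsub>ob M n\<^esub>"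
    and "x \<in> carrier (ob (P (Suc (Suc q))) n) \<Longrightarrow> D q n (D (Suc q) n x) = \<zero>\<^bsub>ob (P q) n\<^esub>"
    and "x \<in> carrier (ob (P 0) n) \<Longrightarrow> \<epsilon> n x = \<zero>\<^bsub>ob M n\<^esub> \<Longrightarrow> x \<in> D 0 n ` carrier (ob (P (Suc 0)) n)"
    and "x \<in> carrier (ob (P (Suc q)) n) \<Longrightarrow> D q n x = \<zero>\<^bsub>ob (P q) n\<^esub> \<Longrightarrow>
      x \<in> D (Suc q) n ` carrier (ob (P (Suc (Suc q))) n)"
proof -
  note * = assms[unfolded projective_resolution_def contra_epi_def]
  show "projective k (P q)" "D q \<in> contra_nat k (P (Suc q)) (P q)" "\<epsilon> \<in> contra_nat k (P 0) M"
    "\<epsilon> n ` carrier (ob (P 0) n) = carrier (ob M n)" using * by auto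
  then show "contravariant k (P q)" by (simp add: projective_def)
  have 0: "D 0 n ` carrier (ob (P (Suc 0)) n) = {x \<in> carrier (ob (P 0) n). \<epsilon> n x = \<zero>\<^bsub>ob M n\<^esub>}"
    and S: "D (Suc q) n ` carrier (ob (P (Suc (Suc q))) n) =
      {x \<in> carrier (ob (P (Suc q)) n). D q n x = \<zero>\<^bsub>ob (P q) n\<^esub>}" using * by auto
  show "\<epsilon> n (D 0 n x) = \<zero>\<^bsub>ob M n\<^esub>" if "x \<in> carrier (ob (P (Suc 0)) n)" using 0 that by blast
  show "x \<in> D 0 n ` carrier (ob (P (Suc 0)) n)" if "x \<in> carrier (ob (P 0) n)" "\<epsilon> n x = \<zero>\<^bsub>ob M n\<^esub>"
    using 0 that by blast
  show "D q n (D (Suc q) n x) = \<zero>\<^bsub>ob (P q) n\<^esub>" if "x \<in> carrier (ob (P (Suc (Suc q))) n)"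
    using S that by blast
  show "x \<in> D (Suc q) n ` carrier (ob (P (Suc (Suc q))) n)"
    if "x \<in> carrier (ob (P (Suc q)) n)" "D q n x = \<zero>\<^bsub>ob (P q) n\<^esub>" using S that by blast
qed

text \<open>The standard inductive lifting along an exact sequence. Dependent choice sees only the
  latest map \<open>h\<close>, so \<open>A\<close> also records that \<open>h\<close> after
  \<open>D q\<close> lands in the image of \<open>D' q\<close>, which is what the next lift
  requires.\<close>

lemma comparison:
  assumes k: "cring k" and M: "contravariant k M"
    and P: "projective_resolution k M P D \<epsilon>" and P': "projective_resolution k M P' D' \<epsilon>'"
  obtains g where "\<And>q. g q \<in> contra_nat k (P q) (P' q)"
    "\<And>n x. x \<in> carrier (ob (P 0) n) \<Longrightarrow> \<epsilon>' n (g 0 n x) = \<epsilon> n x"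
    "\<And>q n x. x \<in> carrier (ob (P (Suc q)) n) \<Longrightarrow> D' q n (g (Suc q) n x) = g q n (D q n x)"
proof -
  note P = projective_resolutionD[OF P] and P' = projective_resolutionD[OF P']
  define A where "A q h \<longleftrightarrow> h \<in> contra_nat k (P q) (P' q) \<and>
      (q = 0 \<longrightarrow> (\<forall>n. \<forall>x \<in> carrier (ob (P 0) n). \<epsilon>' n (h n x) = \<epsilon> n x)) \<and>
      (\<forall>n. \<forall>x \<in> carrier (ob (P (Suc q)) n). h n (D q n x) \<in> D' q n ` carrier (ob (P' (Suc q)) n))" for q h
  define S where "S q h h' \<longleftrightarrow> (\<forall>n. \<forall>x \<in> carrier (ob (P (Suc q)) n). D' q n (h' n x) = h n (D q n x))" for q h h'
  note cl = contra_nat_closed[OF P(3)]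
  have "\<exists>g. \<forall>q. A q (g q) \<and> S q (g q) (g (Suc q))"
  proof (rule dependent_nat_choice)
    obtain h where h: "h \<in> contra_nat k (P 0) (P' 0)"
      "\<And>n x. x \<in> carrier (ob (P 0) n) \<Longrightarrow> \<epsilon>' n (h n x) = \<epsilon> n x"
      using projective_lift[OF k P(1) P'(2) M P'(4) P(4)] contra_nat_closed[OF P(4)] P'(5) by metis
    have "h n (D 0 n x) \<in> D' 0 n ` carrier (ob (P' (Suc 0)) n)" if "x \<in> carrier (ob (P (Suc 0)) n)" for n x
      by (rule P'(8)) (use contra_nat_closed[OF h(1)] cl h(2) P(6) that in auto)
    then show "\<exists>h. A 0 h" using h unfolding A_def by blast
  next
    fix q h assume A: "A q h"
    then have h: "h \<in> contra_nat k (P q) (P' q)" by (simp add: A_def)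
    obtain h' where h': "h' \<in> contra_nat k (P (Suc q)) (P' (Suc q))"
      "\<And>n x. x \<in> carrier (ob (P (Suc q)) n) \<Longrightarrow> D' q n (h' n x) = h n (D q n x)"
    proof (rule projective_lift[OF k P(1) P'(2) P'(2) P'(3) contra_nat_comp[OF h P(3)]])
      show "h n (D q n x) \<in> D' q n ` carrier (ob (P' (Suc q)) n)" if "x \<in> carrier (ob (P (Suc q)) n)" for n x
        using A that by (simp add: A_def)
    qed blast
    have "h' n (D (Suc q) n x) \<in> D' (Suc q) n ` carrier (ob (P' (Suc (Suc q))) n)"
      if "x \<in> carrier (ob (P (Suc (Suc q))) n)" for n x
      by (rule P'(9)) (use contra_nat_closed[OF h'(1)] cl h'(2) P(7) that contra_nat_zero[OF P(2) P'(2) h] in auto)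
    then show "\<exists>h'. A (Suc q) h' \<and> S q h h'" using h' unfolding A_def S_def by blast
  qed
  then obtain g where "\<And>q. A q (g q)" "\<And>q. S q (g q) (g (Suc q))" by blast
  then show ?thesis using that[of g] unfolding A_def S_def by blast
qed

text \<open>As in \<open>comparison\<close>, but the map to be lifted is the defect
  \<open>?\<psi>\<close>: what remains of \<open>\<phi>\<close> after subtracting the part produced
  by the homotopy found so far.\<close>

lemma null_homotopy:
  assumes k: "cring k" and M: "contravariant k M"
    and P: "projective_resolution k M P D \<epsilon>" and P': "projective_resolution k M P' D' \<epsilon>'"
    and \<phi>: "\<And>q. \<phi> q \<in> contra_nat k (P q) (P' q)"
    and \<phi>0: "\<And>n x. x \<in> carrier (ob (P 0) n) \<Longrightarrow> \<epsilon>' n (\<phi> 0 n x) = \<zero>\<^bsub>ob M n\<^esub>"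
    and \<phi>D: "\<And>q n x. x \<in> carrier (ob (P (Suc q)) n) \<Longrightarrow> D' q n (\<phi> (Suc q) n x) = \<phi> q n (D q n x)"
  obtains s where "\<And>q. s q \<in> contra_nat k (P q) (P' (Suc q))"
    "\<And>n x. x \<in> carrier (ob (P 0) n) \<Longrightarrow> \<phi> 0 n x = D' 0 n (s 0 n x)"
    "\<And>q n x. x \<in> carrier (ob (P (Suc q)) n) \<Longrightarrow>
      \<phi> (Suc q) n x = D' (Suc q) n (s (Suc q) n x) \<oplus>\<^bsub>ob (P' (Suc q)) n\<^esub> s q n (D q n x)"
proof -
  note P = projective_resolutionD[OF P] and P' = projective_resolutionD[OF P']
  let ?\<psi> = "\<lambda>q h n x. \<phi> (Suc q) n x \<ominus>\<^bsub>ob (P' (Suc q)) n\<^esub> h n (D q n x)"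
  define A where "A q h \<longleftrightarrow> h \<in> contra_nat k (P q) (P' (Suc q)) \<and>
      (q = 0 \<longrightarrow> (\<forall>n. \<forall>x \<in> carrier (ob (P 0) n). \<phi> 0 n x = D' 0 n (h n x))) \<and>
      (\<forall>n. \<forall>x \<in> carrier (ob (P (Suc q)) n). ?\<psi> q h n x \<in> D' (Suc q) n ` carrier (ob (P' (Suc (Suc q))) n))" for q h
  define S where "S q h h' \<longleftrightarrow> (\<forall>n. \<forall>x \<in> carrier (ob (P (Suc q)) n). D' (Suc q) n (h' n x) = ?\<psi> q h n x)" for q h h'
  note cl = contra_nat_closed[OF P(3)] and cl' = contra_nat_closed[OF P'(3)] and \<phi>cl = contra_nat_closed[OF \<phi>]
  have m: "module k (ob (P q) n)" "module k (ob (P' q) n)" for q n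
    using contravariant_module P(2) P'(2) by blast+
  have nat: "?\<psi> q h \<in> contra_nat k (P (Suc q)) (P' (Suc q))" if "h \<in> contra_nat k (P q) (P' (Suc q))" for q h
    by (rule contra_nat_minus[OF P'(2) \<phi> contra_nat_comp[OF that P(3)]])
  \<comment> \<open>Applying \<open>D' q\<close> to the defect gives
    \<open>\<phi> q (D q x) - D' q (h (D q x))\<close>, so the defect is a cycle by
    \<open>eq\<close>, and exactness makes it a boundary.\<close>
  have ker: "?\<psi> q h n x \<in> D' (Suc q) n ` carrier (ob (P' (Suc (Suc q))) n)"
    if h: "h \<in> contra_nat k (P q) (P' (Suc q))" and x: "x \<in> carrier (ob (P (Suc q)) n)"
      and eq: "D' q n (h n (D q n x)) = \<phi> q n (D q n x)" for q h n x
  proof (rule P'(9))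
    interpret P': module k "ob (P' q) n" by (rule m)
    show "?\<psi> q h n x \<in> carrier (ob (P' (Suc q)) n)" by (rule contra_nat_closed[OF nat[OF h] x])
    show "D' q n (?\<psi> q h n x) = \<zero>\<^bsub>ob (P' q) n\<^esub>"
      using x by (simp add: module_homs_minus[OF m(2) m(2) contra_nat_hom[OF P'(3)]] \<phi>cl
        contra_nat_closed[OF h] cl \<phi>D eq P'.M.right_minus_eq)
  qed
  have "\<exists>s. \<forall>q. A q (s q) \<and> S q (s q) (s (Suc q))"
  proof (rule dependent_nat_choice)
    obtain h where h: "h \<in> contra_nat k (P 0) (P' (Suc 0))"
      "\<And>n x. x \<in> carrier (ob (P 0) n) \<Longrightarrow> D' 0 n (h n x) = \<phi> 0 n x"
    proof (rule projective_lift[OF k P(1) P'(2) P'(2) P'(3) \<phi>])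
      show "\<phi> 0 n x \<in> D' 0 n ` carrier (ob (P' (Suc 0)) n)" if "x \<in> carrier (ob (P 0) n)" for n x
        by (rule P'(8)[OF \<phi>cl[OF that] \<phi>0[OF that]])
    qed blast
    have "?\<psi> 0 h n x \<in> D' (Suc 0) n ` carrier (ob (P' (Suc (Suc 0))) n)"
      if "x \<in> carrier (ob (P (Suc 0)) n)" for n x
      by (rule ker[OF h(1) that h(2)[OF cl[OF that]]])
    then have "A 0 h" unfolding A_def using h(1) h(2)[symmetric] by blast
    then show "\<exists>h. A 0 h" by blast
  next
    fix q h assume A: "A q h"
    then have h: "h \<in> contra_nat k (P q) (P' (Suc q))" by (simp add: A_def)
    obtain h' where h': "h' \<in> contra_nat k (P (Suc q)) (P' (Suc (Suc q)))"
      "\<And>n x. x \<in> carrier (ob (P (Suc q)) n) \<Longrightarrow> D' (Suc q) n (h' n x) = ?\<psi> q h n x"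
    proof (rule projective_lift[OF k P(1) P'(2) P'(2) P'(3) nat[OF h]])
      show "?\<psi> q h n x \<in> D' (Suc q) n ` carrier (ob (P' (Suc (Suc q))) n)"
        if "x \<in> carrier (ob (P (Suc q)) n)" for n x
        using A that by (simp add: A_def)
    qed blast
    have "?\<psi> (Suc q) h' n x \<in> D' (Suc (Suc q)) n ` carrier (ob (P' (Suc (Suc (Suc q)))) n)"
      if x: "x \<in> carrier (ob (P (Suc (Suc q))) n)" for n x
    proof (rule ker[OF h'(1) x])
      interpret P': module k "ob (P' (Suc q)) n" by (rule m)
      \<comment> \<open>By the choice of \<open>h'\<close> the two sides differ, up to sign, by
        \<open>h\<close> applied to two successive differentials of \<open>x\<close>, which is
        zero.\<close>
      show "D' (Suc q) n (h' n (D (Suc q) n x)) = \<phi> (Suc q) n (D (Suc q) n x)"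
        using cl[OF x] \<phi>cl P(7)[OF x] contra_nat_zero[OF P(2) P'(2) h]
        by (simp add: h'(2) a_minus_def P'.M.a_inv_zero)
    qed
    then show "\<exists>h'. A (Suc q) h' \<and> S q h h'" using h' unfolding A_def S_def by blast
  qed
  then obtain s where s: "\<And>q. A q (s q)" "\<And>q. S q (s q) (s (Suc q))" by blast
  have nat: "s q \<in> contra_nat k (P q) (P' (Suc q))" for q using s(1) by (simp add: A_def)
  show ?thesis
  proof (rule that[OF nat])
    show "\<phi> 0 n x = D' 0 n (s 0 n x)" if "x \<in> carrier (ob (P 0) n)" for n x
      using s(1)[of 0] that by (simp add: A_def)
    fix q n x assume x: "x \<in> carrier (ob (P (Suc q)) n)"
    interpret P': module k "ob (P' (Suc q)) n" by (rule m)
    have "D' (Suc q) n (s (Suc q) n x) = \<phi> (Suc q) n x \<ominus>\<^bsub>ob (P' (Suc q)) n\<^esub> s q n (D q n x)"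
      using s(2)[of q] x by (simp add: S_def)
    then show "\<phi> (Suc q) n x = D' (Suc q) n (s (Suc q) n x) \<oplus>\<^bsub>ob (P' (Suc q)) n\<^esub> s q n (D q n x)"
      using \<phi>cl[OF x] contra_nat_closed[OF nat cl[OF x]]
      by (simp add: a_minus_def P'.M.a_assoc P'.M.l_neg)
  qed
qed

section \<open>Resolutions of \<open>b_epi\<close>, by representables and by their copies on
  lists\<close>

lemma representable_resolution:
  assumes k: "cring k"
  shows "projective_resolution k (b_epi k) (representable k) (rep_diff k) (b_epi_proj k)"
  unfolding projective_resolution_def
proof (intro conjI allI)
  show "projective k (representable k q)" for q
    by (rule projective_representable_iso[OF k representable_contravariant[OF k] contra_nat_id contra_nat_id]) (rule refl)
  note cl = contra_nat_closed[OF rep_diff_nat[OF k]]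
  show "rep_diff k 0 n ` carrier (ob (representable k 1) n) =
      {x \<in> carrier (ob (representable k 0) n). b_epi_proj k n x = \<zero>\<^bsub>ob (b_epi k) n\<^esub>}" for n
    using b_epi_proj_zero[OF k] cl[of _ 0 n] by auto
  show "rep_diff k (Suc q) n ` carrier (ob (representable k (Suc (Suc q))) n) =
      {x \<in> carrier (ob (representable k (Suc q)) n). rep_diff k q n x = \<zero>\<^bsub>ob (representable k q) n\<^esub>}" for q n
    using rep_exact[OF k] rep_diff_rep_diff[OF k] cl[of _ "Suc q" n] by auto
qed (simp_all add: rep_diff_nat[OF k] b_epi_proj[OF k])

text \<open>Conjugation by the mutually inverse \<open>e\<close> and \<open>e'\<close> carries
  kernels to kernels and images to images; \<open>im\<close> and \<open>img\<close> reduce exactness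
  of \<open>P\<close> to that of \<open>R\<close>.\<close>

lemma transport_resolution:
  assumes R: "projective_resolution k M R d \<rho>" and P: "\<And>q. projective k (P q)"
    and e: "\<And>q. e q \<in> contra_nat k (R q) (P q)" and e': "\<And>q. e' q \<in> contra_nat k (P q) (R q)"
    and inv: "\<And>q l x. x \<in> carrier (ob (R q) l) \<Longrightarrow> e' q l (e q l x) = x"
    and inv': "\<And>q l y. y \<in> carrier (ob (P q) l) \<Longrightarrow> e q l (e' q l y) = y"
  shows "projective_resolution k M P (\<lambda>q l x. e q l (d q l (e' (Suc q) l x))) (\<lambda>l x. \<rho> l (e' 0 l x))"
  unfolding projective_resolution_def contra_epi_def
proof (intro conjI allI CollectI)
  note RD = projective_resolutionD[OF R]
  note ecl = contra_nat_closed[OF e] and ecl' = contra_nat_closed[OF e'] and dcl = contra_nat_closed[OF RD(3)]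
  have cP: "contravariant k (P q)" for q using P[of q] by (simp add: projective_def)
  have im: "carrier (ob (R q) l) = e' q l ` carrier (ob (P q) l)" for q l
  proof
    show "carrier (ob (R q) l) \<subseteq> e' q l ` carrier (ob (P q) l)"
      using inv[symmetric] ecl by (blast intro: image_eqI)
  qed (use ecl' in auto)
  have ez: "e q l x = \<zero>\<^bsub>ob (P q) l\<^esub> \<longleftrightarrow> x = \<zero>\<^bsub>ob (R q) l\<^esub>" if "x \<in> carrier (ob (R q) l)" for q l x
    using contra_nat_zero[OF RD(2) cP e] contra_nat_zero[OF cP RD(2) e'] inv[OF that] by metis
  have img: "e q l ` {x \<in> carrier (ob (R q) l). Z x} = {y \<in> carrier (ob (P q) l). Z (e' q l y)}" for q l Z
  proof (intro equalityI subsetI)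
    fix y assume "y \<in> {y \<in> carrier (ob (P q) l). Z (e' q l y)}"
    then show "y \<in> e q l ` {x \<in> carrier (ob (R q) l). Z x}"
      using inv' ecl' by (intro image_eqI[of _ _ "e' q l y"]) auto
  qed (auto simp: inv ecl)
  show "(\<lambda>l x. e q l (d q l (e' (Suc q) l x))) \<in> contra_nat k (P (Suc q)) (P q)" for q
    by (rule contra_nat_comp[OF e contra_nat_comp[OF RD(3) e']])
  show "(\<lambda>l x. \<rho> l (e' 0 l x)) \<in> contra_nat k (P 0) M"
    by (rule contra_nat_comp[OF RD(4) e'])
  show "(\<lambda>x. \<rho> l (e' 0 l x)) ` carrier (ob (P 0) l) = carrier (ob M l)" for l
    using RD(5)[of l] unfolding im image_image .
  show "(\<lambda>x. e 0 l (d 0 l (e' (Suc 0) l x))) ` carrier (ob (P 1) l) =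
      {x \<in> carrier (ob (P 0) l). \<rho> l (e' 0 l x) = \<zero>\<^bsub>ob M l\<^esub>}" for l
  proof -
    have "(\<lambda>x. e 0 l (d 0 l (e' (Suc 0) l x))) ` carrier (ob (P 1) l) =
        e 0 l ` d 0 l ` carrier (ob (R (Suc 0)) l)"
      unfolding im image_image by simp
    also have "d 0 l ` carrier (ob (R (Suc 0)) l) = {x \<in> carrier (ob (R 0) l). \<rho> l x = \<zero>\<^bsub>ob M l\<^esub>}"
      using RD(6,8) dcl by blast
    finally show ?thesis unfolding img .
  qed
  show "(\<lambda>x. e (Suc q) l (d (Suc q) l (e' (Suc (Suc q)) l x))) ` carrier (ob (P (Suc (Suc q))) l) =
      {x \<in> carrier (ob (P (Suc q)) l). e q l (d q l (e' (Suc q) l x)) = \<zero>\<^bsub>ob (P q) l\<^esub>}" for q l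
  proof -
    have "(\<lambda>x. e (Suc q) l (d (Suc q) l (e' (Suc (Suc q)) l x))) ` carrier (ob (P (Suc (Suc q))) l) =
        e (Suc q) l ` d (Suc q) l ` carrier (ob (R (Suc (Suc q))) l)"
      unfolding im image_image by simp
    also have "d (Suc q) l ` carrier (ob (R (Suc (Suc q))) l) =
        {x \<in> carrier (ob (R (Suc q)) l). d q l x = \<zero>\<^bsub>ob (R q) l\<^esub>}"
      using RD(7,9) dcl by blast
    also have "\<dots> = {x \<in> carrier (ob (R (Suc q)) l). e q l (d q l x) = \<zero>\<^bsub>ob (P q) l\<^esub>}"
      using ez dcl by blast
    finally show ?thesis unfolding img .
  qed
qed (rule P)

text \<open>Existence on the list type is what turns the choice in \<open>chosen_resolution\<close>
  into an actual resolution; no other property of this copy is retained.\<close>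

lemma b_epi_resolution:
  fixes k :: "('k, 'z) ring_scheme"
  assumes k: "cring k"
  obtains P :: "nat \<Rightarrow> ('k, ('m \<times> 'k) list) epi_functor" and D \<epsilon>
  where "projective_resolution k (b_epi k) P D \<epsilon>"
proof -
  let ?e = "rep_code :: nat \<Rightarrow> nat \<Rightarrow> ((nat \<Rightarrow> nat) \<Rightarrow> 'k) \<Rightarrow> ('m \<times> 'k) list"
  let ?e' = "\<lambda>q l. inv_into (carrier (ob (representable k q) l)) (?e q l)"
  let ?P = "\<lambda>q. transport_functor (?e q) (representable k q)"
  note T = transport_functor[where e = "?e q" and M = "representable k q" for q,
      OF representable_contravariant[OF k] rep_code_inj]
  have "projective k (?P q)" for q
    by (rule projective_representable_iso[where e = "?e q" and e' = "?e' q", OF k T(1,2,3)]) (rule T(5))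
  then have "projective_resolution k (b_epi k) ?P (\<lambda>q l x. ?e q l (rep_diff k q l (?e' (Suc q) l x)))
      (\<lambda>l x. b_epi_proj k l (?e' 0 l x))"
    by (rule transport_resolution[where e = ?e and e' = ?e', OF representable_resolution[OF k] _ T(2,3,4,5)])
  then show ?thesis by (rule that)
qed

lemma chosen_resolution_b_epi:
  fixes k :: "('k, 'z) ring_scheme"
  assumes k: "cring k"
  obtains P D \<epsilon> where "chosen_resolution k (b_epi k) = (P, D)" "projective_resolution k (b_epi k) P D \<epsilon>"
proof -
  obtain P :: "nat \<Rightarrow> ('k, (((nat \<Rightarrow> nat) \<Rightarrow> 'k) set \<times> 'k) list) epi_functor" and D \<epsilon>
    where "projective_resolution k (b_epi k) P D \<epsilon>"
    using b_epi_resolution[OF k] .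
  then have "case (P, D) of (P, D) \<Rightarrow> \<exists>\<epsilon>. projective_resolution k (b_epi k) P D \<epsilon>" by auto
  then have "case chosen_resolution k (b_epi k) of (P, D) \<Rightarrow> \<exists>\<epsilon>. projective_resolution k (b_epi k) P D \<epsilon>"
    unfolding chosen_resolution_def by (rule someI)
  then show ?thesis
    using that by (cases "chosen_resolution k (b_epi k)") auto
qed

section \<open>Bar homology as a Tor functor\<close>

lemma bar_diff_alt_sum:
  "bar_diff k F n x = alt_sum k (ob F n) n (\<lambda>i. arr F (Suc n) n (face (Suc n) i) x)"
  by (simp add: bar_diff_def alt_sum_def)

lemma bar_diff_hom:
  assumes F: "covariant k F"
  shows "bar_diff k F n \<in> module_homs k (ob F (Suc n)) (ob F n)"
  unfolding bar_diff_alt_sum[abs_def]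
  by (rule alt_sum_hom_map[OF covariant_module[OF F] covariant_arr[OF F face_epi]])

lemma bar_diff_bar_diff:
  assumes F: "covariant k F" and x: "x \<in> carrier (ob F (Suc (Suc n)))"
  shows "bar_diff k F n (bar_diff k F (Suc n) x) = \<zero>\<^bsub>ob F n\<^esub>"
proof -
  note m = covariant_module[OF F]
  note cl = module_homs_closed[OF covariant_arr[OF F face_epi]]
  let ?a = "\<lambda>i j. arr F (Suc n) n (face (Suc n) i) (arr F (Suc (Suc n)) (Suc n) (face (Suc (Suc n)) j) x)"
  have "bar_diff k F n (bar_diff k F (Suc n) x) = alt_sum k (ob F n) n (\<lambda>i. alt_sum k (ob F n) (Suc n) (?a i))"
    unfolding bar_diff_alt_sum
    by (rule alt_sum_cong[OF m])
      (simp_all add: alt_sum_hom[OF m m covariant_arr[OF F face_epi]] cl x alt_sum_closed[OF m])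
  also have "\<dots> = \<zero>\<^bsub>ob F n\<^esub>"
  proof (rule alt_sum_alt_sum[OF m])
    fix i j assume "i < j" "j \<le> Suc n"
    then show "?a i j = ?a (j - 1) i"
      using x by (simp add: covariant_comp[OF F face_epi face_epi, symmetric] face_face)
  qed (simp add: cl x)
  finally show ?thesis .
qed

text \<open>The map to \<open>F[n]\<close> induced by \<open>g\<close> and the co-Yoneda
  identification of the tensor product of a representable with \<open>F\<close>. Naturality of
  \<open>g\<close> reduces the coend relation to the case of a representable, where it is
  functoriality of \<open>F\<close>.\<close>

lemma free_lift_arr_balanced:
  assumes k: "cring k" and F: "covariant k F" and g: "g \<in> contra_nat k M (representable k n)"
  shows "balanced k M F (ob F n) (\<lambda>m x y. free_lift k (ob F n) (\<lambda>h. arr F m n h y) (g m x))"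
  unfolding balanced_def
proof (intro conjI allI ballI)
  note mF = covariant_module[OF F] and arrF = covariant_arr[OF F]
  note cl = module_homs_closed[OF arrF]
  have lift: "free_lift k (ob F n) (\<lambda>h. arr F m n h y) \<in> module_homs k (ob (representable k n) m) (ob F n)"
    if "y \<in> carrier (ob F m)" for m y
    unfolding ob_representable by (rule free_lift_hom[OF k mF]) (auto intro: cl that)
  show "(\<lambda>x. free_lift k (ob F n) (\<lambda>h. arr F m n h y) (g m x)) \<in> module_homs k (ob M m) (ob F n)"
    if "y \<in> carrier (ob F m)" for m y
    by (rule module_homs_comp[OF lift[OF that] contra_nat_hom[OF g]])
  show "(\<lambda>y. free_lift k (ob F n) (\<lambda>h. arr F m n h y) (g m x)) \<in> module_homs k (ob F m) (ob F n)"
    if "x \<in> carrier (ob M m)" for m x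
  proof -
    \<comment> \<open>For linearity in \<open>y\<close> the sum is regarded as a combination of the
      maps \<open>arr F m n h\<close> over the support of \<open>g m x\<close>, which consists of
      morphisms.\<close>
    have gx: "g m x \<in> carrier (free_module k (epi_mor m n))"
      using contra_nat_closed[OF g that] by (simp add: ob_representable)
    then have "g m x h \<in> carrier k" "h \<in> epi_mor m n" if "g m x h \<noteq> \<zero>\<^bsub>k\<^esub>" for h
      using that by (auto simp: free_carrier_iff)
    then show ?thesis
      unfolding free_lift_def
      by (intro module_homs_finsum_map[OF mF] module_homs_smult_map[OF mF] arrF) auto
  qed
  fix l m f x y
  assume f: "f \<in> epi_mor l m" and x: "x \<in> carrier (ob M m)" and y: "y \<in> carrier (ob F l)"
  have "free_lift k (ob F n) (\<lambda>h. arr F l n h y) (arr (representable k n) l m f c) =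
      free_lift k (ob F n) (\<lambda>h. arr F m n h (arr F l m f y)) c"
    if c: "c \<in> carrier (ob (representable k n) m)" for c
  proof (rule representable_hom_ext[OF k mF module_homs_comp[OF lift[OF y]
          contravariant_arr[OF representable_contravariant[OF k] f]] lift[OF cl[OF f y]] _ c])
    fix h assume h: "h \<in> epi_mor m n"
    show "free_lift k (ob F n) (\<lambda>h. arr F l n h y) (arr (representable k n) l m f (free_gen k h)) =
        free_lift k (ob F n) (\<lambda>h. arr F m n h (arr F l m f y)) (free_gen k h)"
      using free_lift_gen[OF k mF, of "\<lambda>h. arr F l n h y" "compose {0..l} h f" n]
        free_lift_gen[OF k mF, of "\<lambda>h. arr F m n h (arr F l m f y)" h n] cl epi_mor_compose f h y
      by (simp add: representable_arr_gen[OF k f h] covariant_comp[OF F f h y])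
  qed
  then show "free_lift k (ob F n) (\<lambda>h. arr F l n h y) (g l (arr M l m f x)) =
      free_lift k (ob F n) (\<lambda>h. arr F m n h (arr F l m f y)) (g m x)"
    by (simp add: contra_nat_arr[OF g f x] contra_nat_closed[OF g x])
qed

text \<open>The differential is injective on \<open>k[epi_mor n n]\<close>, as \<open>k[epi_mor n (n + 1)] = 0\<close>. Hence the
  resolution by representables has no endomorphism over \<open>b_epi\<close> other than the identity.\<close>

lemma representable_resolution_endo:
  assumes k: "cring k"
    and \<phi>: "\<And>q. \<phi> q \<in> contra_nat k (representable k q) (representable k q)"
    and \<phi>0: "\<And>n x. x \<in> carrier (ob (representable k 0) n) \<Longrightarrow> b_epi_proj k n (\<phi> 0 n x) = b_epi_proj k n x"
    and \<phi>D: "\<And>q n x. x \<in> carrier (ob (representable k (Suc q)) n) \<Longrightarrow>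
      rep_diff k q n (\<phi> (Suc q) n x) = \<phi> q n (rep_diff k q n x)"
    and x: "x \<in> carrier (ob (representable k q) n)"
  shows "\<phi> q n x = x"
  using x
proof (induction q arbitrary: n x)
  note C = representable_contravariant[OF k] and RD = projective_resolutionD[OF representable_resolution[OF k]]
  note B = b_epi_contravariant[OF k] and cl = contra_nat_closed[OF \<phi>]
  note m = representable_module[OF k] contravariant_module[OF B]
  \<comment> \<open>At the object \<open>[q]\<close> the term of degree \<open>q + 1\<close> is
    zero, so zero is the only boundary in degree \<open>q\<close>.\<close>
  have im: "x = \<zero>\<^bsub>ob (representable k q) q\<^esub>"
    if "x \<in> rep_diff k q q ` carrier (ob (representable k (Suc q)) q)" for x q
    using that representable_empty[OF k, of q "Suc q"] contra_nat_zero[OF C C RD(3)] by auto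
  note i = representable_gen[OF k epi_mor_id]
  have minus: "\<phi> q n x \<ominus>\<^bsub>ob (representable k q) n\<^esub> x \<in> carrier (ob (representable k q) n)"
    if "x \<in> carrier (ob (representable k q) n)" for q n x
    by (rule contra_nat_closed[OF contra_nat_minus[OF C \<phi> contra_nat_id] that])
  have eq: "\<phi> q n x = x"
    if "\<phi> q n x \<ominus>\<^bsub>ob (representable k q) n\<^esub> x = \<zero>\<^bsub>ob (representable k q) n\<^esub>"
      "x \<in> carrier (ob (representable k q) n)" for q n x
    using that abelian_group.right_minus_eq[OF module.axioms(2)[OF m(1)]] cl by blast
  {
    case 0
    interpret B: module k "ob (b_epi k) 0" by (rule m)
    have "b_epi_proj k 0 (\<phi> 0 0 x \<ominus>\<^bsub>ob (representable k 0) 0\<^esub> x) = \<zero>\<^bsub>ob (b_epi k) 0\<^esub>"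
      if "x \<in> carrier (ob (representable k 0) 0)" for x
      using that contra_nat_closed[OF RD(4) that]
      by (simp add: module_homs_minus[OF m contra_nat_hom[OF RD(4)]] cl \<phi>0 B.M.right_minus_eq)
    \<comment> \<open>By Yoneda it suffices that \<open>\<phi> 0\<close> fixes the identity of
      \<open>[0]\<close>. The augmentation kills the difference, so it is a boundary at
      \<open>[0]\<close> and hence zero.\<close>
    from eq[OF im[OF RD(8)[OF minus[OF i] this[OF i]]] i] show ?case
      by (rule yoneda_ext[OF k C \<phi> contra_nat_id _ 0])
  next
    case (Suc q)
    let ?i = "free_gen k (epi_id (Suc q))"
    interpret R: module k "ob (representable k q) (Suc q)" by (rule m)
    have d: "rep_diff k q (Suc q) ?i \<in> carrier (ob (representable k q) (Suc q))"
      by (rule contra_nat_closed[OF RD(3) i])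
    \<comment> \<open>By induction \<open>\<phi> q\<close> fixes the differential of the identity,
      so the identity and its image differ by a cycle, which is a boundary at an object where
      boundaries vanish.\<close>
    have "rep_diff k q (Suc q) (\<phi> (Suc q) (Suc q) ?i \<ominus>\<^bsub>ob (representable k (Suc q)) (Suc q)\<^esub> ?i) =
        \<zero>\<^bsub>ob (representable k q) (Suc q)\<^esub>"
      using d by (simp add: module_homs_minus[OF m(1,1) contra_nat_hom[OF RD(3)]] cl i \<phi>D Suc.IH
        R.M.right_minus_eq)
    from eq[OF im[OF RD(9)[OF minus[OF i] this]] i] show ?case
      by (rule yoneda_ext[OF k C \<phi> contra_nat_id _ Suc.prems])
  }
qed

theorem proposition2p3:
  fixes k :: "('k, 'z) ring_scheme"
    and F :: "('k, 'a) epi_functor"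
    and p :: nat
  assumes "cring k"
    and "covariant k F"
  shows "module_iso k (bar_homology k F p) (Tor k p (b_epi k) F)"
proof -
  note k = assms(1) and F = assms(2)
  obtain Q D \<epsilon> where QD: "chosen_resolution k (b_epi k) = (Q, D)"
    and res: "projective_resolution k (b_epi k) Q D \<epsilon>"
    by (rule chosen_resolution_b_epi[OF k])
  let ?R = "representable k"
  note B = b_epi_contravariant[OF k] and Rres = representable_resolution[OF k]
  note Q = projective_resolutionD[OF res] and R = projective_resolutionD[OF Rres]
  obtain f where f: "\<And>q. f q \<in> contra_nat k (?R q) (Q q)"
    "\<And>n x. x \<in> carrier (ob (?R 0) n) \<Longrightarrow> \<epsilon> n (f 0 n x) = b_epi_proj k n x"
    "\<And>q n x. x \<in> carrier (ob (?R (Suc q)) n) \<Longrightarrow> D q n (f (Suc q) n x) = f q n (rep_diff k q n x)"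
    by (rule comparison[OF k B Rres res]) blast
  obtain g where g: "\<And>q. g q \<in> contra_nat k (Q q) (?R q)"
    "\<And>n x. x \<in> carrier (ob (Q 0) n) \<Longrightarrow> b_epi_proj k n (g 0 n x) = \<epsilon> n x"
    "\<And>q n x. x \<in> carrier (ob (Q (Suc q)) n) \<Longrightarrow> rep_diff k q n (g (Suc q) n x) = g q n (D q n x)"
    by (rule comparison[OF k B res Rres]) blast
  note fcl = contra_nat_closed[OF f(1)] and gcl = contra_nat_closed[OF g(1)] and Dcl = contra_nat_closed[OF Q(3)]
  \<comment> \<open>The composite is an endomorphism of the representable resolution over
    \<open>b_epi k\<close>, hence exactly the identity, without a homotopy.\<close>
  have gf: "g q n (f q n x) = x" if "x \<in> carrier (ob (?R q) n)" for q n x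
    by (rule representable_resolution_endo[where \<phi> = "\<lambda>q n x. g q n (f q n x)", OF k contra_nat_comp[OF g(1) f(1)] _ _ that])
      (simp_all add: f(2,3) g(2,3) fcl)
  have mQ: "module k (ob (Q q) n)" for q n by (rule contravariant_module[OF Q(2)])
  \<comment> \<open>For the chosen resolution only a homotopy is available: \<open>f g - id\<close>
    covers zero on \<open>b_epi k\<close>, and \<open>s\<close> contracts it.\<close>
  let ?\<psi> = "\<lambda>q n x. f q n (g q n x) \<ominus>\<^bsub>ob (Q q) n\<^esub> x"
  obtain s where s: "\<And>q. s q \<in> contra_nat k (Q q) (Q (Suc q))"
    "\<And>n x. x \<in> carrier (ob (Q 0) n) \<Longrightarrow> ?\<psi> 0 n x = D 0 n (s 0 n x)"
    "\<And>q n x. x \<in> carrier (ob (Q (Suc q)) n) \<Longrightarrow>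
      ?\<psi> (Suc q) n x = D (Suc q) n (s (Suc q) n x) \<oplus>\<^bsub>ob (Q (Suc q)) n\<^esub> s q n (D q n x)"
  proof (rule null_homotopy[where \<phi> = ?\<psi>, OF k B res res])
    show "?\<psi> q \<in> contra_nat k (Q q) (Q q)" for q
      by (rule contra_nat_minus[OF Q(2) contra_nat_comp[OF f(1) g(1)] contra_nat_id])
    show "\<epsilon> n (?\<psi> 0 n x) = \<zero>\<^bsub>ob (b_epi k) n\<^esub>" if "x \<in> carrier (ob (Q 0) n)" for n x
    proof -
      interpret B: module k "ob (b_epi k) n" by (rule contravariant_module[OF B])
      show ?thesis
        using that contra_nat_closed[OF Q(4) that]
        by (simp add: module_homs_minus[OF mQ B.module_axioms contra_nat_hom[OF Q(4)]] f(2) g(2) fcl gcl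
          B.M.right_minus_eq)
    qed
    show "D q n (?\<psi> (Suc q) n x) = ?\<psi> q n (D q n x)" if "x \<in> carrier (ob (Q (Suc q)) n)" for q n x
      using that by (simp add: module_homs_minus[OF mQ mQ contra_nat_hom[OF Q(3)]] fcl gcl f(3) g(3))
  qed blast
  let ?T = "\<lambda>q. tensor k (Q q) F" and ?t = "\<lambda>q. tensor_elem k (Q q) F"
    and ?d = "\<lambda>q. tensor_map k (Q (Suc q)) (Q q) F (D q)"
  let ?S = "\<lambda>q. tensor_map k (Q q) (Q (Suc q)) F (s q)"
  note mF = covariant_module[OF F] and arrF = covariant_arr[OF F]
  note Fcl = module_homs_closed[OF arrF]
  have mT: "module k (?T q)" for q by (rule tensor_is_module[OF k Q(2) F])
  have bal: "balanced k (Q q) F (?T q) (?t q)" for q by (rule tensor_elem_balanced[OF k Q(2) F])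
  note d = tensor_map_hom[OF k Q(2,2) F Q(3)] and S = tensor_map_hom[OF k Q(2,2) F s(1)]
  note d_elem = tensor_map_elem[OF k Q(2,2) F Q(3)] and S_elem = tensor_map_elem[OF k Q(2,2) F s(1)]
  note ext = tensor_hom_ext[OF k Q(2) F]
  note t1 = balancedD(1)[OF bal] and t2 = balancedD(2)[OF bal] and t3 = balancedD(3)[OF bal]
  \<comment> \<open>By Yoneda this element determines \<open>f n\<close>; tensoring with it will be
    the map from \<open>F[n]\<close> to the chosen complex.\<close>
  let ?u = "\<lambda>n. f n n (free_gen k (epi_id n))"
  have gen: "free_gen k h \<in> carrier (ob (?R n) m)" if "h \<in> epi_mor m n" for m n h
    by (rule representable_gen[OF k that])
  have u: "?u n \<in> carrier (ob (Q n) n)" for n by (rule fcl[OF gen[OF epi_mor_id]])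
  have f_gen: "f n m (free_gen k h) = arr (Q n) m n h (?u n)" if h: "h \<in> epi_mor m n" for m n h
    using contra_nat_arr[OF f(1) h gen[OF epi_mor_id]]
    by (simp add: representable_arr_gen[OF k h epi_mor_id] epi_mor_id_compose[OF h])
  \<comment> \<open>In the representable complex the differential of the identity of
    \<open>[n + 1]\<close> is the alternating sum of the faces. The chain map \<open>f\<close> turns
    each face into its action on \<open>?u n\<close>; moving it across the tensor sign later gives
    \<open>bar_diff\<close>.\<close>
  have Du: "D n (Suc n) (?u (Suc n)) = alt_sum k (ob (Q n) (Suc n)) n (\<lambda>i. arr (Q n) (Suc n) n (face (Suc n) i) (?u n))" for n
  proof -
    have "D n (Suc n) (?u (Suc n)) = f n (Suc n) (alt_sum k (ob (?R n) (Suc n)) n (\<lambda>i. free_gen k (face (Suc n) i)))"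
      unfolding f(3)[OF gen[OF epi_mor_id]] rep_diff_gen[OF k epi_mor_id]
      by (rule arg_cong[where f = "f n (Suc n)"], rule alt_sum_cong[OF representable_module[OF k]])
        (simp_all add: epi_mor_compose_id[OF face_epi] gen face_epi)
    also have "\<dots> = alt_sum k (ob (Q n) (Suc n)) n (\<lambda>i. f n (Suc n) (free_gen k (face (Suc n) i)))"
      by (rule alt_sum_hom[OF representable_module[OF k] mQ contra_nat_hom[OF f(1)] gen[OF face_epi]])
    also have "\<dots> = alt_sum k (ob (Q n) (Suc n)) n (\<lambda>i. arr (Q n) (Suc n) n (face (Suc n) i) (?u n))"
      by (rule alt_sum_cong[OF mQ f_gen[OF face_epi]])
        (assumption, rule module_homs_closed[OF contravariant_arr[OF Q(2) face_epi] u], assumption)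
    finally show ?thesis .
  qed
  let ?l = "\<lambda>n m y. free_lift k (ob F n) (\<lambda>h. arr F m n h y)"
  have lift: "?l n m y \<in> module_homs k (ob (?R n) m) (ob F n)" if "y \<in> carrier (ob F m)" for n m y
    unfolding ob_representable by (rule free_lift_hom[OF k mF]) (auto intro: Fcl that)
  have lift_gen: "?l n m y (free_gen k h) = arr F m n h y" if "y \<in> carrier (ob F m)" "h \<in> epi_mor m n" for n m y h
    by (rule free_lift_gen[of k _ "\<lambda>h. arr F m n h y", OF k mF]) (rule Fcl[OF that(2,1)])
  have "\<exists>\<beta>. \<beta> \<in> module_homs k (?T n) (ob F n) \<and>
      (\<forall>m x y. x \<in> carrier (ob (Q n) m) \<longrightarrow> y \<in> carrier (ob F m) \<longrightarrow> \<beta> (?t n m x y) = ?l n m y (g n m x))" for n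
    by (rule tensor_lift[OF k Q(2) F mF free_lift_arr_balanced[OF k F g(1)]]) blast
  then obtain \<beta> where \<beta>: "\<And>n. \<beta> n \<in> module_homs k (?T n) (ob F n)"
    "\<And>n m x y. x \<in> carrier (ob (Q n) m) \<Longrightarrow> y \<in> carrier (ob F m) \<Longrightarrow> \<beta> n (?t n m x y) = ?l n m y (g n m x)"
    by metis
  let ?\<alpha> = "\<lambda>n. ?t n n (?u n)"
  have \<alpha>: "?\<alpha> n \<in> module_homs k (ob F n) (?T n)" for n by (rule t2[OF u])
  \<comment> \<open>Both sides are linear in the vector \<open>g n m x\<close>, so it may be
    replaced by a basis element \<open>h\<close>; there the coend relation moves \<open>h\<close>
    from \<open>y\<close> to \<open>?u n\<close>, and \<open>f_gen\<close> identifies the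
    result.\<close>
  have \<alpha>\<beta>_elem: "?\<alpha> n (\<beta> n (?t n m x y)) = ?t n m (f n m (g n m x)) y"
    if x: "x \<in> carrier (ob (Q n) m)" and y: "y \<in> carrier (ob F m)" for n m x y
    unfolding \<beta>(2)[OF x y]
  proof (rule representable_hom_ext[OF k mT module_homs_comp[OF \<alpha> lift[OF y]]
        module_homs_comp[OF t1[OF y] contra_nat_hom[OF f(1)]] _ gcl[OF x]])
    fix h assume h: "h \<in> epi_mor m n"
    show "?\<alpha> n (?l n m y (free_gen k h)) = ?t n m (f n m (free_gen k h)) y"
      unfolding lift_gen[OF y h] f_gen[OF h] by (rule t3[OF h u y, symmetric])
  qed
  \<comment> \<open>Thus the defect of \<open>?\<alpha>\<close> after \<open>\<beta>\<close> is the
    map induced by \<open>?\<psi>\<close> on the first tensor factor, and \<open>?S\<close>, induced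
    by \<open>s\<close>, is a homotopy for it.\<close>
  have minus_elem: "?\<alpha> n (\<beta> n (?t n m x y)) \<ominus>\<^bsub>?T n\<^esub> ?t n m x y = ?t n m (?\<psi> n m x) y"
    if x: "x \<in> carrier (ob (Q n) m)" and y: "y \<in> carrier (ob F m)" for n m x y
    unfolding \<alpha>\<beta>_elem[OF x y] using module_homs_minus[OF mQ mT t1[OF y] fcl[OF gcl[OF x]] x] ..
  have \<alpha>\<beta>_hom: "(\<lambda>z. ?\<alpha> n (\<beta> n z) \<ominus>\<^bsub>?T n\<^esub> z) \<in> module_homs k (?T n) (?T n)" for n
    by (rule module_homs_minus_map[OF mT module_homs_comp[OF \<alpha> \<beta>(1)] module_homs_id])
  have "module_iso k (homology (ob F) (bar_diff k F) p) (homology ?T ?d p)"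
  proof (rule homology_iso[where \<alpha> = ?\<alpha> and \<beta> = \<beta>, OF mF bar_diff_hom[OF F] bar_diff_bar_diff[OF F] mT d _ \<alpha> \<beta>(1)])
    show "?d n (?d (Suc n) z) = \<zero>\<^bsub>?T n\<^esub>" if "z \<in> carrier (?T (Suc (Suc n)))" for n z
      by (rule ext[OF mT module_homs_comp[OF d d] module_homs_zero_map[OF mT] _ that])
        (simp add: d_elem Dcl Q(7) module_homs_zero[OF mQ mT t1])
    show "?d n (?\<alpha> (Suc n) y) = ?\<alpha> n (bar_diff k F n y)" if y: "y \<in> carrier (ob F (Suc n))" for n y
    proof -
      have "?d n (?\<alpha> (Suc n) y) =
          alt_sum k (?T n) n (\<lambda>i. ?t n (Suc n) (arr (Q n) (Suc n) n (face (Suc n) i) (?u n)) y)"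
        unfolding d_elem[OF u y] Du
        by (rule alt_sum_hom[OF mQ mT t1[OF y] module_homs_closed[OF contravariant_arr[OF Q(2) face_epi] u]])
      also have "\<dots> = alt_sum k (?T n) n (\<lambda>i. ?\<alpha> n (arr F (Suc n) n (face (Suc n) i) y))"
        by (rule alt_sum_cong[OF mT t3[OF face_epi u y] module_homs_closed[OF \<alpha> Fcl[OF face_epi y]]])
      also have "\<dots> = ?\<alpha> n (bar_diff k F n y)"
        unfolding bar_diff_alt_sum by (rule alt_sum_hom[OF mF mT \<alpha> Fcl[OF face_epi y], symmetric])
      finally show ?thesis .
    qed
    show "bar_diff k F n (\<beta> (Suc n) z) = \<beta> n (?d n z)" if "z \<in> carrier (?T (Suc n))" for n z
    proof (rule ext[OF mF module_homs_comp[OF bar_diff_hom[OF F] \<beta>(1)] module_homs_comp[OF \<beta>(1) d] _ that])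
      fix m x y assume x: "x \<in> carrier (ob (Q (Suc n)) m)" and y: "y \<in> carrier (ob F m)"
      \<comment> \<open>As \<open>g\<close> is a chain map, it remains to see that pairing with
        \<open>y\<close> turns \<open>rep_diff\<close> into \<open>bar_diff\<close>. On a basis
        element \<open>h\<close> this is functoriality of \<open>F\<close> applied to a face
        composed with \<open>h\<close>.\<close>
      have "bar_diff k F n (?l (Suc n) m y (g (Suc n) m x)) = ?l n m y (rep_diff k n m (g (Suc n) m x))"
      proof (rule representable_hom_ext[OF k mF module_homs_comp[OF bar_diff_hom[OF F] lift[OF y]]
            module_homs_comp[OF lift[OF y] contra_nat_hom[OF R(3)]] _ gcl[OF x]])
        fix h assume h: "h \<in> epi_mor m (Suc n)"
        have h': "compose {0..m} (face (Suc n) i) h \<in> epi_mor m n" if "i \<le> n" for i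
          by (rule epi_mor_compose[OF h face_epi[OF that]])
        have "?l n m y (rep_diff k n m (free_gen k h)) =
            alt_sum k (ob F n) n (\<lambda>i. ?l n m y (free_gen k (compose {0..m} (face (Suc n) i) h)))"
          unfolding rep_diff_gen[OF k h]
          by (rule alt_sum_hom[OF representable_module[OF k] mF lift[OF y] gen[OF h']])
        also have "\<dots> = alt_sum k (ob F n) n (\<lambda>i. arr F (Suc n) n (face (Suc n) i) (arr F m (Suc n) h y))"
          by (rule alt_sum_cong[OF mF])
            (simp_all add: lift_gen[OF y h'] covariant_comp[OF F h face_epi y] Fcl[OF face_epi Fcl[OF h y]])
        finally show "bar_diff k F n (?l (Suc n) m y (free_gen k h)) = ?l n m y (rep_diff k n m (free_gen k h))"
          unfolding lift_gen[OF y h] bar_diff_alt_sum by (rule sym)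
      qed
      then show "bar_diff k F n (\<beta> (Suc n) (?t (Suc n) m x y)) = \<beta> n (?d n (?t (Suc n) m x y))"
        by (simp add: \<beta>(2) x y d_elem Dcl g(3))
    qed
    \<comment> \<open>The strict identity \<open>gf\<close> enters here: \<open>g\<close> returns
      \<open>?u n\<close> to the identity of \<open>[n]\<close>, and pairing that with
      \<open>y\<close> gives \<open>y\<close>.\<close>
    show "\<beta> n (?\<alpha> n y) = y" if y: "y \<in> carrier (ob F n)" for n y
      unfolding \<beta>(2)[OF u y] gf[OF gen[OF epi_mor_id]] lift_gen[OF y epi_mor_id] by (rule covariant_id[OF F y])
    fix z assume z: "z \<in> cycles ?T ?d p"
    show "?\<alpha> p (\<beta> p z) \<ominus>\<^bsub>?T p\<^esub> z \<in> boundaries ?T ?d p"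
    \<comment> \<open>In degree 0 the homotopy has a single term. In positive degrees a second term
      contains the differential of \<open>z\<close>, and drops out because \<open>z\<close> is a
      cycle.\<close>
    proof (cases p)
      case 0
      have z0: "z \<in> carrier (?T 0)" using z 0 by (simp add: cycles_def)
      have "?\<alpha> 0 (\<beta> 0 z) \<ominus>\<^bsub>?T 0\<^esub> z = ?d 0 (?S 0 z)"
      proof (rule ext[OF mT \<alpha>\<beta>_hom module_homs_comp[OF d S] _ z0])
        fix m x y assume x: "x \<in> carrier (ob (Q 0) m)" and y: "y \<in> carrier (ob F m)"
        show "?\<alpha> 0 (\<beta> 0 (?t 0 m x y)) \<ominus>\<^bsub>?T 0\<^esub> ?t 0 m x y = ?d 0 (?S 0 (?t 0 m x y))"
          unfolding minus_elem[OF x y] S_elem[OF x y] d_elem[OF contra_nat_closed[OF s(1) x] y] s(2)[OF x] ..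
      qed
      then show ?thesis
        using module_homs_closed[OF S z0] 0 by (simp add: boundaries_def)
    next
      case (Suc q)
      have zq: "z \<in> carrier (?T (Suc q))" and dz: "?d q z = \<zero>\<^bsub>?T q\<^esub>" using z Suc by (simp_all add: cycles_def)
      have "?\<alpha> (Suc q) (\<beta> (Suc q) z) \<ominus>\<^bsub>?T (Suc q)\<^esub> z = ?d (Suc q) (?S (Suc q) z) \<oplus>\<^bsub>?T (Suc q)\<^esub> ?S q (?d q z)"
      proof (rule ext[OF mT \<alpha>\<beta>_hom module_homs_add_map[OF mT module_homs_comp[OF d S] module_homs_comp[OF S d]] _ zq])
        fix m x y assume x: "x \<in> carrier (ob (Q (Suc q)) m)" and y: "y \<in> carrier (ob F m)"
        note sx = contra_nat_closed[OF s(1) x] and Dx = Dcl[OF x]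
        show "?\<alpha> (Suc q) (\<beta> (Suc q) (?t (Suc q) m x y)) \<ominus>\<^bsub>?T (Suc q)\<^esub> ?t (Suc q) m x y =
            ?d (Suc q) (?S (Suc q) (?t (Suc q) m x y)) \<oplus>\<^bsub>?T (Suc q)\<^esub> ?S q (?d q (?t (Suc q) m x y))"
          unfolding minus_elem[OF x y] S_elem[OF x y] d_elem[OF sx y] d_elem[OF x y] S_elem[OF Dx y] s(3)[OF x]
          by (rule module_homs_add[OF t1[OF y] Dcl[OF sx] contra_nat_closed[OF s(1) Dx]])
      qed
      moreover have "?S q (?d q z) = \<zero>\<^bsub>?T (Suc q)\<^esub>"
        unfolding dz by (rule module_homs_zero[OF mT mT S])
      moreover have "?d (Suc q) (?S (Suc q) z) \<oplus>\<^bsub>?T (Suc q)\<^esub> \<zero>\<^bsub>?T (Suc q)\<^esub> = ?d (Suc q) (?S (Suc q) z)"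
        using module_homs_closed[OF d module_homs_closed[OF S zq]] mT
        by (simp add: module_def abelian_group_def abelian_monoid.r_zero)
      ultimately show ?thesis
        using module_homs_closed[OF S zq] Suc by (simp add: boundaries_def)
    qed
  qed
  then show ?thesis
    by (simp add: bar_homology_def Tor_def QD)
qed

end
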